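(* Let $m$ be an integer with $0\le m\le k$, let $r\ge m$, and put $s=\min(r,p+1)$. Let $\pi_h^Ev:=E_h\pi_hv$ for $v\in L^2(\Omega)$. There is a constant $C>0$, independent of $h$ and of how $\partial\Omega$ intersects the mesh, such that for all $h\in(0,h_0]$ and all $v\in H^r(\Omega)$, $$\|v-\pi_h^Ev\|_{H^m(\Omega_h)}\le C\,h^{s-m}\,\|v\|_{H^s(\Omega)},$$ where on the left-hand side $v$ stands for its extension $v^E$ to $\mathbb{R}^d$.
   Context: Spline spaces. $\widetilde{\mathcal{T}}_h$ is a uniform tensor product mesh of $\mathbb{R}^d$ with mesh parameter $h\in(0,h_0]$. $\mathbb{Q}_p(T)$ is the space of tensor product polynomials of degree $p$ (degree at most $p$ in each variable) on $T$. For $0\le k\le p-1$, $\widetilde V_{h,p,k}\subset C^k(\mathbb{R}^d)$ is the spline space of $C^k$ functions that are in $\mathbb{Q}_p(T)$ on each $T\in\widetilde{\mathcal{T}}_h$ (polynomials are represented exactly). $\widetilde{\mathcal{B}}=\{\varphi_i\}_{i\in\widetilde I}$ is a basis of $\widetilde V_{h,p,k}$ satisfying, with constants independent of $h$: (A1) local support: the number of elements contained in $\operatorname{supp}\varphi_i$ is uniformly bounded and $\operatorname{diam}(\operatorname{supp}\varphi_i)\lesssim h$; (A2) for each element $T$ the restrictions to $T$ of the basis functions $\varphi_i$ with $T\subset\operatorname{supp}\varphi_i$ form a basis of $\mathbb{Q}_p(T)$, and this basis is stable: if $v=\sum_i \widehat v_{T,i}\varphi_i|_T\in\mathbb{Q}_p(T)$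 then $h^d\sum_i|\widehat v_{T,i}|^2\sim\|v\|_{L^2(T)}^2$. Active objects. $\Omega\subset\mathbb{R}^d$ is a domain with Lipschitz boundary. $\mathcal{T}_h=\{T\in\widetilde{\mathcal{T}}_h: T\cap\Omega\ne\emptyset\}$, $\Omega_h=\bigcup_{T\in\mathcal{T}_h}T$. $I$ is the set of indices $i$ such that $\operatorname{supp}\varphi_i$ contains some $T\in\mathcal{T}_h$; $\mathcal{B}=\{\varphi_i\}_{i\in I}$; $V_{h,p,k}=\operatorname{span}\mathcal{B}$. $V_{h,p,-1}$ is the space of discontinuous functions on $\Omega_h$ that are in $\mathbb{Q}_p(T)$ on each $T\in\mathcal{T}_h$. For $T\in\mathcal{T}_h$, $I_T=\{i\in I: T\subset\operatorname{supp}\varphi_i\}$, and for $i\in I$, $\mathcal{T}_{h,i}=\{T\in\mathcal{T}_h:T\subset\operatorname{supp}\varphi_i\}$. Continuous extension. $E:H^s(\Omega)\to H^s(\mathbb{R}^d)$, $v\mapsto v^E$, is a linear extension operator, the same for all $s$ (Stein's operator), with $\|v^E\|_{H^s(\mathbb{R}^d)}\lesssim\|v\|_{H^s(\Omega)}$. Interpolation operator. For $T\in\mathcal{T}_h$ let $P_{T,p}:L^2(T)\to\mathbb{Q}_p(T)$ be the $L^2(T)$ projection, and for $v\in L^2(\Omega_h)$ write $P_{T,p}(v|_T)=\sum_{i\in I_T}\widehat v_{T,i}\varphi_i|_T$. Then $\pi_h v=\sum_{i\in I}\big(\sum_{T\in\mathcal{T}_{h,i}}\kappa_{T,i}\widehat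 v_{T,i}\big)\varphi_i$, with arbitrary weights $0\le\kappa_{T,i}\le1$, $\sum_{T\in\mathcal{T}_{h,i}}\kappa_{T,i}=1$. For $v\in L^2(\Omega)$, $\pi_hv:=\pi_h(v^E|_{\Omega_h})$. Extension operator. Fix $\gamma\ge0$. The large elements are $\mathcal{T}_h^L=\{T\in\mathcal{T}_h:\gamma h^d\le|T\cap\Omega|\}$ and the small elements are $\mathcal{T}_h^S=\mathcal{T}_h\setminus\mathcal{T}_h^L$. $S_h:\mathcal{T}_h^S\to\mathcal{T}_h^L$ is a mapping with $\operatorname{diam}(S_h(T)\cup T)\lesssim h$ (such a mapping exists for sufficiently fine meshes). The operator $B_h$, with values in $V_{h,p,-1}$, is defined by $(B_hv)|_T=v|_T$ for $T\in\mathcal{T}_h^L$ and $(B_hv)|_T=(v|_{S_h(T)})^e|_T$ for $T\in\mathcal{T}_h^S$, where $q^e$ is the canonical extension of a polynomial $q$ on an element to a polynomial on $\mathbb{R}^d$. Finally $E_hv=\pi_hB_hv\in V_{h,p,k}$. (The paper introduces $B_h,E_h$ on the span $V^L_{h,p,k}$ of the basis functions having a large element in their support, but $B_hv$ and $E_hv$ depend only on $v$ on the large elements, so they are defined for all $v\in V_{h,p,k}$.) Constants may depend on $p,k,d,r,m,h_0,\gamma,\Omega$ and the constants in (A1), (A2) and in the bound on $\operatorname{diam}(S_h(T)\cup T)$. *)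

theory Defs
  imports "HOL-Analysis.Analysis" "HOL-Library.Multiset"
begin

section \<open>Classical derivatives and test functions\<close>

definition supp :: "(real^'n \<Rightarrow> real) \<Rightarrow> (real^'n) set" where
  "supp f = closure {x. f x \<noteq> 0}"

definition partial_deriv :: "'n::finite \<Rightarrow> (real^'n \<Rightarrow> real) \<Rightarrow> real^'n \<Rightarrow> real" where
  "partial_deriv i f x = frechet_derivative f (at x) (axis i 1)"

fun Ck :: "nat \<Rightarrow> (real^'n \<Rightarrow> real) \<Rightarrow> bool" where
  "Ck 0 f = continuous_on UNIV f"
| "Ck (Suc k) f = ((\<forall>x. f differentiable (at x)) \<and> (\<forall>i. Ck k (partial_deriv i f)))"

text \<open>A multi-index is a multiset of coordinate directions; its order is its size.
  The order in which the partial derivatives are taken is left open: the operator below is applied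
  to smooth functions only, for which it is irrelevant.\<close>

definition multi_deriv :: "'n::finite multiset \<Rightarrow> (real^'n \<Rightarrow> real) \<Rightarrow> real^'n \<Rightarrow> real" where
  "multi_deriv \<alpha> f = foldr partial_deriv (SOME js. mset js = \<alpha>) f"

definition test_function :: "(real^'n) set \<Rightarrow> (real^'n \<Rightarrow> real) \<Rightarrow> bool" where
  "test_function U \<psi> \<longleftrightarrow> (\<forall>k. Ck k \<psi>) \<and> compact (supp \<psi>) \<and> supp \<psi> \<subseteq> U"


section \<open>Sobolev spaces on open sets\<close>

text \<open>Elements are represented by functions on the whole space, of which only the values almost
  everywhere on \<open>U\<close> matter. Every class has a Borel representative, so \<open>lborel\<close> suffices.\<close>

definition L2_space :: "(real^'n) set \<Rightarrow> (real^'n \<Rightarrow> real) set" where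
  "L2_space U = {u. set_borel_measurable lborel U u \<and> set_integrable lborel U (\<lambda>x. (u x)\<^sup>2)}"

definition locally_integrable :: "(real^'n) set \<Rightarrow> (real^'n \<Rightarrow> real) \<Rightarrow> bool" where
  "locally_integrable U u \<longleftrightarrow> (\<forall>K. compact K \<and> K \<subseteq> U \<longrightarrow> set_integrable lborel K u)"

definition has_weak_deriv ::
    "(real^'n) set \<Rightarrow> 'n::finite multiset \<Rightarrow> (real^'n \<Rightarrow> real) \<Rightarrow> (real^'n \<Rightarrow> real) \<Rightarrow> bool" where
  "has_weak_deriv U \<alpha> u w \<longleftrightarrow>
     locally_integrable U u \<and> locally_integrable U w \<and>
     (\<forall>\<psi>. test_function U \<psi> \<longrightarrow>
        (LINT x:U|lborel. u x * multi_deriv \<alpha> \<psi> x) =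
        (-1) ^ size \<alpha> * (LINT x:U|lborel. w x * \<psi> x))"

text \<open>Weak derivatives are unique almost everywhere on \<open>U\<close>, so the choice does not matter.\<close>

definition weak_deriv ::
    "(real^'n) set \<Rightarrow> 'n::finite multiset \<Rightarrow> (real^'n \<Rightarrow> real) \<Rightarrow> real^'n \<Rightarrow> real" where
  "weak_deriv U \<alpha> u = (SOME w. has_weak_deriv U \<alpha> u w)"

text \<open>The square of the Sobolev-Slobodeckij seminorm of order \<open>\<sigma> \<in> (0,1)\<close>.\<close>

definition slobodeckij :: "real \<Rightarrow> (real^'n) set \<Rightarrow> (real^'n \<Rightarrow> real) \<Rightarrow> ennreal" where
  "slobodeckij \<sigma> U w =
     (\<integral>\<^sup>+x\<in>U. (\<integral>\<^sup>+y\<in>U. ennreal ((w x - w y)\<^sup>2 / norm (x - y) powr (real CARD('n) + 2 * \<sigma>))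
        \<partial>lborel) \<partial>lborel)"

text \<open>\<open>H\<^sup>s(U)\<close> for real \<open>s \<ge> 0\<close>: the classical integer order space if \<open>s\<close> is an integer, and the
  Sobolev-Slobodeckij space otherwise.\<close>

definition sobolev :: "real \<Rightarrow> (real^'n) set \<Rightarrow> (real^'n \<Rightarrow> real) set" where
  "sobolev s U =
     {u. u \<in> L2_space U \<and>
         (\<forall>\<alpha>. size \<alpha> \<le> nat \<lfloor>s\<rfloor> \<longrightarrow>
            (\<exists>w. has_weak_deriv U \<alpha> u w \<and> w \<in> L2_space U)) \<and>
         (frac s \<noteq> 0 \<longrightarrow>
            (\<forall>\<alpha>. size \<alpha> = nat \<lfloor>s\<rfloor> \<longrightarrow> slobodeckij (frac s) U (weak_deriv U \<alpha> u) < \<infinity>))}"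

definition sobolev_norm :: "real \<Rightarrow> (real^'n) set \<Rightarrow> (real^'n \<Rightarrow> real) \<Rightarrow> real" where
  "sobolev_norm s U u =
     sqrt ((\<Sum>\<alpha> | size \<alpha> \<le> nat \<lfloor>s\<rfloor>. LINT x:U|lborel. (weak_deriv U \<alpha> u x)\<^sup>2) +
           (if frac s = 0 then 0
            else \<Sum>\<alpha> | size \<alpha> = nat \<lfloor>s\<rfloor>. enn2real (slobodeckij (frac s) U (weak_deriv U \<alpha> u))))"


section \<open>Lipschitz domains and extension operators\<close>

text \<open>Near each boundary point, \<open>\<Omega>\<close> is the set above the graph, in some direction \<open>e\<close>, of a
  Lipschitz function of the coordinates orthogonal to \<open>e\<close>. Boundedness is not required.\<close>

definition lipschitz_domain :: "(real^'n) set \<Rightarrow> bool" where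
  "lipschitz_domain \<Omega> \<longleftrightarrow>
     open \<Omega> \<and> connected \<Omega> \<and> \<Omega> \<noteq> {} \<and>
     (\<forall>x0 \<in> frontier \<Omega>. \<exists>e (g :: real^'n \<Rightarrow> real) L \<rho>.
        norm e = 1 \<and> L-lipschitz_on UNIV g \<and> (\<forall>y t. g (y + t *\<^sub>R e) = g y) \<and> \<rho> > 0 \<and>
        (\<forall>x \<in> ball x0 \<rho>. x \<in> \<Omega> \<longleftrightarrow> g x < x \<bullet> e))"

definition extension_operator ::
    "(real^'n) set \<Rightarrow> ((real^'n \<Rightarrow> real) \<Rightarrow> (real^'n \<Rightarrow> real)) \<Rightarrow> bool" where
  "extension_operator \<Omega> E \<longleftrightarrow>
     (\<forall>u \<in> L2_space \<Omega>. AE x in lborel. x \<in> \<Omega> \<longrightarrow> E u x = u x) \<and>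
     (\<forall>u \<in> L2_space \<Omega>. \<forall>v \<in> L2_space \<Omega>. \<forall>a b.
        AE x in lborel. E (\<lambda>y. a * u y + b * v y) x = a * E u x + b * E v x) \<and>
     (\<forall>s \<ge> 0. \<exists>C. \<forall>u \<in> sobolev s \<Omega>.
        E u \<in> sobolev s UNIV \<and> sobolev_norm s UNIV (E u) \<le> C * sobolev_norm s \<Omega> u)"


section \<open>Meshes and spline spaces\<close>

text \<open>The uniform mesh of closed cubes of side \<open>h\<close> with a vertex at \<open>a\<close>. The offset \<open>a\<close> describes
  the position of the mesh relative to the domain.\<close>

definition uniform_mesh :: "real \<Rightarrow> real^'n \<Rightarrow> (real^'n) set set" where
  "uniform_mesh h a =
     range (\<lambda>z :: int^'n. cbox (\<chi> i. a $ i + h * of_int (z $ i))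
                               (\<chi> i. a $ i + h * (of_int (z $ i) + 1)))"

text \<open>Polynomials in \<open>Q\<^sub>p\<close>, as functions on the whole space.\<close>

definition Qpoly :: "nat \<Rightarrow> (real^'n \<Rightarrow> real) set" where
  "Qpoly p = range (\<lambda>c x. \<Sum>\<alpha> | \<forall>i. \<alpha> i \<le> p. c \<alpha> * (\<Prod>i\<in>UNIV. (x $ i) ^ \<alpha> i))"

definition spline_space :: "nat \<Rightarrow> nat \<Rightarrow> real \<Rightarrow> real^'n \<Rightarrow> (real^'n \<Rightarrow> real) set" where
  "spline_space p k h a =
     {f. Ck k f \<and> (\<forall>T \<in> uniform_mesh h a. \<exists>q \<in> Qpoly p. \<forall>x\<in>T. f x = q x)}"

text \<open>The spline space on the full mesh is infinite dimensional, and its basis is to be understood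
  in the sense of locally finite linear combinations: at each point only finitely many basis
  functions are nonzero (a consequence of the local basis property below).\<close>

definition basis_comb ::
    "'i set \<Rightarrow> ('i \<Rightarrow> real^'n \<Rightarrow> real) \<Rightarrow> ('i \<Rightarrow> real) \<Rightarrow> real^'n \<Rightarrow> real" where
  "basis_comb I \<phi> c x = (\<Sum>i | i \<in> I \<and> \<phi> i x \<noteq> 0. c i * \<phi> i x)"

definition is_basis ::
    "(real^'n \<Rightarrow> real) set \<Rightarrow> 'i set \<Rightarrow> ('i \<Rightarrow> real^'n \<Rightarrow> real) \<Rightarrow> bool" where
  "is_basis V I \<phi> \<longleftrightarrow>
     (\<forall>i \<in> I. \<phi> i \<in> V) \<and>
     (\<forall>f \<in> V. \<exists>c. f = basis_comb I \<phi> c) \<and>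
     (\<forall>c. basis_comb I \<phi> c = (\<lambda>x. 0) \<longrightarrow> (\<forall>i \<in> I. c i = 0))"

text \<open>Local support, with \<open>N\<close> bounding the number of elements in the support of a basis function
  and \<open>C1\<close> its diameter relative to \<open>h\<close>.\<close>

definition local_support ::
    "nat \<Rightarrow> real \<Rightarrow> real \<Rightarrow> real^'n \<Rightarrow> 'i set \<Rightarrow> ('i \<Rightarrow> real^'n \<Rightarrow> real) \<Rightarrow> bool" where
  "local_support N C1 h a I \<phi> \<longleftrightarrow>
     (\<forall>i \<in> I. finite {T \<in> uniform_mesh h a. T \<subseteq> supp (\<phi> i)} \<and>
              card {T \<in> uniform_mesh h a. T \<subseteq> supp (\<phi> i)} \<le> N \<and>
              bounded (supp (\<phi> i)) \<and> diameter (supp (\<phi> i)) \<le> C1 * h)"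

text \<open>The restrictions of the basis functions to an element form a stable basis of \<open>Q\<^sub>p\<close>, with
  stability constants \<open>c2\<close> and \<open>C2\<close>. That the restrictions belong to \<open>Q\<^sub>p\<close> is part of
  \<^const>\<open>spline_space\<close>.\<close>

definition stable_local_basis ::
    "nat \<Rightarrow> real \<Rightarrow> real \<Rightarrow> real \<Rightarrow> real^'n \<Rightarrow> 'i set \<Rightarrow> ('i \<Rightarrow> real^'n \<Rightarrow> real) \<Rightarrow> bool" where
  "stable_local_basis p c2 C2 h a I \<phi> \<longleftrightarrow>
     (\<forall>T \<in> uniform_mesh h a. let J = {i \<in> I. T \<subseteq> supp (\<phi> i)} in
        finite J \<and>
        (\<forall>q \<in> Qpoly p. \<exists>c. \<forall>x\<in>T. q x = (\<Sum>i\<in>J. c i * \<phi> i x)) \<and>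
        (\<forall>c. (\<forall>x\<in>T. (\<Sum>i\<in>J. c i * \<phi> i x) = 0) \<longrightarrow> (\<forall>i\<in>J. c i = 0)) \<and>
        (\<forall>c. c2 * (h ^ CARD('n) * (\<Sum>i\<in>J. (c i)\<^sup>2))
                \<le> (LINT x:T|lborel. (\<Sum>i\<in>J. c i * \<phi> i x)\<^sup>2) \<and>
             (LINT x:T|lborel. (\<Sum>i\<in>J. c i * \<phi> i x)\<^sup>2)
                \<le> C2 * (h ^ CARD('n) * (\<Sum>i\<in>J. (c i)\<^sup>2))))"


section \<open>Active objects\<close>

definition active_mesh :: "real \<Rightarrow> real^'n \<Rightarrow> (real^'n) set \<Rightarrow> (real^'n) set set" where
  "active_mesh h a \<Omega> = {T \<in> uniform_mesh h a. T \<inter> \<Omega> \<noteq> {}}"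

text \<open>In what follows, \<open>Th\<close> is the active mesh, \<open>I\<close> the index set of the basis on the full mesh, and
  the set defined next is the set of active indices.\<close>

definition active_index ::
    "(real^'n) set set \<Rightarrow> 'i set \<Rightarrow> ('i \<Rightarrow> real^'n \<Rightarrow> real) \<Rightarrow> 'i set" where
  "active_index Th I \<phi> = {i \<in> I. \<exists>T \<in> Th. T \<subseteq> supp (\<phi> i)}"

definition local_index ::
    "(real^'n) set set \<Rightarrow> 'i set \<Rightarrow> ('i \<Rightarrow> real^'n \<Rightarrow> real) \<Rightarrow> (real^'n) set \<Rightarrow> 'i set" where
  "local_index Th I \<phi> T = {i \<in> active_index Th I \<phi>. T \<subseteq> supp (\<phi> i)}"

definition local_elements ::
    "(real^'n) set set \<Rightarrow> ('i \<Rightarrow> real^'n \<Rightarrow> real) \<Rightarrow> 'i \<Rightarrow> (real^'n) set set" where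
  "local_elements Th \<phi> i = {T \<in> Th. T \<subseteq> supp (\<phi> i)}"


section \<open>The interpolation operator\<close>

definition L2_proj :: "nat \<Rightarrow> (real^'n) set \<Rightarrow> (real^'n \<Rightarrow> real) \<Rightarrow> real^'n \<Rightarrow> real" where
  "L2_proj p T v =
     (THE q. q \<in> Qpoly p \<and> (\<forall>w \<in> Qpoly p. (LINT x:T|lborel. (v x - q x) * w x) = 0))"

definition local_coeff ::
    "nat \<Rightarrow> (real^'n) set set \<Rightarrow> 'i set \<Rightarrow> ('i \<Rightarrow> real^'n \<Rightarrow> real) \<Rightarrow> (real^'n) set \<Rightarrow>
     (real^'n \<Rightarrow> real) \<Rightarrow> 'i \<Rightarrow> real" where
  "local_coeff p Th I \<phi> T v =
     (THE c. (\<forall>i. i \<notin> local_index Th I \<phi> T \<longrightarrow> c i = 0) \<and>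
             (\<forall>x\<in>T. L2_proj p T v x = (\<Sum>i\<in>local_index Th I \<phi> T. c i * \<phi> i x)))"

definition interp_weights ::
    "(real^'n) set set \<Rightarrow> 'i set \<Rightarrow> ('i \<Rightarrow> real^'n \<Rightarrow> real) \<Rightarrow>
     ((real^'n) set \<Rightarrow> 'i \<Rightarrow> real) \<Rightarrow> bool" where
  "interp_weights Th I \<phi> \<kappa> \<longleftrightarrow>
     (\<forall>i \<in> active_index Th I \<phi>.
        (\<forall>T \<in> local_elements Th \<phi> i. 0 \<le> \<kappa> T i \<and> \<kappa> T i \<le> 1) \<and>
        (\<Sum>T \<in> local_elements Th \<phi> i. \<kappa> T i) = 1)"

definition interp ::
    "nat \<Rightarrow> (real^'n) set set \<Rightarrow> 'i set \<Rightarrow> ('i \<Rightarrow> real^'n \<Rightarrow> real) \<Rightarrow>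
     ((real^'n) set \<Rightarrow> 'i \<Rightarrow> real) \<Rightarrow> (real^'n \<Rightarrow> real) \<Rightarrow> real^'n \<Rightarrow> real" where
  "interp p Th I \<phi> \<kappa> v =
     basis_comb (active_index Th I \<phi>) \<phi>
       (\<lambda>i. \<Sum>T \<in> local_elements Th \<phi> i. \<kappa> T i * local_coeff p Th I \<phi> T v i)"


section \<open>The discrete extension operator\<close>

definition large_elements ::
    "real \<Rightarrow> real \<Rightarrow> (real^'n) set \<Rightarrow> (real^'n) set set \<Rightarrow> (real^'n) set set" where
  "large_elements \<gamma> h \<Omega> Th = {T \<in> Th. \<gamma> * h ^ CARD('n) \<le> measure lborel (T \<inter> \<Omega>)}"

definition element_map ::
    "real \<Rightarrow> real \<Rightarrow> (real^'n) set set \<Rightarrow> (real^'n) set set \<Rightarrow>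
     ((real^'n) set \<Rightarrow> (real^'n) set) \<Rightarrow> bool" where
  "element_map CS h Th TL S \<longleftrightarrow>
     (\<forall>T \<in> Th - TL. S T \<in> TL \<and> diameter (S T \<union> T) \<le> CS * h)"

text \<open>The polynomial on the whole space that agrees with \<open>v\<close> on the element \<open>T\<close>.\<close>

definition poly_ext :: "nat \<Rightarrow> (real^'n) set \<Rightarrow> (real^'n \<Rightarrow> real) \<Rightarrow> real^'n \<Rightarrow> real" where
  "poly_ext p T v = (THE q. q \<in> Qpoly p \<and> (\<forall>x\<in>T. q x = v x))"

text \<open>The operator \<open>B\<^sub>h\<close>. Its values are discontinuous across element faces, and are defined by the
  formula in the interior of each element. The faces have measure zero, so that the value 0 chosen
  there is irrelevant to the subsequent \<open>L\<^sup>2\<close> projections.\<close>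

definition disc_ext ::
    "nat \<Rightarrow> (real^'n) set set \<Rightarrow> (real^'n) set set \<Rightarrow> ((real^'n) set \<Rightarrow> (real^'n) set) \<Rightarrow>
     (real^'n \<Rightarrow> real) \<Rightarrow> real^'n \<Rightarrow> real" where
  "disc_ext p Th TL S v x =
     (if \<exists>T \<in> Th. x \<in> interior T
      then let T = (THE T. T \<in> Th \<and> x \<in> interior T)
           in if T \<in> TL then v x else poly_ext p (S T) v x
      else 0)"

definition ext_op ::
    "nat \<Rightarrow> (real^'n) set set \<Rightarrow> (real^'n) set set \<Rightarrow> ((real^'n) set \<Rightarrow> (real^'n) set) \<Rightarrow>
     'i set \<Rightarrow> ('i \<Rightarrow> real^'n \<Rightarrow> real) \<Rightarrow> ((real^'n) set \<Rightarrow> 'i \<Rightarrow> real) \<Rightarrow>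
     (real^'n \<Rightarrow> real) \<Rightarrow> real^'n \<Rightarrow> real" where
  "ext_op p Th TL S I \<phi> \<kappa> v = interp p Th I \<phi> \<kappa> (disc_ext p Th TL S v)"

end

theory Submission
  imports Defs "HOL-Computational_Algebra.Polynomial"
begin

text \<open>Both operators reproduce tensor product polynomials, and on a cell \<open>T\<close> they depend only on the
  data in a patch \<open>\<omega>\<close> of boundedly many cells around \<open>T\<close>. Hence, for every polynomial \<open>q\<close>, the
  stability of the local bases gives \<open>\<parallel>\<pi> v - q\<parallel> \<le> C \<parallel>v - q\<parallel>\<close> in \<open>L\<^sup>2(T)\<close> and \<open>L\<^sup>2(\<omega>)\<close>; the extension
  of a polynomial from \<open>S(T)\<close> to \<open>T\<close> and the inverse inequality for its derivatives follow from the
  equivalence of norms on the polynomials over the unit cube and scaling. Choosing for \<open>q\<close> the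
  polynomial whose derivatives have the same means over \<open>\<omega>\<close> as those of \<open>v\<close>, iterating the Poincare
  inequality bounds the local error by \<open>h\<^sup>s\<close> times the Sobolev seminorm of \<open>v\<close> on \<open>\<omega>\<close> (in the last step
  a fractional seminorm bounds the oscillation directly), and the patches overlap boundedly.

  The Poincare inequality is derived from \<open>u(x + z) - u(x) = \<integral> z \<bullet> \<nabla>u(x + t z) dt\<close>, which holds for
  weak gradients by duality and the fundamental lemma of the calculus of variations.\<close>

section \<open>Classical derivatives\<close>

text \<open>Every local estimate is made on full cells and full patches for the extension of
  \<open>v\<close>, never on their intersections with \<Omega>, so no constant can see how the
  boundary cuts the mesh; the polynomial constants come from compactness on the unit cube and
  scaling, hence not from \<open>h\<close> or the offset \<open>a\<close> either. Reproduction of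
  polynomials holds for any weights: an element of \<open>Qpoly p\<close> is itself a spline, so its
  expansion has one coefficient per basis function, the same on all cells, and averaging with
  weights of sum 1 changes nothing. As \<Omega> may be unbounded, there may be infinitely many
  active cells; sums over cells are therefore integrals over a counting measure. The condition
  \<open>m \<le> k\<close> makes the classical derivatives of the discrete function weak derivatives
  on all of \<open>\<Omega>h\<close>, so the global norm is assembled from the cells without jump
  terms. A further obstacle is the arbitrary choice in \<open>multi_deriv\<close> and
  \<open>weak_deriv\<close>: the first is removed by the symmetry of mixed derivatives, the second
  by uniqueness almost everywhere.\<close>

lemma axis_nth_sum: "(x::real^'n) = (\<Sum>i\<in>UNIV. x $ i *\<^sub>R axis i 1)"
  by (simp add: vec_eq_iff axis_def if_distrib cong: if_cong)

lemma partial_deriv_eqI: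
  "(f has_derivative f') (at x) \<Longrightarrow> partial_deriv i f x = f' (axis i 1)"
  unfolding partial_deriv_def using frechet_derivative_at by metis

lemma has_derivative_partials:
  fixes f :: "real^'n \<Rightarrow> real"
  assumes "f differentiable (at x)"
  shows "(f has_derivative (\<lambda>h. \<Sum>i\<in>UNIV. partial_deriv i f x * h $ i)) (at x)"
proof -
  let ?f = "frechet_derivative f (at x)"
  have d: "(f has_derivative ?f) (at x)" using assms frechet_derivative_works by blast
  then have lin: "linear ?f" using has_derivative_linear by blast
  have "?f h = (\<Sum>i\<in>UNIV. partial_deriv i f x * h $ i)" for h
  proof -
    have "?f h = ?f (\<Sum>i\<in>UNIV. h $ i *\<^sub>R axis i 1)" using axis_nth_sum[of h] by simp
    also have "\<dots> = (\<Sum>i\<in>UNIV. h $ i *\<^sub>R ?f (axis i 1))"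
      using lin by (simp add: linear_sum linear_cmul)
    finally show ?thesis by (simp add: partial_deriv_def mult.commute)
  qed
  then have "?f = (\<lambda>h. \<Sum>i\<in>UNIV. partial_deriv i f x * h $ i)" by blast
  with d show ?thesis by simp
qed

lemma has_real_derivative_line:
  fixes f :: "real^'n \<Rightarrow> real"
  assumes "\<And>x. f differentiable (at x)"
  shows "((\<lambda>t. f (x + t *\<^sub>R z)) has_real_derivative
           (\<Sum>i\<in>UNIV. z $ i * partial_deriv i f (x + t *\<^sub>R z))) (at t)"
proof -
  have 1: "((\<lambda>t. x + t *\<^sub>R z) has_derivative (\<lambda>h. h *\<^sub>R z)) (at t)"
    by (auto intro!: derivative_eq_intros)
  have "((\<lambda>t. f (x + t *\<^sub>R z)) has_derivative
     (\<lambda>h. \<Sum>i\<in>UNIV. partial_deriv i f (x + t *\<^sub>R z) * (h *\<^sub>R z) $ i)) (at t)"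
    using has_derivative_compose[OF 1 has_derivative_partials[OF assms]] .
  moreover have "(\<lambda>h. \<Sum>i\<in>UNIV. partial_deriv i f (x + t *\<^sub>R z) * (h *\<^sub>R z) $ i)
      = times (\<Sum>i\<in>UNIV. z $ i * partial_deriv i f (x + t *\<^sub>R z))"
    by (auto simp: sum_distrib_left mult_ac)
  ultimately show ?thesis by (simp add: has_field_derivative_def)
qed

lemma Ck_continuous: "Ck k f \<Longrightarrow> continuous_on UNIV f"
  by (cases k) (auto intro!: continuous_at_imp_continuous_on differentiable_imp_continuous_within)

lemma Ck_SucD: "Ck (Suc k) f \<Longrightarrow> Ck k f"
proof (induction k arbitrary: f)
  case 0
  then show ?case using Ck_continuous by fastforce
next
  case (Suc k)
  then show ?case by (metis Ck.simps(2))
qed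

lemma Ck_mono: "Ck k f \<Longrightarrow> j \<le> k \<Longrightarrow> Ck j f"
  by (induction k) (auto simp del: Ck.simps simp: le_Suc_eq dest: Ck_SucD)

lemma Ck_partial: "Ck (Suc k) f \<Longrightarrow> Ck k (partial_deriv i f)"
  by simp

lemma Ck_differentiable: "Ck (Suc k) f \<Longrightarrow> f differentiable (at x)"
  by simp

section \<open>Algebra of partial derivatives and of the classes \<open>Ck\<close>\<close>

lemma partial_deriv_add:
  assumes "f differentiable (at x)" "g differentiable (at x)"
  shows "partial_deriv i (\<lambda>x. f x + g x) x = partial_deriv i f x + partial_deriv i g x"
  using partial_deriv_eqI[OF has_derivative_add[OF assms[unfolded frechet_derivative_works]]]
  by (simp add: partial_deriv_def)

lemma partial_deriv_mult:
  assumes "f differentiable (at x)" "g differentiable (at x)"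
  shows "partial_deriv i (\<lambda>x. f x * g x) x = f x * partial_deriv i g x + partial_deriv i f x * g x"
  using partial_deriv_eqI[OF has_derivative_mult[OF assms[unfolded frechet_derivative_works]]]
  by (simp add: partial_deriv_def)

lemma partial_deriv_const: "partial_deriv i (\<lambda>x. c) = (\<lambda>x. 0)"
  by (auto simp: partial_deriv_def)

lemma partial_deriv_cmult:
  assumes "f differentiable (at x)"
  shows "partial_deriv i (\<lambda>x. c * f x) x = c * partial_deriv i f x"
  using partial_deriv_mult[OF _ assms, of "\<lambda>x. c" i] by (simp add: partial_deriv_const)

lemma Ck_const: "Ck k (\<lambda>x. c)"
  by (induction k arbitrary: c) (auto simp: partial_deriv_const)

lemma Ck_add: "Ck k f \<Longrightarrow> Ck k g \<Longrightarrow> Ck k (\<lambda>x. f x + g x)"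
proof (induction k arbitrary: f g)
  case 0
  then show ?case by (auto intro: continuous_intros)
next
  case (Suc k)
  then have "partial_deriv i (\<lambda>x. f x + g x) = (\<lambda>x. partial_deriv i f x + partial_deriv i g x)" for i
    by (auto intro!: partial_deriv_add)
  with Suc show ?case by auto
qed

lemma Ck_mult: "Ck k f \<Longrightarrow> Ck k g \<Longrightarrow> Ck k (\<lambda>x. f x * g x)"
proof (induction k arbitrary: f g)
  case 0
  then show ?case by (auto intro: continuous_intros)
next
  case (Suc k)
  then have "partial_deriv i (\<lambda>x. f x * g x) = (\<lambda>x. f x * partial_deriv i g x + partial_deriv i f x * g x)" for i
    by (auto intro!: partial_deriv_mult)
  moreover have "Ck k (\<lambda>x. f x * partial_deriv i g x + partial_deriv i f x * g x)" for i
    using Suc.prems Suc.prems[THEN Ck_SucD] by (intro Ck_add Suc.IH Ck_partial)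
  ultimately show ?case using Suc.prems by auto
qed

lemma Ck_cmult: "Ck k f \<Longrightarrow> Ck k (\<lambda>x. c * f x)"
  by (intro Ck_mult Ck_const)

lemma Ck_sum: "(\<And>i. i \<in> F \<Longrightarrow> Ck k (f i)) \<Longrightarrow> Ck k (\<lambda>x. \<Sum>i\<in>F. f i x)"
  by (induction F rule: infinite_finite_induct) (auto intro: Ck_const Ck_add simp del: Ck.simps)

lemma Ck_prod: "(\<And>i. i \<in> F \<Longrightarrow> Ck k (f i)) \<Longrightarrow> Ck k (\<lambda>x. \<Prod>i\<in>F. f i x)"
  by (induction F rule: infinite_finite_induct) (auto intro: Ck_const Ck_mult simp del: Ck.simps)

lemma partial_deriv_coord:
  assumes "(g has_real_derivative d) (at (x $ j))"
  shows "partial_deriv i (\<lambda>x::real^'n. g (x $ j)) x = (if i = j then d else 0)"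
proof -
  have "((\<lambda>x::real^'n. g (x $ j)) has_derivative (\<lambda>h. d * h $ j)) (at x)"
    using has_derivative_compose[of "\<lambda>x. x $ j" "\<lambda>h. h $ j" x UNIV g "times d"] assms
    by (auto simp: has_field_derivative_def intro: bounded_linear_imp_has_derivative)
  from partial_deriv_eqI[OF this] show ?thesis by (auto simp: axis_def)
qed

text \<open>The whole sequence of successive derivatives is given at once because the induction on
  \<open>k\<close> passes from \<open>G n\<close> to \<open>G (Suc n)\<close>. It is instantiated
  with univariate polynomials and with the bump function below.\<close>

lemma Ck_coord:
  assumes G: "\<And>n t. (G n has_real_derivative G (Suc n) t) (at t)"
  shows "Ck k (\<lambda>x::real^'n. G n (x $ j))"
proof (induction k arbitrary: n)
  case 0
  have "continuous_on UNIV (G n)" using G by (meson DERIV_isCont continuous_at_imp_continuous_on)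
  then have "continuous_on UNIV (\<lambda>x::real^'n. G n (x $ j))"
    by (rule continuous_on_compose2) (auto intro: continuous_intros)
  then show ?case by simp
next
  case (Suc k)
  have "(\<lambda>x::real^'n. G n (x $ j)) differentiable (at x)" for x
    using differentiable_chain_at[of "\<lambda>x. x $ j" x "G n"] G
    by (auto simp: o_def intro: bounded_linear_imp_differentiable simp: real_differentiable_def)
  moreover have "partial_deriv i (\<lambda>x::real^'n. G n (x $ j)) = (if i = j then (\<lambda>x. G (Suc n) (x $ j)) else (\<lambda>x. 0))" for i
    by (rule ext) (simp add: partial_deriv_coord[OF G])
  ultimately show ?case using Suc Ck_const by auto
qed

lemma partial_deriv_cong_open:
  assumes "open U" "x \<in> U" "\<And>x. x \<in> U \<Longrightarrow> f x = g x" "g differentiable (at x)"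
  shows "partial_deriv i f x = partial_deriv i g x"
  using frechet_derivative_transform_within_open[of g x U f] assms by (simp add: partial_deriv_def)

text \<open>Smoothness is a local property. This is needed for infinite combinations of basis
  functions, which agree with a finite sum near each point but with no single finite sum
  globally.\<close>

lemma Ck_local:
  assumes "\<And>x. \<exists>U g. open U \<and> x \<in> U \<and> Ck k g \<and> (\<forall>y\<in>U. f y = g y)"
  shows "Ck k f"
  using assms
proof (induction k arbitrary: f)
  case 0
  have "isCont f x" for x
  proof -
    obtain U g where "open U" "x \<in> U" "Ck 0 g" "\<forall>y\<in>U. f y = g y" using 0 by blast
    moreover then have "isCont g x" by (simp add: continuous_on_eq_continuous_at)
    ultimately show ?thesis
      using Lim_transform_within_open[of g "g x" x UNIV U f] by (auto simp: isCont_def)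
  qed
  then show ?case by (simp add: continuous_at_imp_continuous_on)
next
  case (Suc k)
  have "f differentiable (at x)" for x
  proof -
    obtain U g where U: "open U" "x \<in> U" "Ck (Suc k) g" "\<forall>y\<in>U. f y = g y" using Suc.prems by blast
    then have "(g has_derivative frechet_derivative g (at x)) (at x)"
      using frechet_derivative_works by auto
    from has_derivative_transform_within_open[OF this U(1,2), of f] U(4)
    have "(f has_derivative frechet_derivative g (at x)) (at x)" by simp
    then show ?thesis by (auto simp: differentiable_def)
  qed
  moreover have "Ck k (partial_deriv i f)" for i
  proof (rule Suc.IH)
    fix x
    obtain U g where U: "open U" "x \<in> U" "Ck (Suc k) g" "\<forall>y\<in>U. f y = g y" using Suc.prems by blast
    then have "\<forall>y\<in>U. partial_deriv i f y = partial_deriv i g y"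
      by (auto intro!: partial_deriv_cong_open[of U])
    moreover have "Ck k (partial_deriv i g)" using U(3) by simp
    ultimately show "\<exists>U g. open U \<and> x \<in> U \<and> Ck k g \<and> (\<forall>y\<in>U. partial_deriv i f y = g y)"
      using U(1,2) by blast
  qed
  ultimately show ?case by simp
qed

lemma partial_deriv_translate:
  assumes "f differentiable (at (x + c))"
  shows "partial_deriv i (\<lambda>x. f (x + c)) x = partial_deriv i f (x + c)"
proof -
  have "((\<lambda>x. x + c) has_derivative (\<lambda>h. h)) (at x)"
    by (auto intro!: derivative_eq_intros)
  from has_derivative_compose[OF this assms[unfolded frechet_derivative_works]]
  have "((\<lambda>x. f (x + c)) has_derivative frechet_derivative f (at (x + c))) (at x)" .
  from partial_deriv_eqI[OF this] show ?thesis by (simp add: partial_deriv_def)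
qed

lemma Ck_translate: "Ck k f \<Longrightarrow> Ck k (\<lambda>x. f (x + c))"
proof (induction k arbitrary: f)
  case 0
  then show ?case by (auto intro!: continuous_on_compose2[of UNIV f] continuous_intros)
next
  case (Suc k)
  then have "partial_deriv i (\<lambda>x. f (x + c)) = (\<lambda>x. partial_deriv i f (x + c))" for i
    by (auto intro!: partial_deriv_translate)
  moreover have "(\<lambda>x. f (x + c)) differentiable (at x)" for x
    using differentiable_chain_at[of "\<lambda>x. x + c" x f] Suc.prems by (auto simp: o_def)
  ultimately show ?case using Suc by auto
qed

subsection \<open>Iterated partial derivatives\<close>

text \<open>\<open>multi_deriv\<close> differentiates along an unspecified ordering of its
  multi-index, which gives no recursion. Explicit lists allow induction; symmetry of the derivatives
  identifies the two in \<open>multi_deriv_eq_pd\<close>.\<close>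

definition pd :: "'n::finite list \<Rightarrow> (real^'n \<Rightarrow> real) \<Rightarrow> real^'n \<Rightarrow> real" where
  "pd js f = foldr partial_deriv js f"

lemma pd_simps [simp]: "pd [] f = f" "pd (i # js) f = partial_deriv i (pd js f)"
  by (auto simp: pd_def)

lemma pd_append: "pd (is @ js) f = pd is (pd js f)"
  by (simp add: pd_def)

lemma Ck_pd: "Ck (length js + k) f \<Longrightarrow> Ck k (pd js f)"
proof (induction js arbitrary: k)
  case (Cons i js)
  then have "Ck (Suc k) (pd js f)" by (metis add_Suc_right add_Suc length_Cons)
  then show ?case by simp
qed simp

lemma pd_add:
  assumes "Ck (length js) f" "Ck (length js) g"
  shows "pd js (\<lambda>x. f x + g x) = (\<lambda>x. pd js f x + pd js g x)"
  using assms
proof (induction js)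
  case (Cons i js)
  then have "pd js (\<lambda>x. f x + g x) = (\<lambda>x. pd js f x + pd js g x)"
    by (metis Ck_SucD length_Cons)
  moreover have "Ck (Suc 0) (pd js f)" "Ck (Suc 0) (pd js g)"
    using Cons.prems by (auto intro!: Ck_pd simp del: Ck.simps)
  ultimately show ?case by (auto intro!: partial_deriv_add)
qed simp

lemma pd_cmult:
  assumes "Ck (length js) f"
  shows "pd js (\<lambda>x. c * f x) = (\<lambda>x. c * pd js f x)"
  using assms
proof (induction js)
  case (Cons i js)
  then have "pd js (\<lambda>x. c * f x) = (\<lambda>x. c * pd js f x)"
    by (metis Ck_SucD length_Cons)
  moreover have "Ck (Suc 0) (pd js f)"
    using Cons.prems by (auto intro!: Ck_pd simp del: Ck.simps)
  ultimately show ?case by (auto intro!: partial_deriv_cmult)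
qed simp

lemma pd_diff:
  assumes "Ck (length js) f" "Ck (length js) g"
  shows "pd js (\<lambda>x. f x - g x) = (\<lambda>x. pd js f x - pd js g x)"
  using pd_add[OF assms(1) Ck_cmult[OF assms(2), of "-1"]] pd_cmult[OF assms(2), of "-1"] by simp

lemma pd_const: "pd js (\<lambda>x. c) = (\<lambda>x. if js = [] then c else 0)"
  by (induction js) (auto simp: partial_deriv_const)

lemma pd_sum:
  assumes "finite F" "\<And>i. i \<in> F \<Longrightarrow> Ck (length js) (f i)"
  shows "pd js (\<lambda>x. \<Sum>i\<in>F. f i x) = (\<lambda>x. \<Sum>i\<in>F. pd js (f i) x)"
  using assms by induction (auto simp: pd_const pd_add Ck_sum)

lemma pd_cong_open:
  assumes "open U" "\<And>x. x \<in> U \<Longrightarrow> f x = g x" "Ck (length js) g" "x \<in> U"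
  shows "pd js f x = pd js g x"
  using assms(3,4)
proof (induction js arbitrary: x)
  case (Cons i js)
  have "Ck (Suc 0) (pd js g)"
    using Cons.prems by (auto intro!: Ck_pd simp del: Ck.simps)
  moreover have "Ck (length js) g" using Cons.prems by (metis Ck_SucD length_Cons)
  ultimately show ?case using Cons assms(1)
    by (auto intro!: partial_deriv_cong_open[of U])
qed (use assms in auto)

section \<open>Symmetry of mixed derivatives\<close>

text \<open>The mean value theorem is applied twice: in direction \<open>i\<close> to the increment
  of \<open>f\<close> in direction \<open>j\<close>, then in direction \<open>j\<close> to the
  partial derivative so obtained.\<close>

lemma double_difference_mvt:
  fixes f :: "real^'n \<Rightarrow> real"
  assumes C: "Ck 2 f" and s: "s > 0"
  shows "\<exists>u t. 0 < u \<and> u < s \<and> 0 < t \<and> t < s \<and>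
     f (x + s *\<^sub>R axis i 1 + s *\<^sub>R axis j 1) - f (x + s *\<^sub>R axis i 1) - f (x + s *\<^sub>R axis j 1) + f x
     = s\<^sup>2 * partial_deriv j (partial_deriv i f) (x + u *\<^sub>R axis i 1 + t *\<^sub>R axis j 1)"
proof -
  have C1: "Ck (Suc (Suc 0)) f" using C by (simp add: numeral_2_eq_2)
  then have d: "f differentiable (at x)" "partial_deriv i f differentiable (at x)" for x by auto
  have a: "(\<Sum>k\<in>UNIV. axis i 1 $ k * partial_deriv k g y) = partial_deriv i g y" for i y
    and g :: "real^'n \<Rightarrow> real"
  proof -
    have "(\<Sum>k\<in>UNIV. axis i 1 $ k * partial_deriv k g y) = (\<Sum>k\<in>UNIV. if k = i then partial_deriv k g y else 0)"
      by (rule sum.cong) (auto simp: axis_def)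
    then show ?thesis by simp
  qed
  define \<phi> where "\<phi> u = f (x + s *\<^sub>R axis j 1 + u *\<^sub>R axis i 1) - f (x + u *\<^sub>R axis i 1)" for u
  have "(\<phi> has_real_derivative (partial_deriv i f (x + s *\<^sub>R axis j 1 + u *\<^sub>R axis i 1) - partial_deriv i f (x + u *\<^sub>R axis i 1))) (at u)" for u
    unfolding \<phi>_def using has_real_derivative_line[of f _ "axis i 1" u, OF d(1)] 
    by (intro DERIV_diff) (simp_all add: a)
  from MVT2[OF s this] obtain u where u: "0 < u" "u < s"
    "\<phi> s - \<phi> 0 = s * (partial_deriv i f (x + s *\<^sub>R axis j 1 + u *\<^sub>R axis i 1) - partial_deriv i f (x + u *\<^sub>R axis i 1))"
    by auto
  have "((\<lambda>t. partial_deriv i f (x + u *\<^sub>R axis i 1 + t *\<^sub>R axis j 1)) has_real_derivative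
     partial_deriv j (partial_deriv i f) (x + u *\<^sub>R axis i 1 + t *\<^sub>R axis j 1)) (at t)" for t
    using has_real_derivative_line[of "partial_deriv i f" _ "axis j 1" t, OF d(2)] by (simp add: a)
  from MVT2[OF s this] obtain t where t: "0 < t" "t < s"
    "partial_deriv i f (x + u *\<^sub>R axis i 1 + s *\<^sub>R axis j 1) - partial_deriv i f (x + u *\<^sub>R axis i 1)
      = s * partial_deriv j (partial_deriv i f) (x + u *\<^sub>R axis i 1 + t *\<^sub>R axis j 1)"
    by auto
  have "f (x + s *\<^sub>R axis i 1 + s *\<^sub>R axis j 1) - f (x + s *\<^sub>R axis i 1) - f (x + s *\<^sub>R axis j 1) + f x = \<phi> s - \<phi> 0"
    by (simp add: \<phi>_def algebra_simps)
  also have "\<dots> = s * (s * partial_deriv j (partial_deriv i f) (x + u *\<^sub>R axis i 1 + t *\<^sub>R axis j 1))"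
    using t u(3) by (simp add: algebra_simps)
  finally show ?thesis using u t by (auto simp: power2_eq_square mult.assoc)
qed

text \<open>The double difference is symmetric in \<open>i\<close> and \<open>j\<close>, so its two
  mean value forms give equal values of the two mixed derivatives at points close to
  \<open>x\<close>. If the derivatives differed at \<open>x\<close>, continuity would keep these
  values apart.\<close>

lemma partial_deriv_commute:
  fixes f :: "real^'n \<Rightarrow> real"
  assumes C: "Ck 2 f"
  shows "partial_deriv i (partial_deriv j f) = partial_deriv j (partial_deriv i f)"
proof
  fix x
  let ?A = "partial_deriv i (partial_deriv j f)" and ?B = "partial_deriv j (partial_deriv i f)"
  have c: "isCont ?A x" "isCont ?B x"
    using C by (auto simp: numeral_2_eq_2 continuous_on_eq_continuous_at)
  have near: "x + u *\<^sub>R axis i 1 + t *\<^sub>R axis j 1 \<in> ball x e" if "0 < u" "u < e/2" "0 < t" "t < e/2" for e u t i j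
  proof -
    have "norm (u *\<^sub>R axis i (1::real) + t *\<^sub>R axis j 1 :: real^'n) \<le> u + t"
      using that norm_triangle_ineq[of "u *\<^sub>R axis i (1::real) :: real^'n" "t *\<^sub>R axis j 1"] by simp
    then show ?thesis using that by (simp add: dist_norm norm_minus_commute algebra_simps)
  qed
  show "?A x = ?B x"
  proof (rule ccontr)
    assume "?A x \<noteq> ?B x"
    define e where "e = \<bar>?A x - ?B x\<bar> / 2"
    have e: "e > 0" using \<open>?A x \<noteq> ?B x\<close> by (simp add: e_def)
    from c(1)[unfolded continuous_at_eps_delta] e obtain d1 where d1: "d1 > 0" "\<And>y. dist y x < d1 \<Longrightarrow> dist (?A y) (?A x) < e" by blast
    from c(2)[unfolded continuous_at_eps_delta] e obtain d2 where d2: "d2 > 0" "\<And>y. dist y x < d2 \<Longrightarrow> dist (?B y) (?B x) < e" by blast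
    \<comment> \<open>Halved because the evaluation point may be displaced by up to \<open>s\<close>
      in each of two directions.\<close>
    define s where "s = min d1 d2 / 2"
    have s: "s > 0" "s \<le> d1/2" "s \<le> d2/2" using d1 d2 by (auto simp: s_def)
    obtain u t where 1: "0 < u" "u < s" "0 < t" "t < s"
     "f (x + s *\<^sub>R axis i 1 + s *\<^sub>R axis j 1) - f (x + s *\<^sub>R axis i 1) - f (x + s *\<^sub>R axis j 1) + f x
     = s\<^sup>2 * ?B (x + u *\<^sub>R axis i 1 + t *\<^sub>R axis j 1)"
      using double_difference_mvt[OF C s(1)] by blast
    obtain u' t' where 2: "0 < u'" "u' < s" "0 < t'" "t' < s"
     "f (x + s *\<^sub>R axis j 1 + s *\<^sub>R axis i 1) - f (x + s *\<^sub>R axis j 1) - f (x + s *\<^sub>R axis i 1) + f x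
     = s\<^sup>2 * ?A (x + u' *\<^sub>R axis j 1 + t' *\<^sub>R axis i 1)"
      using double_difference_mvt[OF C s(1)] by blast
    have "s\<^sup>2 * ?B (x + u *\<^sub>R axis i 1 + t *\<^sub>R axis j 1) = s\<^sup>2 * ?A (x + u' *\<^sub>R axis j 1 + t' *\<^sub>R axis i 1)"
      using 1(5) 2(5) by (simp add: algebra_simps)
    then have eq: "?B (x + u *\<^sub>R axis i 1 + t *\<^sub>R axis j 1) = ?A (x + u' *\<^sub>R axis j 1 + t' *\<^sub>R axis i 1)"
      using s by simp
    have "dist (?B (x + u *\<^sub>R axis i 1 + t *\<^sub>R axis j 1)) (?B x) < e"
      using near[of u d2 t i j] 1 s by (intro d2) (auto simp: dist_commute)
    moreover have "dist (?A (x + u' *\<^sub>R axis j 1 + t' *\<^sub>R axis i 1)) (?A x) < e"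
      using near[of u' d1 t' j i] 2 s by (intro d1) (auto simp: dist_commute)
    ultimately show False using eq by (auto simp: e_def dist_real_def abs_if split: if_splits)
  qed
qed

text \<open>The index \<open>i\<close> passes the entries of \<open>ys\<close> one at a time; each
  exchange is the symmetry of a second derivative of a lower-order derivative of
  \<open>f\<close>.\<close>

lemma pd_move:
  assumes "Ck (Suc (length ys + length zs)) f"
  shows "pd (ys @ i # zs) f = pd (i # ys @ zs) f"
  using assms
proof (induction ys)
  case (Cons y ys)
  have "Ck (length (ys @ zs) + 2) f" using Cons.prems by (simp del: Ck.simps)
  then have "Ck 2 (pd (ys @ zs) f)" by (rule Ck_pd)
  moreover have "pd (ys @ i # zs) f = pd (i # ys @ zs) f"
    using Cons.IH Ck_SucD[OF Cons.prems] by (simp del: Ck.simps)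
  ultimately show ?case using partial_deriv_commute[of "pd (ys @ zs) f" y i] by simp
qed simp

lemma pd_perm:
  assumes "mset js = mset js'" "Ck (length js) f"
  shows "pd js f = pd js' f"
  using assms
proof (induction js arbitrary: js')
  case (Cons i js)
  then have "i \<in> set js'" by (metis list.set_intros(1) set_mset_mset)
  then obtain ys zs where js': "js' = ys @ i # zs" by (meson split_list)
  have "length js' = Suc (length js)" using Cons.prems(1) by (metis length_Cons size_mset)
  then have "pd js' f = pd (i # ys @ zs) f"
    using Cons.prems(2) unfolding js' by (intro pd_move) (simp del: Ck.simps)
  moreover have "pd js f = pd (ys @ zs) f"
    using Cons.prems Ck_SucD[of "length js" f] by (intro Cons.IH) (auto simp: js' simp del: Ck.simps)
  ultimately show ?case by simp
qed auto

lemma multi_deriv_eq_pd: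
  assumes "mset js = \<alpha>" "Ck (size \<alpha>) f"
  shows "multi_deriv \<alpha> f = pd js f"
proof -
  have "mset (SOME js. mset js = \<alpha>) = \<alpha>" using assms(1) by (metis (mono_tags) someI)
  then show ?thesis
    using pd_perm[of "SOME js. mset js = \<alpha>" js f] assms
    by (metis multi_deriv_def pd_def size_mset)
qed

section \<open>Smooth bump functions\<close>

text \<open>The derivatives of \<open>exp (-1/t)\<close> have the form \<open>P (1/t) * exp (-1/t)\<close> with polynomials \<open>P\<close>.\<close>

primrec bump_poly :: "nat \<Rightarrow> real poly" where
  "bump_poly 0 = 1"
| "bump_poly (Suc n) = [:0, 0, 1:] * (bump_poly n - pderiv (bump_poly n))"

definition bump_deriv :: "nat \<Rightarrow> real \<Rightarrow> real" where
  "bump_deriv n t = (if t > 0 then poly (bump_poly n) (1 / t) * exp (- (1 / t)) else 0)"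

lemma poly_times_exp_tendsto_0:
  "((\<lambda>x::real. poly q x * exp (- x)) \<longlongrightarrow> 0) at_top"
proof -
  have "((\<lambda>x. \<Sum>i\<le>degree q. coeff q i * (x ^ i / exp x)) \<longlongrightarrow> (\<Sum>i\<le>degree q. coeff q i * 0)) at_top"
    by (intro tendsto_intros tendsto_power_div_exp_0)
  then show ?thesis by (simp add: poly_altdef exp_minus sum_distrib_right divide_inverse mult.assoc)
qed

lemma bump_deriv_step: "(bump_deriv n has_real_derivative bump_deriv (Suc n) t) (at t)"
proof -
  consider "t > 0" | "t < 0" | "t = 0" by linarith
  then show ?thesis
  proof cases
    case 1
    let ?P = "bump_poly n"
    have e: "1 / t * (1 / t) = (1 / t)\<^sup>2" by (simp add: power2_eq_square)
    have i: "((\<lambda>t. 1 / t) has_real_derivative - (1 / t)\<^sup>2) (at t)"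
      using 1 by (auto intro!: derivative_eq_intros simp: e[symmetric])
    have "((\<lambda>t. poly ?P (1 / t)) has_real_derivative poly (pderiv ?P) (1 / t) * (- (1 / t)\<^sup>2)) (at t)"
      by (rule DERIV_chain2[OF poly_DERIV i])
    moreover have "((\<lambda>t. exp (- (1 / t))) has_real_derivative exp (- (1 / t)) * - (- (1 / t)\<^sup>2)) (at t)"
      by (rule DERIV_chain2[OF DERIV_exp DERIV_minus[OF i]])
    ultimately have "((\<lambda>t. poly ?P (1 / t) * exp (- (1 / t))) has_real_derivative
       poly (pderiv ?P) (1 / t) * (- (1 / t)\<^sup>2) * exp (- (1 / t)) + exp (- (1 / t)) * - (- (1 / t)\<^sup>2) * poly ?P (1 / t)) (at t)"
      by (rule DERIV_mult)
    moreover have "poly (pderiv ?P) (1 / t) * (- (1 / t)\<^sup>2) * exp (- (1 / t)) + exp (- (1 / t)) * - (- (1 / t)\<^sup>2) * poly ?P (1 / t)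
       = bump_deriv (Suc n) t"
      using 1 by (simp add: bump_deriv_def power2_eq_square algebra_simps)
    ultimately have "((\<lambda>t. poly ?P (1 / t) * exp (- (1 / t))) has_real_derivative bump_deriv (Suc n) t) (at t)"
      by simp
    then show ?thesis
      by (rule DERIV_cong_ev[THEN iffD1, rotated -1])
         (use 1 eventually_nhds_in_open[of "{0<..}" t] in \<open>auto elim!: eventually_mono simp: bump_deriv_def\<close>)
  next
    case 2
    have "((\<lambda>t. 0) has_real_derivative bump_deriv (Suc n) t) (at t)"
      using 2 by (auto simp: bump_deriv_def)
    then show ?thesis
      by (rule DERIV_cong_ev[THEN iffD1, rotated -1])
         (use 2 eventually_nhds_in_open[of "{..<0}" t] in \<open>auto elim!: eventually_mono simp: bump_deriv_def\<close>)
  next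
    case 3
    \<comment> \<open>At the origin the difference quotient multiplies the polynomial in the inverse
      by one more factor of the inverse, which the exponential still dominates.\<close>
    have "((\<lambda>x. poly ([:0, 1:] * bump_poly n) (inverse x) * exp (- (inverse x))) \<longlongrightarrow> 0) (at_right 0)"
      by (rule filterlim_compose[OF poly_times_exp_tendsto_0 filterlim_inverse_at_top_right])
    then have "((\<lambda>h. bump_deriv n h / h) \<longlongrightarrow> 0) (at_right 0)"
      by (rule Lim_transform_eventually)
         (auto simp: eventually_at_filter bump_deriv_def field_simps)
    moreover have "((\<lambda>h. bump_deriv n h / h) \<longlongrightarrow> 0) (at_left 0)"
      by (rule Lim_transform_eventually[of "\<lambda>x. 0"])
         (auto simp: eventually_at_filter bump_deriv_def field_simps)
    ultimately have "((\<lambda>h. bump_deriv n h / h) \<longlongrightarrow> 0) (at 0)"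
      by (simp add: filterlim_split_at_real)
    then show ?thesis using 3 by (simp add: DERIV_def bump_deriv_def)
  qed
qed

lemma bump_deriv_affine_step:
  "((\<lambda>t. c ^ n * bump_deriv n (c * t + d)) has_real_derivative c ^ Suc n * bump_deriv (Suc n) (c * t + d)) (at t)"
  by (auto intro!: derivative_eq_intros DERIV_chain2[OF bump_deriv_step])

lemma Ck_bump: "Ck k (\<lambda>x::real^'n. bump_deriv 0 (c * x $ j + d))"
  using Ck_coord[of "\<lambda>n t. c ^ n * bump_deriv n (c * t + d)" k 0 j, OF bump_deriv_affine_step] by simp

lemma bump_deriv_0: "bump_deriv 0 t = (if t > 0 then exp (- (1 / t)) else 0)"
  by (simp add: bump_deriv_def)

lemma bump_bounds: "0 \<le> bump_deriv 0 t" "bump_deriv 0 t \<le> 1"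
  by (auto simp: bump_deriv_0)

lemma bump_tendsto_indicator:
  "(\<lambda>n. bump_deriv 0 (real n * t)) \<longlonglongrightarrow> (if t > 0 then 1 else 0)"
proof (cases "t > 0")
  case True
  have "(\<lambda>n. exp (- ((1 / t) * (1 / real n)))) \<longlonglongrightarrow> exp (- ((1 / t) * 0))"
    by (intro tendsto_intros lim_1_over_n)
  then have "(\<lambda>n. exp (- ((1 / t) * (1 / real n)))) \<longlonglongrightarrow> 1" by simp
  moreover have "\<forall>\<^sub>F n in sequentially. exp (- ((1 / t) * (1 / real n))) = bump_deriv 0 (real n * t)"
    using True by (intro eventually_sequentiallyI[of 1]) (simp add: bump_deriv_0 mult.commute)
  ultimately show ?thesis using True by (simp add: Lim_transform_eventually)
next
  case False
  then have "\<not> 0 < real n * t" for n by (simp add: zero_less_mult_iff)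
  then show ?thesis using False by (simp add: bump_deriv_0)
qed

text \<open>A smooth function vanishing outside the open box. The dilation factor \<open>n\<close>
  sharpens it: it stays between 0 and 1 and converges to the indicator of the box, so statements
  about test functions pass to boxes by dominated convergence.\<close>

definition box_bump :: "real^'n \<Rightarrow> real^'n \<Rightarrow> nat \<Rightarrow> real^'n \<Rightarrow> real" where
  "box_bump a b n x = (\<Prod>j\<in>UNIV. bump_deriv 0 (real n * (x $ j - a $ j)) * bump_deriv 0 (real n * (b $ j - x $ j)))"

lemma box_bump_bounds: "0 \<le> box_bump a b n x" "box_bump a b n x \<le> 1"
  unfolding box_bump_def by (auto intro!: prod_nonneg prod_le_1 mult_le_one simp: bump_bounds)

lemma Ck_box_bump: "Ck k (box_bump (a::real^'n) b n)"
proof -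
  have 1: "Ck k (\<lambda>x::real^'n. bump_deriv 0 (real n * (x $ j - a $ j)))" for j
    using Ck_bump[of k "real n" j "- real n * a $ j"] by (simp add: algebra_simps)
  have 2: "Ck k (\<lambda>x::real^'n. bump_deriv 0 (real n * (b $ j - x $ j)))" for j
    using Ck_bump[of k "- real n" j "real n * b $ j"] by (simp add: algebra_simps)
  show ?thesis unfolding box_bump_def[abs_def] by (intro Ck_prod Ck_mult 1 2)
qed

lemma box_bump_eq_0: "x \<notin> box a b \<Longrightarrow> box_bump a b n x = 0"
proof -
  assume "x \<notin> box a b"
  then obtain i where "x $ i - a $ i \<le> 0 \<or> b $ i - x $ i \<le> 0" by (auto simp: mem_box_cart not_less)
  then have "bump_deriv 0 (real n * (x $ i - a $ i)) * bump_deriv 0 (real n * (b $ i - x $ i)) = 0"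
    by (auto simp: bump_deriv_0 zero_less_mult_iff)
  then show ?thesis unfolding box_bump_def by (intro prod_zero) auto
qed

lemma box_bump_tendsto: "(\<lambda>n. box_bump a b n x) \<longlonglongrightarrow> indicator (box a b) x"
proof -
  have "(\<lambda>n. box_bump a b n x) \<longlonglongrightarrow>
     (\<Prod>j\<in>UNIV. (if x $ j - a $ j > 0 then 1 else 0) * (if b $ j - x $ j > 0 then 1 else 0))"
    unfolding box_bump_def by (intro tendsto_intros bump_tendsto_indicator)
  also have "(\<Prod>j\<in>UNIV. (if x $ j - a $ j > 0 then 1 else 0) * (if b $ j - x $ j > 0 then 1 else 0))
      = (indicator (box a b) x :: real)"
    by (auto simp: indicator_def mem_box_cart)
  finally show ?thesis .
qed

lemma test_function_box_bump:
  assumes "cbox a b \<subseteq> U"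
  shows "test_function U (box_bump a b n)"
proof -
  have "supp (box_bump a b n) \<subseteq> cbox a b"
    unfolding supp_def using box_bump_eq_0[of _ a b n] box_subset_cbox[of a b]
    by (intro closure_minimal) auto
  moreover have "closed (supp (box_bump a b n))" by (simp add: supp_def)
  ultimately show ?thesis
    using Ck_box_bump assms compact_Int_closed[of "cbox a b" "supp (box_bump a b n)"]
    by (auto simp: test_function_def Int_absorb1 simp del: Ck.simps)
qed

section \<open>Test functions and local integrability\<close>

lemma zero_outside_supp: "x \<notin> supp f \<Longrightarrow> f x = 0"
  using subsetD[OF closure_subset, of x "{x. f x \<noteq> 0}"] unfolding supp_def by blast

lemma test_functionD:
  assumes "test_function U \<psi>"
  shows "Ck k \<psi>" "compact (supp \<psi>)" "supp \<psi> \<subseteq> U"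
  using assms unfolding test_function_def by blast+

lemma test_function_mono: "test_function U \<psi> \<Longrightarrow> U \<subseteq> V \<Longrightarrow> test_function V \<psi>"
  unfolding test_function_def by blast

lemma supp_partial_subset: "supp (partial_deriv i f) \<subseteq> supp f"
proof -
  have "x \<in> supp f" if "partial_deriv i f x \<noteq> 0" for x
  proof (rule ccontr)
    assume "x \<notin> supp f"
    have "partial_deriv i f x = partial_deriv i (\<lambda>x. 0) x"
    proof (rule partial_deriv_cong_open)
      show "open (- supp f)" unfolding supp_def by (rule open_Compl[OF closed_closure])
      show "x \<in> - supp f" using \<open>x \<notin> supp f\<close> by simp
      show "f y = 0" if "y \<in> - supp f" for y using that by (simp add: zero_outside_supp)
    qed simp
    with that show False by (simp add: partial_deriv_const)
  qed
  then have "{x. partial_deriv i f x \<noteq> 0} \<subseteq> supp f" by blast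
  then show ?thesis unfolding supp_def[of "partial_deriv i f"]
    by (rule closure_minimal) (simp add: supp_def)
qed

lemma test_function_partial:
  assumes "test_function U \<psi>"
  shows "test_function U (partial_deriv i \<psi>)"
proof -
  have "closed (supp (partial_deriv i \<psi>))" by (simp add: supp_def)
  then have "compact (supp (partial_deriv i \<psi>))"
    using compact_Int_closed[OF test_functionD(2)[OF assms]] supp_partial_subset[of i \<psi>]
    by (metis Int_absorb1)
  moreover have "Ck k (partial_deriv i \<psi>)" for k
    using test_functionD(1)[OF assms, of "Suc k"] by simp
  ultimately show ?thesis using test_functionD(3)[OF assms] supp_partial_subset[of i \<psi>]
    unfolding test_function_def by blast
qed

lemma test_function_pd: "test_function U \<psi> \<Longrightarrow> test_function U (pd js \<psi>)"
  by (induction js) (auto intro: test_function_partial)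

lemma test_function_translate:
  assumes "test_function UNIV \<psi>"
  shows "test_function UNIV (\<lambda>x. \<psi> (x + c))"
proof -
  have "supp (\<lambda>x. \<psi> (x + c)) = (\<lambda>x. x - c) ` supp \<psi>"
  proof -
    have "{x. \<psi> (x + c) \<noteq> 0} = (\<lambda>x. - c + x) ` {x. \<psi> x \<noteq> 0}"
    proof (intro equalityI subsetI)
      show "x \<in> (\<lambda>x. - c + x) ` {x. \<psi> x \<noteq> 0}" if "x \<in> {x. \<psi> (x + c) \<noteq> 0}" for x
        using that by (intro image_eqI[of _ _ "x + c"]) auto
    qed (auto simp: algebra_simps)
    then show ?thesis unfolding supp_def using closure_translation[of "-c" "{x. \<psi> x \<noteq> 0}"] by simp
  qed
  then have "compact (supp (\<lambda>x. \<psi> (x + c)))"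
    using compact_translation_subtract[OF test_functionD(2)[OF assms]] by simp
  then show ?thesis using assms by (auto simp: test_function_def intro: Ck_translate simp del: Ck.simps)
qed

lemma continuous_borel: "continuous_on UNIV f \<Longrightarrow> f \<in> borel_measurable lborel"
  for f :: "real^'n \<Rightarrow> real"
  by (simp add: borel_measurable_continuous_onI)

lemma continuous_compact_support_bounded:
  fixes g :: "real^'n \<Rightarrow> real"
  assumes "continuous_on UNIV g" "compact K" "\<And>x. x \<notin> K \<Longrightarrow> g x = 0"
  shows "\<exists>M\<ge>0. \<forall>x. \<bar>g x\<bar> \<le> M"
proof -
  have "bounded (g ` K)"
    by (intro compact_imp_bounded compact_continuous_image assms(2)) (rule continuous_on_subset[OF assms(1)], simp)
  then obtain M where M: "\<And>x. x \<in> K \<Longrightarrow> \<bar>g x\<bar> \<le> M" by (auto simp: bounded_iff)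
  have "\<bar>g x\<bar> \<le> max M 0" for x
    using M[of x] assms(3)[of x] by (cases "x \<in> K") auto
  then show ?thesis by (intro exI[of _ "max M 0"]) auto
qed

lemma locally_integrable_mult:
  fixes g :: "real^'n \<Rightarrow> real"
  assumes u: "locally_integrable U u" and g: "continuous_on UNIV g"
    and K: "compact K" "K \<subseteq> U" and z: "\<And>x. x \<notin> K \<Longrightarrow> g x = 0"
  shows "set_integrable lborel U (\<lambda>x. u x * g x)"
proof -
  obtain M where M: "M \<ge> 0" "\<forall>x. \<bar>g x\<bar> \<le> M"
    using continuous_compact_support_bounded[OF g K(1) z] by blast
  have i: "integrable lborel (\<lambda>x. indicator K x *\<^sub>R u x)"
    using u K by (auto simp: locally_integrable_def set_integrable_def)
  have [measurable]: "g \<in> borel_measurable lborel" using continuous_borel[OF g] .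
  have "integrable lborel (\<lambda>x. (indicator K x *\<^sub>R u x) * g x)"
  proof (rule Bochner_Integration.integrable_bound)
    show "integrable lborel (\<lambda>x. M * (indicator K x *\<^sub>R u x))" using i by simp
    show "(\<lambda>x. (indicator K x *\<^sub>R u x) * g x) \<in> borel_measurable lborel"
      using i by (auto dest: borel_measurable_integrable)
    show "AE x in lborel. norm ((indicator K x *\<^sub>R u x) * g x) \<le> norm (M * (indicator K x *\<^sub>R u x))"
    proof (rule AE_I2)
      fix x
      show "norm ((indicator K x *\<^sub>R u x) * g x) \<le> norm (M * (indicator K x *\<^sub>R u x))"
        using M(1) mult_left_mono[OF M(2)[rule_format, of x], of "\<bar>u x\<bar>"]
        by (simp add: abs_mult mult.commute split: split_indicator)
    qed
  qed
  moreover have "(\<lambda>x. (indicator K x *\<^sub>R u x) * g x) = (\<lambda>x. indicator U x *\<^sub>R (u x * g x))"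
    using K(2) z by (auto simp: fun_eq_iff split: split_indicator)
  ultimately show ?thesis by (simp add: set_integrable_def)
qed

lemma locally_integrable_test:
  assumes "locally_integrable U u" "test_function U \<psi>"
  shows "set_integrable lborel U (\<lambda>x. u x * \<psi> x)"
  using locally_integrable_mult[OF assms(1) Ck_continuous[OF test_functionD(1)[OF assms(2)]]
      test_functionD(2,3)[OF assms(2)]] zero_outside_supp by blast

lemma locally_integrable_mono: "locally_integrable U u \<Longrightarrow> V \<subseteq> U \<Longrightarrow> locally_integrable V u"
  unfolding locally_integrable_def by blast

lemma locally_integrable_diff:
  "locally_integrable U u \<Longrightarrow> locally_integrable U v \<Longrightarrow> locally_integrable U (\<lambda>x. u x - v x)"
  unfolding locally_integrable_def by (auto intro: set_integral_diff)

lemma locally_integrable_continuous: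
  "continuous_on UNIV f \<Longrightarrow> locally_integrable U f"
  unfolding locally_integrable_def set_integrable_def
  using borel_integrable_compact continuous_on_subset[of UNIV f] by blast

section \<open>The fundamental lemma of the calculus of variations\<close>

text \<open>The positive and the negative part of \<open>f\<close>, taken as densities, define
  measures that agree on open boxes, a generator stable under intersection, and hence everywhere. By
  uniqueness of densities the two parts coincide almost everywhere, and at each point at least one
  of them is 0.\<close>

lemma integrable_zero_boxes_AE:
  fixes f :: "real^'n \<Rightarrow> real"
  assumes f: "integrable lborel f" and z: "\<And>a b. (LINT x:box a b|lborel. f x) = 0"
  shows "AE x in lborel. f x = 0"
proof -
  have [measurable]: "f \<in> borel_measurable lborel" using f by simp
  let ?P = "density lborel (\<lambda>x. ennreal (f x))" and ?N = "density lborel (\<lambda>x. ennreal (- f x))"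
  have fin: "(\<integral>\<^sup>+x. ennreal (f x) * indicator A x \<partial>lborel) \<noteq> \<infinity>" (is "?a \<noteq> _")
      "(\<integral>\<^sup>+x. ennreal (- f x) * indicator A x \<partial>lborel) \<noteq> \<infinity>" (is "?b \<noteq> _") for A
  proof -
    have n: "(\<integral>\<^sup>+x. ennreal \<bar>f x\<bar> \<partial>lborel) < \<infinity>" using f by (simp add: integrable_iff_bounded)
    have "?a \<le> (\<integral>\<^sup>+x. ennreal \<bar>f x\<bar> \<partial>lborel)"
      by (intro nn_integral_mono) (auto simp: ennreal_leI split: split_indicator)
    then show "?a \<noteq> \<infinity>" using n by (auto simp: top_unique)
    have "?b \<le> (\<integral>\<^sup>+x. ennreal \<bar>f x\<bar> \<partial>lborel)"
      by (intro nn_integral_mono) (auto simp: ennreal_leI split: split_indicator)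
    then show "?b \<noteq> \<infinity>" using n by (auto simp: top_unique)
  qed
  have "?P = ?N"
  proof (rule measure_eqI_generator_eq)
    let ?E = "range (\<lambda>(a, b). box a b :: (real^'n) set)"
    show "Int_stable ?E"
      by (auto simp: Int_stable_def box_Int_box)
    show "?E \<subseteq> Pow UNIV" "sets ?P = sigma_sets UNIV ?E" "sets ?N = sigma_sets UNIV ?E"
      by (simp_all add: borel_eq_box)
    let ?A = "\<lambda>n::nat. box (- (real n *\<^sub>R One)) (real n *\<^sub>R One) :: (real^'n) set"
    show "range ?A \<subseteq> ?E" "(\<Union>i. ?A i) = UNIV"
      unfolding UN_box_eq_UNIV by auto
    show "emeasure ?P (?A i) \<noteq> \<infinity>" for i using fin by (auto simp: emeasure_density)
    show "emeasure ?P X = emeasure ?N X" if X: "X \<in> ?E" for X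
    proof -
      obtain a b where ab: "X = box a b" using X by auto
      have i: "integrable lborel (\<lambda>x. indicator (box a b) x * f x)"
        using integrable_mult_indicator[OF _ f, of "box a b"] by simp
      let ?p = "\<integral>\<^sup>+x. ennreal (f x) * indicator (box a b) x \<partial>lborel"
      let ?n = "\<integral>\<^sup>+x. ennreal (- f x) * indicator (box a b) x \<partial>lborel"
      have e: "ennreal (indicator (box a b) x * f x) = ennreal (f x) * indicator (box a b) x"
        "ennreal (- (indicator (box a b) x * f x)) = ennreal (- f x) * indicator (box a b) x" for x
        by (auto split: split_indicator)
      have "enn2real ?p - enn2real ?n = 0"
        using z[of a b] real_lebesgue_integral_def[OF i]
        unfolding e by (simp add: set_lebesgue_integral_def)
      then have eq: "enn2real ?p = enn2real ?n" by linarith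
      have "?p = ennreal (enn2real ?p)" using fin[of "box a b"] by (simp add: less_top)
      also have "\<dots> = ?n" unfolding eq using fin[of "box a b"] by (simp add: less_top)
      finally have "?p = ?n" .
      then show ?thesis by (simp add: ab emeasure_density)
    qed
  qed
  then have "AE x in lborel. ennreal (f x) = ennreal (- f x)"
    by (intro sigma_finite_measure.density_unique[OF sigma_finite_lborel]) auto
  then show ?thesis
  proof eventually_elim
    case (elim x)
    then show ?case
      by (cases "f x" "0::real" rule: linorder_cases) (auto simp: ennreal_neg ennreal_eq_0_iff)
  qed
qed

text \<open>Testing with sharpened bumps shows that the integral over every box with closure in
  \<open>U\<close> vanishes, which settles the question inside each such box. Countably many closed
  boxes exhaust \<open>U\<close>, and their faces are null sets.\<close>

theorem fundamental_lemma:
  assumes U: "open U" and u: "locally_integrable U u"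
    and z: "\<And>\<psi>. test_function U \<psi> \<Longrightarrow> (LINT x:U|lborel. u x * \<psi> x) = 0"
  shows "AE x in lborel. x \<in> U \<longrightarrow> u x = 0"
proof -
  have box0: "(LINT x:box a b|lborel. u x) = 0" if ab: "cbox a b \<subseteq> U" for a b
  proof -
    have ui: "integrable lborel (\<lambda>x. indicator (cbox a b) x * u x)"
      using u ab by (auto simp: locally_integrable_def set_integrable_def)
    have um [measurable]: "(\<lambda>x. indicator (cbox a b) x * u x) \<in> borel_measurable lborel"
      using ui by (rule borel_measurable_integrable)
    have bm [measurable]: "box_bump a b n \<in> borel_measurable lborel" for n
      by (rule continuous_borel[OF Ck_continuous[OF Ck_box_bump]])
    have "(\<lambda>n. LINT x|lborel. (indicator (cbox a b) x * u x) * box_bump a b n x)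
       \<longlonglongrightarrow> (LINT x|lborel. (indicator (cbox a b) x * u x) * indicator (box a b) x)"
    proof (rule integral_dominated_convergence)
      show "integrable lborel (\<lambda>x. \<bar>indicator (cbox a b) x * u x\<bar>)" using ui by (rule integrable_abs)
      show "AE x in lborel. (\<lambda>n. indicator (cbox a b) x * u x * box_bump a b n x) \<longlonglongrightarrow> indicator (cbox a b) x * u x * indicator (box a b) x"
        by (auto intro!: tendsto_intros box_bump_tendsto)
      show "AE x in lborel. norm (indicator (cbox a b) x * u x * box_bump a b n x) \<le> \<bar>indicator (cbox a b) x * u x\<bar>" for n
        using box_bump_bounds[of a b n] by (auto simp: abs_mult mult_left_le)
    qed auto
    moreover have "(LINT x|lborel. (indicator (cbox a b) x * u x) * box_bump a b n x) = 0" for n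
    proof -
      have "(indicator (cbox a b) x * u x) * box_bump a b n x = indicator U x *\<^sub>R (u x * box_bump a b n x)" for x
        using ab box_bump_eq_0[of x a b n] box_subset_cbox[of a b] by (auto split: split_indicator)
      then show ?thesis using z[OF test_function_box_bump[OF ab]] by (simp only: set_lebesgue_integral_def)
    qed
    moreover have "(indicator (cbox a b) x * u x) * indicator (box a b) x = indicator (box a b) x *\<^sub>R u x" for x
      using box_subset_cbox[of a b] by (auto split: split_indicator)
    ultimately show ?thesis by (simp add: set_lebesgue_integral_def LIMSEQ_const_iff)
  qed
  have loc: "AE x in lborel. x \<in> box a b \<longrightarrow> u x = 0" if ab: "cbox a b \<subseteq> U" for a b
  proof -
    have i: "integrable lborel (\<lambda>x. indicator (box a b) x * u x)"
    proof -
      have "set_integrable lborel (cbox a b) u" using u ab by (auto simp: locally_integrable_def)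
      then have "set_integrable lborel (box a b) u"
        by (rule set_integrable_subset) (auto simp: box_subset_cbox)
      then show ?thesis by (simp add: set_integrable_def)
    qed
    have "(LINT x:box c d|lborel. indicator (box a b) x * u x) = 0" for c d
    proof -
      \<comment> \<open>To work with a function integrable on the whole space, \<open>u\<close> is
        cut off outside one box; intersecting with a second box gives a box whose closure still lies
        in \<open>U\<close>, or the empty set.\<close>
      obtain a' b' where e: "box a b \<inter> box c d = box a' b'" using box_Int_box[of a b c d] by blast
      have "(LINT x:box a' b'|lborel. u x) = 0"
      proof (cases "box a' b' = {}")
        case False
        then have "cbox a' b' = closure (box a' b')" by (simp add: closure_box)
        also have "\<dots> \<subseteq> cbox a b" unfolding e[symmetric]
          using box_subset_cbox[of a b] by (intro closure_minimal) auto
        finally show ?thesis using ab by (intro box0) auto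
      qed (simp add: set_lebesgue_integral_def)
      moreover have "indicator (box c d) x *\<^sub>R (indicator (box a b) x * u x) = indicator (box a' b') x *\<^sub>R u x" for x
        by (simp add: e[symmetric] indicator_inter_arith mult_ac)
      ultimately show ?thesis by (simp only: set_lebesgue_integral_def)
    qed
    from integrable_zero_boxes_AE[OF i this] show ?thesis by eventually_elim (auto split: split_indicator)
  qed
  obtain \<D> where D: "countable \<D>" "\<D> \<subseteq> Pow U" "\<And>X. X \<in> \<D> \<Longrightarrow> \<exists>a b. X = cbox a b" "\<Union>\<D> = U"
    using open_countable_Union_open_cbox[OF U] by metis
  have "AE x in lborel. x \<in> X \<longrightarrow> u x = 0" if XD: "X \<in> \<D>" for X
  proof -
    obtain a b where "X = cbox a b" using D(3)[OF XD] by blast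
    then have X: "X = cbox a b" "cbox a b \<subseteq> U" using D(2) XD by auto
    have "AE x in lborel. x \<notin> cbox a b - box a b"
      by (intro AE_not_in) (simp add: null_sets_def emeasure_Diff box_subset_cbox
          emeasure_lborel_cbox_eq emeasure_lborel_box_eq)
    with loc[OF X(2)] show ?thesis by eventually_elim (auto simp: X)
  qed
  then have "AE x in lborel. \<forall>X\<in>\<D>. x \<in> X \<longrightarrow> u x = 0" unfolding AE_ball_countable[OF D(1)] by blast
  then show ?thesis by eventually_elim (use D(4) in auto)
qed

section \<open>Weak derivatives\<close>

lemma integrable_translate:
  fixes f :: "real^'n \<Rightarrow> real"
  assumes "integrable lborel f"
  shows "integrable lborel (\<lambda>x. f (c + x))"
proof -
  have [measurable]: "f \<in> borel_measurable borel" using borel_measurable_integrable[OF assms] by simp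
  have "integrable (distr lborel borel ((+) c)) f" using assms by (simp add: lborel_distr_plus)
  then show ?thesis by (subst (asm) integrable_distr_eq) auto
qed

lemma integral_translate:
  fixes f :: "real^'n \<Rightarrow> real"
  assumes [measurable]: "f \<in> borel_measurable borel"
  shows "(LINT x|lborel. f (c + x)) = (LINT x|lborel. f x)"
proof -
  have "(LINT x|lborel. f x) = (LINT x|distr lborel borel ((+) c). f x)"
    by (simp add: lborel_distr_plus)
  also have "\<dots> = (LINT x|lborel. f (c + x))" by (rule integral_distr) auto
  finally show ?thesis by simp
qed

lemma nn_integral_translate:
  fixes f :: "real^'n \<Rightarrow> ennreal"
  assumes [measurable]: "f \<in> borel_measurable borel"
  shows "(\<integral>\<^sup>+x. f (c + x) \<partial>lborel) = (\<integral>\<^sup>+x. f x \<partial>lborel)"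
proof -
  have "(\<integral>\<^sup>+x. f x \<partial>lborel) = (\<integral>\<^sup>+x. f x \<partial>distr lborel borel ((+) c))"
    by (simp add: lborel_distr_plus)
  also have "\<dots> = (\<integral>\<^sup>+x. f (c + x) \<partial>lborel)" by (rule nn_integral_distr) auto
  finally show ?thesis by simp
qed

lemma axis_mult_sum: "(\<Sum>k\<in>UNIV. axis i (1::real) $ k * c k) = c i"
proof -
  have "(\<Sum>k\<in>UNIV. axis i (1::real) $ k * c k) = (\<Sum>k\<in>UNIV. if k = i then c k else 0)"
    by (rule sum.cong) (auto simp: axis_def)
  then show ?thesis by simp
qed

text \<open>The difference quotients of \<open>f\<close> integrate to 0 by translation invariance.
  The mean value theorem bounds them by the maximum of the derivative on a ball enlarged by 1, the
  largest step size, so dominated convergence applies.\<close>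

lemma integral_partial_eq_0:
  fixes f :: "real^'n \<Rightarrow> real"
  assumes f: "Ck (Suc 0) f" and K: "compact K" and z: "\<And>x. x \<notin> K \<Longrightarrow> f x = 0"
    and z': "\<And>x. x \<notin> K \<Longrightarrow> partial_deriv i f x = 0"
  shows "(LINT x|lborel. partial_deriv i f x) = 0"
proof -
  have d: "f differentiable (at x)" for x using f by simp
  have cont: "continuous_on UNIV f" "continuous_on UNIV (partial_deriv i f)"
    using Ck_continuous[OF f] f by auto
  have [measurable]: "f \<in> borel_measurable borel" "partial_deriv i f \<in> borel_measurable borel"
    using cont by (auto intro: borel_measurable_continuous_onI)
  obtain M where M: "M \<ge> 0" "\<And>x. \<bar>partial_deriv i f x\<bar> \<le> M"
    using continuous_compact_support_bounded[OF cont(2) K z'] by blast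
  obtain R where R: "\<And>x. x \<in> K \<Longrightarrow> norm x \<le> R"
    using compact_imp_bounded[OF K] by (auto simp: bounded_iff)
  have fint: "integrable lborel f"
  proof -
    have "integrable lborel (\<lambda>x. indicator K x *\<^sub>R f x)"
      using borel_integrable_compact[OF K continuous_on_subset[OF cont(1)]] by simp
    moreover have "indicator K x *\<^sub>R f x = f x" for x using z[of x] by (auto split: split_indicator)
    ultimately show ?thesis by (simp only:)
  qed
  define e where "e = (axis i 1 :: real^'n)"
  define h where "h n = 1 / real (Suc n)" for n
  have h: "h n > 0" "h n \<le> 1" for n by (auto simp: h_def)
  have h0: "h \<longlonglongrightarrow> 0" using LIMSEQ_Suc[OF lim_1_over_n] unfolding h_def[abs_def] by simp
  define q where "q n x = (f (h n *\<^sub>R e + x) - f x) / h n" for n x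
  have der: "((\<lambda>t. f (x + t *\<^sub>R e)) has_real_derivative partial_deriv i f (x + t *\<^sub>R e)) (at t)" for x t
    using has_real_derivative_line[of f x e t, OF d] by (simp add: e_def axis_mult_sum)
  have int_q: "(LINT x|lborel. q n x) = 0" for n
  proof -
    have "(LINT x|lborel. q n x) = ((LINT x|lborel. f (h n *\<^sub>R e + x)) - (LINT x|lborel. f x)) / h n"
      unfolding q_def using fint integrable_translate[OF fint] by simp
    then show ?thesis by (simp add: integral_translate)
  qed
  have "(\<lambda>n. LINT x|lborel. q n x) \<longlonglongrightarrow> (LINT x|lborel. partial_deriv i f x)"
  proof (rule integral_dominated_convergence)
    show "integrable lborel (\<lambda>x. M * indicator (cball (0::real^'n) (R + 1)) x)"
      using emeasure_lborel_cball_finite[of "0::real^'n" "R+1"] by (intro integrable_mult_right) (auto simp: less_top)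
    show "AE x in lborel. (\<lambda>n. q n x) \<longlonglongrightarrow> partial_deriv i f x"
    proof (rule AE_I2)
      fix x
      have "((\<lambda>t. (f (x + t *\<^sub>R e) - f x) / t) \<longlongrightarrow> partial_deriv i f x) (at 0)"
        using der[of x 0] by (simp add: DERIV_def)
      from filterlim_compose[OF this, of h sequentially]
      have "(\<lambda>n. (f (x + h n *\<^sub>R e) - f x) / h n) \<longlonglongrightarrow> partial_deriv i f x"
        using h0 h(1) by (simp add: filterlim_at less_imp_neq[THEN not_sym] eventually_sequentially)
      then show "(\<lambda>n. q n x) \<longlonglongrightarrow> partial_deriv i f x" by (simp add: q_def add.commute)
    qed
    show "AE x in lborel. norm (q n x) \<le> M * indicator (cball 0 (R + 1)) x" for n
    proof (rule AE_I2)
      fix x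
      obtain t where t: "0 < t" "t < h n" "f (x + h n *\<^sub>R e) - f (x + 0 *\<^sub>R e) = (h n - 0) * partial_deriv i f (x + t *\<^sub>R e)"
        using MVT2[OF h(1)[of n], of "\<lambda>t. f (x + t *\<^sub>R e)" "\<lambda>t. partial_deriv i f (x + t *\<^sub>R e)"] der by blast
      then have q: "q n x = partial_deriv i f (x + t *\<^sub>R e)"
        using h(1)[of n] by (simp add: q_def add.commute)
      show "norm (q n x) \<le> M * indicator (cball 0 (R + 1)) x"
      proof (cases "x + t *\<^sub>R e \<in> K")
        case True
        have "norm x \<le> norm (x + t *\<^sub>R e) + norm (t *\<^sub>R e)" by (metis add_diff_cancel norm_triangle_ineq4)
        also have "\<dots> \<le> R + 1" using R[OF True] t h(2)[of n] by (simp add: e_def)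
        finally show ?thesis using M(2) q by simp
      next
        case False
        then show ?thesis using M(1) z' q by simp
      qed
    qed
  qed (auto simp: q_def[abs_def])
  then show ?thesis using int_q by (simp add: LIMSEQ_const_iff)
qed

lemma set_integral_test:
  assumes "test_function U \<psi>" "U \<subseteq> V"
  shows "(LINT x:V|lborel. u x * \<psi> x) = (LINT x:U|lborel. u x * \<psi> x)"
proof -
  have "indicator V x *\<^sub>R (u x * \<psi> x) = indicator U x *\<^sub>R (u x * \<psi> x)" for x
    using assms(2) test_functionD(3)[OF assms(1)] zero_outside_supp[of x \<psi>] by (auto split: split_indicator)
  then show ?thesis unfolding set_lebesgue_integral_def by (simp only:)
qed

lemma set_integral_test_UNIV:
  assumes "test_function U \<psi>"
  shows "(LINT x:U|lborel. u x * \<psi> x) = (LINT x|lborel. u x * \<psi> x)"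
  using set_integral_test[OF assms, of UNIV u] by (simp add: set_lebesgue_integral_def)

lemma integration_by_parts:
  assumes f: "Ck (Suc 0) f" and \<psi>: "test_function U \<psi>"
  shows "(LINT x:U|lborel. f x * partial_deriv i \<psi> x) = - (LINT x:U|lborel. partial_deriv i f x * \<psi> x)"
proof -
  have fd: "f differentiable (at x)" for x using f by simp
  have \<psi>d: "\<psi> differentiable (at x)" for x using test_functionD(1)[OF \<psi>, of "Suc 0"] by simp
  have eq: "partial_deriv i (\<lambda>x. f x * \<psi> x) x = f x * partial_deriv i \<psi> x + partial_deriv i f x * \<psi> x" for x
    by (rule partial_deriv_mult[OF fd \<psi>d])
  have \<psi>i: "test_function U (partial_deriv i \<psi>)" by (rule test_function_partial[OF \<psi>])
  have z: "\<psi> x = 0" "partial_deriv i \<psi> x = 0" if "x \<notin> supp \<psi>" for x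
    using that supp_partial_subset[of i \<psi>] zero_outside_supp by auto
  have "(LINT x|lborel. partial_deriv i (\<lambda>x. f x * \<psi> x) x) = 0"
    by (rule integral_partial_eq_0[OF Ck_mult[OF f test_functionD(1)[OF \<psi>]] test_functionD(2)[OF \<psi>]])
       (auto simp: eq z)
  moreover have "integrable lborel (\<lambda>x. f x * partial_deriv i \<psi> x)"
    using locally_integrable_test[OF locally_integrable_continuous[OF Ck_continuous[OF f]] test_function_mono[OF \<psi>i subset_UNIV]]
    by (simp add: set_integrable_def)
  moreover have "integrable lborel (\<lambda>x. partial_deriv i f x * \<psi> x)"
    using locally_integrable_test[OF locally_integrable_continuous[OF Ck_continuous[OF Ck_partial[OF f]]] test_function_mono[OF \<psi> subset_UNIV]]
    by (simp add: set_integrable_def)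
  ultimately show ?thesis
    by (simp add: eq set_integral_test_UNIV[OF \<psi>] set_integral_test_UNIV[OF \<psi>i])
qed

text \<open>The derivatives change sides one at a time, and the one applied last to \<open>f\<close>
  is the one applied first to the test function; hence \<open>rev\<close>.\<close>

lemma integration_by_parts_pd:
  assumes "Ck (length js) f" "test_function U \<psi>"
  shows "(LINT x:U|lborel. f x * pd (rev js) \<psi> x) = (-1) ^ length js * (LINT x:U|lborel. pd js f x * \<psi> x)"
  using assms
proof (induction js arbitrary: \<psi>)
  case (Cons i js)
  have "(LINT x:U|lborel. f x * pd (rev (i # js)) \<psi> x) = (LINT x:U|lborel. f x * pd (rev js) (partial_deriv i \<psi>) x)"
    by (simp add: pd_append)
  also have "\<dots> = (-1) ^ length js * (LINT x:U|lborel. pd js f x * partial_deriv i \<psi> x)"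
  proof (rule Cons.IH)
    show "Ck (length js) f" using Cons.prems(1) Ck_SucD[of "length js" f] by simp
    show "test_function U (partial_deriv i \<psi>)" by (rule test_function_partial[OF Cons.prems(2)])
  qed
  also have "(LINT x:U|lborel. pd js f x * partial_deriv i \<psi> x) = - (LINT x:U|lborel. pd (i # js) f x * \<psi> x)"
  proof -
    have "Ck (length js + Suc 0) f" using Cons.prems(1) by (simp del: Ck.simps)
    from integration_by_parts[OF Ck_pd[OF this] Cons.prems(2)] show ?thesis by simp
  qed
  finally show ?case by simp
qed simp

lemma multi_deriv_test:
  assumes "test_function U \<psi>" "mset js = \<alpha>"
  shows "multi_deriv \<alpha> \<psi> = pd js \<psi>"
  using multi_deriv_eq_pd[OF assms(2) test_functionD(1)[OF assms(1)]] .

section \<open>Calculus of weak derivatives\<close>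

lemma has_weak_deriv_Ck:
  assumes f: "Ck k f" and js: "mset js = \<alpha>" "length js \<le> k"
  shows "has_weak_deriv U \<alpha> f (pd js f)"
proof -
  have f': "Ck (length js + 0) f" using Ck_mono[OF f js(2)] by simp
  have "locally_integrable U f" "locally_integrable U (pd js f)"
    using Ck_continuous[OF f] Ck_continuous[OF Ck_pd[OF f']] by (auto intro: locally_integrable_continuous)
  moreover have "(LINT x:U|lborel. f x * multi_deriv \<alpha> \<psi> x) = (-1) ^ size \<alpha> * (LINT x:U|lborel. pd js f x * \<psi> x)"
    if "test_function U \<psi>" for \<psi>
  proof -
    have "multi_deriv \<alpha> \<psi> = pd (rev js) \<psi>" using js(1) by (intro multi_deriv_test[OF that]) simp
    moreover have "length js = size \<alpha>" using js(1) by auto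
    ultimately show ?thesis using integration_by_parts_pd[OF _ that, of js f] f' by simp
  qed
  ultimately show ?thesis by (simp add: has_weak_deriv_def)
qed

lemma has_weak_deriv_unique:
  assumes "open U" "has_weak_deriv U \<alpha> u w" "has_weak_deriv U \<alpha> u w'"
  shows "AE x in lborel. x \<in> U \<longrightarrow> w x = w' x"
proof -
  have li: "locally_integrable U w" "locally_integrable U w'" using assms by (auto simp: has_weak_deriv_def)
  have "(LINT x:U|lborel. (w x - w' x) * \<psi> x) = 0" if \<psi>: "test_function U \<psi>" for \<psi>
  proof -
    have "(LINT x:U|lborel. w x * \<psi> x) = (LINT x:U|lborel. w' x * \<psi> x)"
      using assms(2,3) \<psi> by (simp add: has_weak_deriv_def)
    moreover have "(LINT x:U|lborel. (w x - w' x) * \<psi> x) = (LINT x:U|lborel. w x * \<psi> x) - (LINT x:U|lborel. w' x * \<psi> x)"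
      using set_integral_diff(2)[OF locally_integrable_test[OF li(1) \<psi>] locally_integrable_test[OF li(2) \<psi>]]
      by (simp add: left_diff_distrib)
    ultimately show ?thesis by simp
  qed
  from fundamental_lemma[OF assms(1) locally_integrable_diff[OF li] this] show ?thesis by simp
qed

lemma has_weak_deriv_weak_deriv:
  "has_weak_deriv U \<alpha> u w \<Longrightarrow> has_weak_deriv U \<alpha> u (weak_deriv U \<alpha> u)"
  unfolding weak_deriv_def by (rule someI[of "has_weak_deriv U \<alpha> u"])

lemma has_weak_deriv_diff:
  assumes "has_weak_deriv U \<alpha> u w" "has_weak_deriv U \<alpha> u' w'"
  shows "has_weak_deriv U \<alpha> (\<lambda>x. u x - u' x) (\<lambda>x. w x - w' x)"
proof -
  have li: "locally_integrable U w" "locally_integrable U w'" "locally_integrable U u" "locally_integrable U u'"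
    using assms by (auto simp: has_weak_deriv_def)
  have d: "(LINT x:U|lborel. (v x - v' x) * \<psi> x) = (LINT x:U|lborel. v x * \<psi> x) - (LINT x:U|lborel. v' x * \<psi> x)"
    if "test_function U \<psi>" "locally_integrable U v" "locally_integrable U v'" for v v' \<psi>
    using set_integral_diff(2)[OF locally_integrable_test[OF that(2,1)] locally_integrable_test[OF that(3,1)]]
    by (simp add: left_diff_distrib)
  have "(LINT x:U|lborel. (u x - u' x) * multi_deriv \<alpha> \<psi> x) = (-1) ^ size \<alpha> * (LINT x:U|lborel. (w x - w' x) * \<psi> x)"
    if \<psi>: "test_function U \<psi>" for \<psi>
  proof -
    obtain js where js: "mset js = \<alpha>" using ex_mset by blast
    have "test_function U (multi_deriv \<alpha> \<psi>)"
      using multi_deriv_test[OF \<psi> js] test_function_pd[OF \<psi>] by simp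
    with d[OF \<psi> li(1,2)] d[OF this li(3,4)] show ?thesis
      using assms \<psi> by (simp add: has_weak_deriv_def right_diff_distrib)
  qed
  with li show ?thesis by (auto simp: has_weak_deriv_def intro: locally_integrable_diff)
qed

lemma has_weak_deriv_mono:
  assumes w: "has_weak_deriv V \<alpha> u w" and UV: "U \<subseteq> V"
  shows "has_weak_deriv U \<alpha> u w"
proof -
  have "(LINT x:U|lborel. u x * multi_deriv \<alpha> \<psi> x) = (-1) ^ size \<alpha> * (LINT x:U|lborel. w x * \<psi> x)"
    if \<psi>: "test_function U \<psi>" for \<psi>
  proof -
    obtain js where js: "mset js = \<alpha>" using ex_mset by blast
    have "test_function U (multi_deriv \<alpha> \<psi>)"
      using multi_deriv_test[OF \<psi> js] test_function_pd[OF \<psi>] by simp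
    then have "(LINT x:U|lborel. u x * multi_deriv \<alpha> \<psi> x) = (LINT x:V|lborel. u x * multi_deriv \<alpha> \<psi> x)"
      using set_integral_test UV by metis
    also have "\<dots> = (-1) ^ size \<alpha> * (LINT x:V|lborel. w x * \<psi> x)"
      using w test_function_mono[OF \<psi> UV] by (simp add: has_weak_deriv_def)
    also have "(LINT x:V|lborel. w x * \<psi> x) = (LINT x:U|lborel. w x * \<psi> x)"
      using set_integral_test[OF \<psi> UV] by simp
    finally show ?thesis .
  qed
  moreover have "locally_integrable U u" "locally_integrable U w"
    using w locally_integrable_mono[OF _ UV] by (auto simp: has_weak_deriv_def)
  ultimately show ?thesis by (simp add: has_weak_deriv_def)
qed

text \<open>The identity for \<alpha> is tested with a partial derivative of the test function and
  compared with the identity for the longer multi-index. In this form first-order inequalities can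
  be applied to higher derivatives one order at a time.\<close>

lemma has_weak_deriv_step:
  assumes w: "has_weak_deriv U \<alpha> u w" and w': "has_weak_deriv U (add_mset i \<alpha>) u w'"
  shows "has_weak_deriv U {#i#} w w'"
proof -
  have "(LINT x:U|lborel. w x * multi_deriv {#i#} \<psi> x) = (-1) ^ size {#i#} * (LINT x:U|lborel. w' x * \<psi> x)"
    if \<psi>: "test_function U \<psi>" for \<psi>
  proof -
    obtain js where js: "mset js = \<alpha>" using ex_mset by blast
    have \<psi>i: "test_function U (partial_deriv i \<psi>)" by (rule test_function_partial[OF \<psi>])
    have a: "multi_deriv \<alpha> (partial_deriv i \<psi>) = multi_deriv (add_mset i \<alpha>) \<psi>"
      using multi_deriv_test[OF \<psi>i js] multi_deriv_test[OF \<psi>, of "js @ [i]"] js by (simp add: pd_append)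
    have b: "multi_deriv {#i#} \<psi> = partial_deriv i \<psi>"
      using multi_deriv_test[OF \<psi>, of "[i]"] by simp
    have "(LINT x:U|lborel. u x * multi_deriv \<alpha> (partial_deriv i \<psi>) x) = (-1) ^ size \<alpha> * (LINT x:U|lborel. w x * partial_deriv i \<psi> x)"
      using w \<psi>i by (simp add: has_weak_deriv_def)
    moreover have "(LINT x:U|lborel. u x * multi_deriv (add_mset i \<alpha>) \<psi> x) = (-1) ^ Suc (size \<alpha>) * (LINT x:U|lborel. w' x * \<psi> x)"
      using w' \<psi> by (simp add: has_weak_deriv_def)
    ultimately have "(-1) ^ size \<alpha> * (LINT x:U|lborel. w x * partial_deriv i \<psi> x) = (-1) ^ size \<alpha> * (- (LINT x:U|lborel. w' x * \<psi> x))"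
      by (simp add: a)
    then have "(LINT x:U|lborel. w x * partial_deriv i \<psi> x) = - (LINT x:U|lborel. w' x * \<psi> x)"
      by (rule mult_left_cancel[THEN iffD1, rotated]) simp
    then show ?thesis by (simp add: b)
  qed
  then show ?thesis using w w' by (simp add: has_weak_deriv_def)
qed

lemma has_weak_deriv_empty: "locally_integrable U u \<Longrightarrow> has_weak_deriv U {#} u u"
  using multi_deriv_test[of U _ "[]" "{#}"] by (simp add: has_weak_deriv_def)

text \<open>Local integrability directly provides measurability only of truncations to compact sets;
  \<open>u\<close> is their pointwise limit along growing balls.\<close>

lemma locally_integrable_measurable:
  assumes u: "locally_integrable UNIV u"
  shows "u \<in> borel_measurable lborel"
proof (rule borel_measurable_LIMSEQ_real)
  show "(\<lambda>x. indicator (cball 0 (real n)) x *\<^sub>R u x) \<in> borel_measurable lborel" for n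
  proof -
    have "set_integrable lborel (cball 0 (real n)) u" using u compact_cball unfolding locally_integrable_def by blast
    then show ?thesis unfolding set_integrable_def by (rule borel_measurable_integrable)
  qed
  show "(\<lambda>n. indicator (cball 0 (real n)) x *\<^sub>R u x) \<longlonglongrightarrow> u x" for x
  proof (rule tendsto_eventually)
    obtain N where N: "norm x \<le> real N" using real_arch_simple by blast
    show "\<forall>\<^sub>F n in sequentially. indicator (cball 0 (real n)) x *\<^sub>R u x = u x"
      by (rule eventually_sequentiallyI[of N]) (use N in \<open>auto simp: indicator_def\<close>)
  qed
qed

section \<open>Differences of functions with weak derivatives\<close>

text \<open>Justifies the two exchanges of integration in the difference formula below: once with
  the shift on the test function, once with the shift on the gradient. The second bound is the first
  one translated.\<close>

lemma translate_product_integrable: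
  fixes a b :: "real^'n \<Rightarrow> real"
  assumes a: "locally_integrable UNIV a"
    and b[measurable]: "b \<in> borel_measurable borel" and M: "\<And>x. \<bar>b x\<bar> \<le> M" "M \<ge> 0"
    and K: "compact K" and z: "\<And>x. x \<notin> K \<Longrightarrow> b x = 0"
  shows "integrable (lborel \<Otimes>\<^sub>M lborel) (\<lambda>(t::real, x). indicator {0..1} t * (a x * b (x - t *\<^sub>R z0)))" (is ?A)
    and "integrable (lborel \<Otimes>\<^sub>M lborel) (\<lambda>(t::real, x). indicator {0..1} t * (a (x + t *\<^sub>R z0) * b x))" (is ?B)
proof -
  have [measurable]: "a \<in> borel_measurable borel" using locally_integrable_measurable[OF a] by simp
  obtain R where R: "\<And>x. x \<in> K \<Longrightarrow> norm x \<le> R"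
    using compact_imp_bounded[OF K] by (auto simp: bounded_iff)
  \<comment> \<open>For \<open>t\<close> between 0 and 1 all translates of \<open>K\<close> by
    \<open>t *\<^sub>R z0\<close> stay in this ball, which gives a bound uniform in
    \<open>t\<close>.\<close>
  define K' where "K' = cball (0::real^'n) (R + norm z0)"
  have [measurable]: "K' \<in> sets borel" by (simp add: K'_def)
  have ia: "integrable lborel (\<lambda>x. indicator K' x *\<^sub>R a x)"
  proof -
    have "set_integrable lborel K' a"
      using a compact_cball unfolding locally_integrable_def K'_def by blast
    then show ?thesis by (simp only: set_integrable_def)
  qed
  define C where "C = (\<integral>\<^sup>+x. ennreal (M * \<bar>indicator K' x *\<^sub>R a x\<bar>) \<partial>lborel)"
  have C: "C < \<infinity>"
    using integrable_mult_right[OF integrable_abs[OF ia], of M] M(2)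
    unfolding C_def integrable_iff_bounded by (simp add: abs_mult)
  have bnd: "(\<integral>\<^sup>+x. ennreal (norm (a x * b (x - t *\<^sub>R z0))) \<partial>lborel) \<le> C" if t: "t \<in> {0..1}" for t
    unfolding C_def
  proof (rule nn_integral_mono)
    fix x
    show "ennreal (norm (a x * b (x - t *\<^sub>R z0))) \<le> ennreal (M * \<bar>indicator K' x *\<^sub>R a x\<bar>)"
    proof (cases "x - t *\<^sub>R z0 \<in> K")
      case True
      have "norm x \<le> norm (x - t *\<^sub>R z0) + norm (t *\<^sub>R z0)" by (metis diff_add_cancel norm_triangle_ineq)
      also have "\<dots> \<le> R + norm z0" using R[OF True] t by (intro add_mono) (auto simp: mult_left_le_one_le)
      finally have "x \<in> K'" by (simp add: K'_def)
      then show ?thesis using mult_right_mono[OF M(1)[of "x - t *\<^sub>R z0"], of "\<bar>a x\<bar>"]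
        by (simp add: abs_mult mult.commute ennreal_leI)
    next
      case False
      then show ?thesis using z by simp
    qed
  qed
  have bnd2: "(\<integral>\<^sup>+x. ennreal (norm (a (x + t *\<^sub>R z0) * b x)) \<partial>lborel) \<le> C" if t: "t \<in> {0..1}" for t
    using nn_integral_translate[of "\<lambda>x. ennreal (norm (a x * b (x - t *\<^sub>R z0)))" "t *\<^sub>R z0"] bnd[OF t]
    by (simp add: add.commute)
  have fin: "(\<integral>\<^sup>+t. indicator {0..1::real} t * C \<partial>lborel) < \<infinity>"
    using C by (simp add: nn_integral_multc)
  have gen: "integrable (lborel \<Otimes>\<^sub>M lborel) (\<lambda>(t::real, x). indicator {0..1} t * f t x)"
    if [measurable]: "case_prod f \<in> borel_measurable (borel \<Otimes>\<^sub>M borel)"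
      and f: "\<And>t. t \<in> {0..1} \<Longrightarrow> (\<integral>\<^sup>+x. ennreal (norm (f t x)) \<partial>lborel) \<le> C" for f :: "real \<Rightarrow> real^'n \<Rightarrow> real"
  proof (rule integrableI_bounded)
    show "(\<lambda>(t, x). indicator {0..1} t * f t x) \<in> borel_measurable (lborel \<Otimes>\<^sub>M lborel)"
      by measurable
    have "(\<integral>\<^sup>+y. ennreal (norm (case y of (t, x) \<Rightarrow> indicator {0..1} t * f t x)) \<partial>(lborel \<Otimes>\<^sub>M lborel))
      = (\<integral>\<^sup>+t. \<integral>\<^sup>+x. ennreal (norm (indicator {0..1} t * f t x)) \<partial>lborel \<partial>lborel)"
      by (subst lborel.nn_integral_fst[symmetric]) auto
    also have "\<dots> \<le> (\<integral>\<^sup>+t. indicator {0..1::real} t * C \<partial>lborel)"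
      by (rule nn_integral_mono) (use f in \<open>auto split: split_indicator\<close>)
    finally show "(\<integral>\<^sup>+y. ennreal (norm (case y of (t, x) \<Rightarrow> indicator {0..1} t * f t x)) \<partial>(lborel \<Otimes>\<^sub>M lborel)) < \<infinity>"
      using fin by (rule le_less_trans)
  qed
  show ?A by (rule gen) (use bnd in auto)
  show ?B by (rule gen) (use bnd2 in auto)
qed

lemma locally_integrable_translate:
  fixes u :: "real^'n \<Rightarrow> real"
  assumes "locally_integrable UNIV u"
  shows "locally_integrable UNIV (\<lambda>x. u (z + x))"
  unfolding locally_integrable_def
proof (intro allI impI, elim conjE)
  fix K :: "(real^'n) set" assume K: "compact K"
  have "integrable lborel (\<lambda>x. indicator ((+) z ` K) x *\<^sub>R u x)"
    using assms compact_translation[OF K, of z] by (simp add: locally_integrable_def set_integrable_def)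
  from integrable_translate[OF this, of z]
  have "integrable lborel (\<lambda>x. indicator ((+) z ` K) (z + x) *\<^sub>R u (z + x))" .
  moreover have "indicator ((+) z ` K) (z + x) = (indicator K x :: real)" for x
    by (auto simp: indicator_def)
  ultimately show "set_integrable lborel K (\<lambda>x. u (z + x))" by (simp add: set_integrable_def)
qed

text \<open>For a test function the identity is the fundamental theorem of calculus on a segment.
  Pairing it with \<open>u\<close>, exchanging the integrals and using the weak gradient for each
  fixed \<open>t\<close> moves the segment integral to the gradient, so the defect \<open>D\<close>
  annihilates all test functions. The exceptional null set may depend on \<open>z\<close>.\<close>

theorem weak_deriv_difference:
  fixes u :: "real^'n \<Rightarrow> real" and g :: "'n \<Rightarrow> real^'n \<Rightarrow> real"
  assumes w: "\<And>i. has_weak_deriv UNIV {#i#} u (g i)"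
  shows "AE x in lborel. u (z + x) - u x = (LINT t|lborel. indicator {0..1} t * (\<Sum>i\<in>UNIV. z $ i * g i (x + t *\<^sub>R z)))"
proof -
  have ui: "locally_integrable UNIV u" and gi: "locally_integrable UNIV (g i)" for i
    using w by (auto simp: has_weak_deriv_def)
  define G where "G x = (\<Sum>i\<in>UNIV. z $ i * g i x)" for x
  have Gi: "locally_integrable UNIV G"
    using gi unfolding locally_integrable_def set_integrable_def G_def
    by (auto simp: sum_distrib_left mult.left_commute)
  have [measurable]: "u \<in> borel_measurable borel" "G \<in> borel_measurable borel"
    using locally_integrable_measurable[OF ui] locally_integrable_measurable[OF Gi] by auto
  define I where "I x = (LINT t|lborel. indicator {0..1} t * G (x + t *\<^sub>R z))" for x
  have I_eq: "(LINT t|lborel. indicator {0..1} t * (G (x + t *\<^sub>R z) * c)) = I x * c" for x c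
    unfolding I_def by (simp flip: mult.assoc)
  have Ii: "locally_integrable UNIV I"
    unfolding locally_integrable_def
  proof (intro allI impI, elim conjE)
    fix K :: "(real^'n) set" assume K: "compact K"
    have "integrable (lborel \<Otimes>\<^sub>M lborel) (\<lambda>(t::real, x). indicator {0..1} t * (G (x + t *\<^sub>R z) * indicator K x))"
      using K borel_compact[OF K]
      by (intro translate_product_integrable(2)[OF Gi, where M = 1 and K = K]) (auto split: split_indicator)
    from lborel_pair.integrable_snd[OF this]
    have "integrable lborel (\<lambda>x. I x * indicator K x)" by (simp add: I_eq)
    then show "set_integrable lborel K I" by (simp add: set_integrable_def mult.commute)
  qed
  define D where "D x = u (z + x) - u x - I x" for x
  have "locally_integrable UNIV D"
    unfolding D_def by (intro locally_integrable_diff locally_integrable_translate ui Ii)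
  moreover have "(LINT x:UNIV|lborel. D x * \<psi> x) = 0" if \<psi>: "test_function UNIV \<psi>" for \<psi>
  proof -
    define \<psi>z where "\<psi>z x = (\<Sum>i\<in>UNIV. z $ i * partial_deriv i \<psi> x)" for x
    have \<psi>d: "\<psi> differentiable (at x)" for x using test_functionD(1)[OF \<psi>, of "Suc 0"] by simp
    have \<psi>c: "continuous_on UNIV \<psi>" using Ck_continuous[OF test_functionD(1)[OF \<psi>]] .
    have \<psi>ic: "continuous_on UNIV (partial_deriv i \<psi>)" for i
      using Ck_continuous[OF test_functionD(1)[OF test_function_partial[OF \<psi>]]] .
    have \<psi>zc: "continuous_on UNIV \<psi>z" unfolding \<psi>z_def[abs_def] by (intro continuous_intros \<psi>ic)
    have \<psi>z0: "\<psi>z x = 0" if "x \<notin> supp \<psi>" for x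
      using that supp_partial_subset[of _ \<psi>] zero_outside_supp[of x] unfolding \<psi>z_def by (intro sum.neutral) auto
    have [measurable]: "\<psi> \<in> borel_measurable borel" "\<psi>z \<in> borel_measurable borel"
      using \<psi>c \<psi>zc by (auto intro: borel_measurable_continuous_onI)
    obtain M where M: "M \<ge> 0" "\<And>x. \<bar>\<psi> x\<bar> \<le> M"
      using continuous_compact_support_bounded[OF \<psi>c test_functionD(2)[OF \<psi>] zero_outside_supp[of _ \<psi>]] by blast
    obtain Mz where Mz: "Mz \<ge> 0" "\<And>x. \<bar>\<psi>z x\<bar> \<le> Mz"
      using continuous_compact_support_bounded[OF \<psi>zc test_functionD(2)[OF \<psi>] \<psi>z0] by blast
    have int1: "integrable (lborel \<Otimes>\<^sub>M lborel) (\<lambda>(t::real, x). indicator {0..1} t * (u x * \<psi>z (x - t *\<^sub>R z)))"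
      by (rule translate_product_integrable(1)[where a = u and b = \<psi>z and M = Mz and K = "supp \<psi>"])
         (use ui Mz \<psi>z0 test_functionD(2)[OF \<psi>] in auto)
    have int2: "integrable (lborel \<Otimes>\<^sub>M lborel) (\<lambda>(t::real, x). indicator {0..1} t * (G (x + t *\<^sub>R z) * \<psi> x))"
      by (rule translate_product_integrable(2)[where a = G and b = \<psi> and M = M and K = "supp \<psi>"])
         (use Gi M zero_outside_supp[of _ \<psi>] test_functionD(2)[OF \<psi>] in auto)
    have ftc: "\<psi> (x - z) - \<psi> x = - (LINT t|lborel. indicator {0..1} t * \<psi>z (x - t *\<^sub>R z))" for x
    proof -
      have "((\<lambda>t. \<psi> (x - t *\<^sub>R z)) has_vector_derivative - \<psi>z (x - t *\<^sub>R z)) (at t within {0..1})" for t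
        using has_real_derivative_line[of \<psi> x "- z" t, OF \<psi>d]
        by (simp add: \<psi>z_def sum_negf has_real_derivative_iff_has_vector_derivative has_vector_derivative_at_within)
      moreover have "continuous_on {0..1} (\<lambda>t. - \<psi>z (x - t *\<^sub>R z))"
        by (intro continuous_intros continuous_on_compose2[OF \<psi>zc]) auto
      ultimately have "(LINT t|lborel. indicator {0..1} t *\<^sub>R (- \<psi>z (x - t *\<^sub>R z))) = \<psi> (x - 1 *\<^sub>R z) - \<psi> (x - 0 *\<^sub>R z)"
        by (intro integral_FTC_atLeastAtMost) auto
      then show ?thesis by simp
    qed
    \<comment> \<open>The weak derivative is tested with the shifted function
      \<open>\<psi>t\<close>; translating back afterwards leaves the shift, in the opposite
      direction, on the gradient.\<close>
    have int_t: "(LINT x|lborel. u x * \<psi>z (x - t *\<^sub>R z)) = - (LINT x|lborel. G (x + t *\<^sub>R z) * \<psi> x)" for t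
    proof -
      define \<psi>t where "\<psi>t x = \<psi> (x - t *\<^sub>R z)" for x
      have \<psi>t: "test_function UNIV \<psi>t"
        using test_function_translate[OF \<psi>, of "- t *\<^sub>R z"] by (simp add: \<psi>t_def[abs_def])
      have pt: "partial_deriv i \<psi>t x = partial_deriv i \<psi> (x - t *\<^sub>R z)" for i x
        using partial_deriv_translate[of \<psi> x "- t *\<^sub>R z" i] \<psi>d by (simp add: \<psi>t_def[abs_def])
      have md: "multi_deriv {#i#} \<psi>t = partial_deriv i \<psi>t" for i
        using multi_deriv_test[OF \<psi>t, of "[i]"] by simp
      have byp: "(LINT x|lborel. u x * partial_deriv i \<psi>t x) = - (LINT x|lborel. g i x * \<psi>t x)" for i
      proof -
        have "(LINT x:UNIV|lborel. u x * multi_deriv {#i#} \<psi>t x) = (-1) ^ size {#i#} * (LINT x:UNIV|lborel. g i x * \<psi>t x)"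
          using w[of i] \<psi>t unfolding has_weak_deriv_def by blast
        then show ?thesis by (simp add: md set_lebesgue_integral_def)
      qed
      have iu: "integrable lborel (\<lambda>x. u x * partial_deriv i \<psi>t x)" for i
        using locally_integrable_test[OF ui test_function_partial[OF \<psi>t]] by (simp add: set_integrable_def)
      have ig: "integrable lborel (\<lambda>x. g i x * \<psi>t x)" for i
        using locally_integrable_test[OF gi \<psi>t] by (simp add: set_integrable_def)
      have "(LINT x|lborel. u x * \<psi>z (x - t *\<^sub>R z)) = (LINT x|lborel. (\<Sum>i\<in>UNIV. z $ i * (u x * partial_deriv i \<psi>t x)))"
        by (simp add: \<psi>z_def pt sum_distrib_left mult.left_commute)
      also have "\<dots> = (\<Sum>i\<in>UNIV. z $ i * (LINT x|lborel. u x * partial_deriv i \<psi>t x))"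
        using iu by simp
      also have "\<dots> = (\<Sum>i\<in>UNIV. z $ i * (- (LINT x|lborel. g i x * \<psi>t x)))"
        by (simp add: byp)
      also have "\<dots> = - (\<Sum>i\<in>UNIV. z $ i * (LINT x|lborel. g i x * \<psi>t x))"
        by (simp add: sum_negf)
      also have "(\<Sum>i\<in>UNIV. z $ i * (LINT x|lborel. g i x * \<psi>t x)) = (LINT x|lborel. (\<Sum>i\<in>UNIV. z $ i * (g i x * \<psi>t x)))"
        using ig by simp
      also have "\<dots> = (LINT x|lborel. G x * \<psi>t x)"
        by (simp add: G_def sum_distrib_right mult.assoc)
      also have "\<dots> = (LINT x|lborel. G (t *\<^sub>R z + x) * \<psi>t (t *\<^sub>R z + x))"
        by (rule integral_translate[symmetric]) (simp add: \<psi>t_def[abs_def])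
      also have "\<dots> = (LINT x|lborel. G (x + t *\<^sub>R z) * \<psi> x)"
        by (simp add: \<psi>t_def add.commute)
      finally show ?thesis .
    qed
    have "(LINT x|lborel. u x * (\<psi> (x - z) - \<psi> x))
        = - (LINT x|lborel. (LINT t|lborel. indicator {0..1} t * (u x * \<psi>z (x - t *\<^sub>R z))))"
      by (simp add: ftc mult.left_commute[of "indicator _ _"])
    also have "(LINT x|lborel. (LINT t|lborel. indicator {0..1} t * (u x * \<psi>z (x - t *\<^sub>R z))))
        = (LINT t|lborel. (LINT x|lborel. indicator {0..1} t * (u x * \<psi>z (x - t *\<^sub>R z))))"
      by (rule lborel_pair.Fubini_integral[OF int1])
    also have "\<dots> = (LINT t|lborel. - (LINT x|lborel. indicator {0..1} t * (G (x + t *\<^sub>R z) * \<psi> x)))"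
      by (simp add: int_t)
    also have "\<dots> = - (LINT t|lborel. (LINT x|lborel. indicator {0..1} t * (G (x + t *\<^sub>R z) * \<psi> x)))"
      by (rule integral_minus)
    also have "(LINT t|lborel. (LINT x|lborel. indicator {0..1} t * (G (x + t *\<^sub>R z) * \<psi> x)))
        = (LINT x|lborel. I x * \<psi> x)"
      using lborel_pair.Fubini_integral[OF int2] by (simp add: I_eq)
    finally have main: "(LINT x|lborel. u x * (\<psi> (x - z) - \<psi> x)) = (LINT x|lborel. I x * \<psi> x)" by simp
    have i1: "integrable lborel (\<lambda>x. u (z + x) * \<psi> x)" "integrable lborel (\<lambda>x. u x * \<psi> x)" "integrable lborel (\<lambda>x. I x * \<psi> x)"
      using locally_integrable_test[OF locally_integrable_translate[OF ui, of z] \<psi>] locally_integrable_test[OF ui \<psi>]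
        locally_integrable_test[OF Ii \<psi>] by (simp_all add: set_integrable_def)
    have "test_function UNIV (\<lambda>x. \<psi> (x + - z))" by (rule test_function_translate[OF \<psi>])
    from locally_integrable_test[OF ui this] have i2: "integrable lborel (\<lambda>x. u x * \<psi> (x - z))"
      by (simp add: set_integrable_def)
    have tr: "(LINT x|lborel. u (z + x) * \<psi> x) = (LINT x|lborel. u x * \<psi> (x - z))"
      using integral_translate[of "\<lambda>x. u x * \<psi> (x - z)" z] by simp
    have "(LINT x|lborel. D x * \<psi> x) = (LINT x|lborel. u (z + x) * \<psi> x) - (LINT x|lborel. u x * \<psi> x) - (LINT x|lborel. I x * \<psi> x)"
      using i1 by (simp add: D_def left_diff_distrib)
    also have "\<dots> = (LINT x|lborel. u x * (\<psi> (x - z) - \<psi> x)) - (LINT x|lborel. I x * \<psi> x)"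
      using i1 i2 by (simp add: tr right_diff_distrib)
    finally show ?thesis using main by (simp add: set_lebesgue_integral_def)
  qed
  ultimately have "AE x in lborel. x \<in> UNIV \<longrightarrow> D x = 0"
    by (intro fundamental_lemma) auto
  then show ?thesis by eventually_elim (simp add: D_def I_def G_def)
qed

text \<open>Jensen's inequality on the unit interval, from the nonnegative integral of
  \<open>(h t - c)\<^sup>2\<close> with \<open>c\<close> the mean. If \<open>h\<close> is not
  integrable there, the Bochner integral on the left is 0 by convention and the bound is
  trivial.\<close>

lemma square_integral_le:
  fixes h :: "real \<Rightarrow> real"
  assumes [measurable]: "h \<in> borel_measurable borel"
  shows "ennreal ((LINT t|lborel. indicator {0..1} t * h t)\<^sup>2) \<le> (\<integral>\<^sup>+t. indicator {0..1} t * ennreal ((h t)\<^sup>2) \<partial>lborel)"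
    (is "ennreal (?c\<^sup>2) \<le> ?r")
proof (cases "?r = \<infinity> \<or> \<not> integrable lborel (\<lambda>t. indicator {0..1} t * h t)")
  case True
  then show ?thesis by (auto simp: not_integrable_integral_eq)
next
  case False
  have e: "indicator {0..1} t * ennreal ((h t)\<^sup>2) = ennreal (indicator {0..1} t * (h t)\<^sup>2)" for t
    by (auto split: split_indicator)
  have i1: "integrable lborel (\<lambda>t. indicator {0..1} t * h t)" using False by simp
  have i2: "integrable lborel (\<lambda>t. indicator {0..1} t * (h t)\<^sup>2)"
    using False unfolding e by (intro integrableI_nonneg) (auto simp: less_top)
  have i3: "integrable lborel (indicator {0..1::real} :: real \<Rightarrow> real)" by simp
  define c where "c = ?c"
  have "0 \<le> (LINT t|lborel. indicator {0..1} t * (h t - c)\<^sup>2)"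
    by (rule integral_nonneg_AE) (auto split: split_indicator)
  also have "\<dots> = (LINT t|lborel. indicator {0..1} t * (h t)\<^sup>2 - 2 * c * (indicator {0..1} t * h t) + c\<^sup>2 * indicator {0..1} t)"
    by (simp add: power2_diff algebra_simps)
  also have "\<dots> = (LINT t|lborel. indicator {0..1} t * (h t)\<^sup>2) - 2 * c * c + c\<^sup>2"
    using i1 i2 i3 by (simp add: c_def)
  finally have "c\<^sup>2 \<le> (LINT t|lborel. indicator {0..1} t * (h t)\<^sup>2)" by (simp add: power2_eq_square)
  then have "ennreal (c\<^sup>2) \<le> ennreal (LINT t|lborel. indicator {0..1} t * (h t)\<^sup>2)" by (rule ennreal_leI)
  also have "\<dots> = ?r" unfolding e by (rule nn_integral_eq_integral[OF i2, symmetric]) auto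
  finally show ?thesis by (simp add: c_def)
qed

lemma weak_deriv_difference_square:
  fixes u :: "real^'n \<Rightarrow> real" and g :: "'n \<Rightarrow> real^'n \<Rightarrow> real"
  assumes w: "\<And>i. has_weak_deriv UNIV {#i#} u (g i)"
  shows "AE x in lborel. ennreal ((u (x + z) - u x)\<^sup>2)
     \<le> ennreal ((norm z)\<^sup>2) * (\<integral>\<^sup>+t. indicator {0..1} t * ennreal (\<Sum>i\<in>UNIV. (g i (x + t *\<^sub>R z))\<^sup>2) \<partial>lborel)"
  using weak_deriv_difference[OF w, of z]
proof eventually_elim
  case (elim x)
  have [measurable]: "g i \<in> borel_measurable borel" for i
    using locally_integrable_measurable[of "g i"] w by (simp add: has_weak_deriv_def)
  have nz: "(norm z)\<^sup>2 = (\<Sum>i\<in>UNIV. z $ i * z $ i)"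
    by (simp add: power2_norm_eq_inner inner_vec_def)
  have cs: "(\<Sum>i\<in>UNIV. z $ i * g i y)\<^sup>2 \<le> (norm z)\<^sup>2 * (\<Sum>i\<in>UNIV. (g i y)\<^sup>2)" for y
    using Cauchy_Schwarz_ineq[of z "\<chi> i. g i y"]
    unfolding nz unfolding power2_eq_square by (simp add: inner_vec_def)
  have "ennreal ((u (x + z) - u x)\<^sup>2) \<le> (\<integral>\<^sup>+t. indicator {0..1} t * ennreal ((\<Sum>i\<in>UNIV. z $ i * g i (x + t *\<^sub>R z))\<^sup>2) \<partial>lborel)"
    using square_integral_le[of "\<lambda>t. \<Sum>i\<in>UNIV. z $ i * g i (x + t *\<^sub>R z)"] elim by (simp add: add.commute)
  also have "\<dots> \<le> (\<integral>\<^sup>+t. ennreal ((norm z)\<^sup>2) * (indicator {0..1} t * ennreal (\<Sum>i\<in>UNIV. (g i (x + t *\<^sub>R z))\<^sup>2)) \<partial>lborel)"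
    using cs by (intro nn_integral_mono) (auto simp: ennreal_mult'[symmetric] ennreal_leI split: split_indicator)
  also have "\<dots> = ennreal ((norm z)\<^sup>2) * (\<integral>\<^sup>+t. indicator {0..1} t * ennreal (\<Sum>i\<in>UNIV. (g i (x + t *\<^sub>R z))\<^sup>2) \<partial>lborel)"
    by (rule nn_integral_cmult) measurable
  finally show ?case .
qed

section \<open>The Poincare inequality\<close>

lemma nn_integral_affine:
  fixes f :: "real^'n \<Rightarrow> ennreal"
  assumes [measurable]: "f \<in> borel_measurable borel" and c: "c > 0"
  shows "(\<integral>\<^sup>+x. f x \<partial>lborel) = ennreal (c ^ CARD('n)) * (\<integral>\<^sup>+x. f (b + c *\<^sub>R x) \<partial>lborel)"
proof -
  have "(\<integral>\<^sup>+x. f x \<partial>lborel) = (\<integral>\<^sup>+x. f x \<partial>density (distr lborel borel (\<lambda>x. b + c *\<^sub>R x)) (\<lambda>_. \<bar>c\<bar> ^ DIM(real^'n)))"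
    using lborel_affine[of c b] c by simp
  also have "\<dots> = ennreal (c ^ CARD('n)) * (\<integral>\<^sup>+x. f (b + c *\<^sub>R x) \<partial>lborel)"
    using c by (simp add: nn_integral_density nn_integral_distr nn_integral_cmult)
  finally show ?thesis .
qed

text \<open>For fixed \<open>x\<close> the map from \<open>y\<close> to
  \<open>x + t *\<^sub>R (y - x)\<close> sends the convex set \<open>Q\<close> into itself and
  scales volume by the power \<open>CARD('n)\<close> of \<open>t\<close>. For \<open>t\<close> at
  least 1/2 the inverse of that factor is at most \<open>2 ^ CARD('n)\<close>.\<close>

lemma convex_average_bound:
  fixes H :: "real^'n \<Rightarrow> ennreal"
  assumes [measurable]: "H \<in> borel_measurable borel" "Q \<in> sets borel" and Q: "convex Q"
    and t: "1/2 \<le> t" "t \<le> 1"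
  shows "(\<integral>\<^sup>+x. indicator Q x * (\<integral>\<^sup>+y. indicator Q y * H (x + t *\<^sub>R (y - x)) \<partial>lborel) \<partial>lborel)
     \<le> ennreal (2 ^ CARD('n)) * emeasure lborel Q * (\<integral>\<^sup>+x. indicator Q x * H x \<partial>lborel)"
proof -
  let ?J = "\<integral>\<^sup>+x. indicator Q x * H x \<partial>lborel"
  have inner: "(\<integral>\<^sup>+y. indicator Q y * H (x + t *\<^sub>R (y - x)) \<partial>lborel) \<le> ennreal (2 ^ CARD('n)) * ?J" if x: "x \<in> Q" for x
  proof -
    let ?b = "(1 - t) *\<^sub>R x"
    have "indicator Q y * H (x + t *\<^sub>R (y - x)) \<le> indicator Q (?b + t *\<^sub>R y) * H (?b + t *\<^sub>R y)" for y
    proof (cases "y \<in> Q")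
      case True
      then have "?b + t *\<^sub>R y \<in> Q" using Q x t by (intro convexD) auto
      moreover have "x + t *\<^sub>R (y - x) = ?b + t *\<^sub>R y" by (simp add: algebra_simps)
      ultimately show ?thesis using True by simp
    qed simp
    then have "(\<integral>\<^sup>+y. indicator Q y * H (x + t *\<^sub>R (y - x)) \<partial>lborel) \<le> (\<integral>\<^sup>+y. indicator Q (?b + t *\<^sub>R y) * H (?b + t *\<^sub>R y) \<partial>lborel)"
      by (intro nn_integral_mono)
    also have "\<dots> = 1 * (\<integral>\<^sup>+y. indicator Q (?b + t *\<^sub>R y) * H (?b + t *\<^sub>R y) \<partial>lborel)" by simp
    also have "\<dots> \<le> ennreal (2 ^ CARD('n) * t ^ CARD('n)) * (\<integral>\<^sup>+y. indicator Q (?b + t *\<^sub>R y) * H (?b + t *\<^sub>R y) \<partial>lborel)"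
    proof (rule mult_right_mono)
      have "1 \<le> (2 * t) ^ CARD('n)" using t by (intro one_le_power) simp
      then show "1 \<le> ennreal (2 ^ CARD('n) * t ^ CARD('n))" by (simp add: power_mult_distrib)
    qed simp
    also have "\<dots> = ennreal (2 ^ CARD('n)) * ?J"
      using nn_integral_affine[of "\<lambda>x. indicator Q x * H x" t ?b] t
      by (simp add: ennreal_mult' mult.assoc)
    finally show ?thesis .
  qed
  have "(\<integral>\<^sup>+x. indicator Q x * (\<integral>\<^sup>+y. indicator Q y * H (x + t *\<^sub>R (y - x)) \<partial>lborel) \<partial>lborel)
     \<le> (\<integral>\<^sup>+x. indicator Q x * (ennreal (2 ^ CARD('n)) * ?J) \<partial>lborel)"
    using inner by (intro nn_integral_mono) (auto split: split_indicator)
  also have "\<dots> = ennreal (2 ^ CARD('n)) * emeasure lborel Q * ?J"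
    by (simp add: nn_integral_multc mult_ac)
  finally show ?thesis .
qed

text \<open>For small \<open>t\<close> the substitution in \<open>y\<close> degenerates. The point
  on the segment is then read from the other end, as \<open>y + (1 - t) *\<^sub>R (x - y)\<close>,
  and the roles of \<open>x\<close> and \<open>y\<close> are exchanged.\<close>

lemma convex_average_bound':
  fixes H :: "real^'n \<Rightarrow> ennreal"
  assumes H[measurable]: "H \<in> borel_measurable borel" and Qm[measurable]: "Q \<in> sets borel" and Q: "convex Q"
    and t: "0 \<le> t" "t \<le> 1"
  shows "(\<integral>\<^sup>+x. indicator Q x * (\<integral>\<^sup>+y. indicator Q y * H (x + t *\<^sub>R (y - x)) \<partial>lborel) \<partial>lborel)
     \<le> ennreal (2 ^ CARD('n)) * emeasure lborel Q * (\<integral>\<^sup>+x. indicator Q x * H x \<partial>lborel)"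
proof (cases "1/2 \<le> t")
  case True
  then show ?thesis using convex_average_bound[OF H Qm Q] t by simp
next
  case False
  have "(\<integral>\<^sup>+x. indicator Q x * (\<integral>\<^sup>+y. indicator Q y * H (x + t *\<^sub>R (y - x)) \<partial>lborel) \<partial>lborel)
    = (\<integral>\<^sup>+x. (\<integral>\<^sup>+y. indicator Q x * (indicator Q y * H (x + t *\<^sub>R (y - x))) \<partial>lborel) \<partial>lborel)"
    by (simp add: nn_integral_cmult)
  also have "\<dots> = (\<integral>\<^sup>+y. (\<integral>\<^sup>+x. indicator Q x * (indicator Q y * H (x + t *\<^sub>R (y - x))) \<partial>lborel) \<partial>lborel)"
    by (rule lborel_pair.Fubini') measurable
  also have "\<dots> = (\<integral>\<^sup>+y. indicator Q y * (\<integral>\<^sup>+x. indicator Q x * H (y + (1 - t) *\<^sub>R (x - y)) \<partial>lborel) \<partial>lborel)"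
    by (simp add: nn_integral_cmult[symmetric] mult.left_commute algebra_simps)
  also have "\<dots> \<le> ennreal (2 ^ CARD('n)) * emeasure lborel Q * (\<integral>\<^sup>+x. indicator Q x * H x \<partial>lborel)"
    using convex_average_bound[OF H Qm Q, of "1 - t"] t False by simp
  finally show ?thesis .
qed

text \<open>The square of each difference is bounded by an average of the squared gradient over the
  segment. After the integral over \<open>t\<close> has been moved outside, every slice is an
  average over \<open>Q\<close> of the kind bounded above, uniformly in \<open>t\<close>.\<close>

lemma poincare_double:
  fixes u :: "real^'n \<Rightarrow> real" and g :: "'n \<Rightarrow> real^'n \<Rightarrow> real"
  assumes w: "\<And>i. has_weak_deriv UNIV {#i#} u (g i)"
    and Qm[measurable]: "Q \<in> sets borel" and Q: "convex Q"
    and D: "\<And>x y. x \<in> Q \<Longrightarrow> y \<in> Q \<Longrightarrow> norm (y - x) \<le> D"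
  shows "(\<integral>\<^sup>+x. indicator Q x * (\<integral>\<^sup>+y. indicator Q y * ennreal ((u y - u x)\<^sup>2) \<partial>lborel) \<partial>lborel)
    \<le> ennreal (D\<^sup>2) * (ennreal (2 ^ CARD('n)) * emeasure lborel Q * (\<integral>\<^sup>+x. indicator Q x * ennreal (\<Sum>i\<in>UNIV. (g i x)\<^sup>2) \<partial>lborel))"
proof -
  define H where "H x = ennreal (\<Sum>i\<in>UNIV. (g i x)\<^sup>2)" for x
  have [measurable]: "g i \<in> borel_measurable borel" for i
    using locally_integrable_measurable[of "g i"] w by (simp add: has_weak_deriv_def)
  have [measurable]: "u \<in> borel_measurable borel"
    using locally_integrable_measurable[of u] w by (simp add: has_weak_deriv_def)
  have Hm[measurable]: "H \<in> borel_measurable borel" unfolding H_def[abs_def] by measurable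
  let ?I = "\<lambda>x z. indicator Q x * indicator Q (x + z) :: ennreal"
  have "(\<integral>\<^sup>+x. indicator Q x * (\<integral>\<^sup>+y. indicator Q y * ennreal ((u y - u x)\<^sup>2) \<partial>lborel) \<partial>lborel)
      = (\<integral>\<^sup>+x. \<integral>\<^sup>+z. ?I x z * ennreal ((u (x + z) - u x)\<^sup>2) \<partial>lborel \<partial>lborel)"
  proof (rule nn_integral_cong)
    fix x
    show "indicator Q x * (\<integral>\<^sup>+y. indicator Q y * ennreal ((u y - u x)\<^sup>2) \<partial>lborel) = (\<integral>\<^sup>+z. ?I x z * ennreal ((u (x + z) - u x)\<^sup>2) \<partial>lborel)"
      using nn_integral_translate[of "\<lambda>y. indicator Q y * ennreal ((u y - u x)\<^sup>2)" x]
      by (simp add: mult.assoc nn_integral_cmult)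
  qed
  \<comment> \<open>The difference formula holds for almost every \<open>x\<close> once
    \<open>z\<close> is fixed, so \<open>x\<close> has to become the inner variable before it can be
    used.\<close>
  also have "\<dots> = (\<integral>\<^sup>+z. \<integral>\<^sup>+x. ?I x z * ennreal ((u (x + z) - u x)\<^sup>2) \<partial>lborel \<partial>lborel)"
    by (rule lborel_pair.Fubini') measurable
  also have "\<dots> \<le> (\<integral>\<^sup>+z. \<integral>\<^sup>+x. ?I x z * (ennreal (D\<^sup>2) * (\<integral>\<^sup>+t. indicator {0..1} t * H (x + t *\<^sub>R z) \<partial>lborel)) \<partial>lborel \<partial>lborel)"
  proof (rule nn_integral_mono, rule nn_integral_mono_AE)
    fix z :: "real^'n"
    show "AE x in lborel. ?I x z * ennreal ((u (x + z) - u x)\<^sup>2) \<le> ?I x z * (ennreal (D\<^sup>2) * (\<integral>\<^sup>+t. indicator {0..1} t * H (x + t *\<^sub>R z) \<partial>lborel))"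
      using weak_deriv_difference_square[OF w, of z]
    proof eventually_elim
      case (elim x)
      show ?case
      proof (cases "x \<in> Q \<and> x + z \<in> Q")
        case True
        then have "norm z \<le> D" using D[of x "x + z"] by simp
        then have "ennreal ((norm z)\<^sup>2) \<le> ennreal (D\<^sup>2)" by (intro ennreal_leI power_mono) auto
        from order_trans[OF elim mult_right_mono[OF this]] show ?thesis
          using True by (simp add: H_def)
      qed (auto split: split_indicator)
    qed
  qed
  also have "\<dots> = (\<integral>\<^sup>+x. \<integral>\<^sup>+z. ?I x z * (ennreal (D\<^sup>2) * (\<integral>\<^sup>+t. indicator {0..1} t * H (x + t *\<^sub>R z) \<partial>lborel)) \<partial>lborel \<partial>lborel)"
    by (rule lborel_pair.Fubini') measurable
  also have "\<dots> = (\<integral>\<^sup>+x. \<integral>\<^sup>+z. \<integral>\<^sup>+t. ennreal (D\<^sup>2) * (indicator {0..1} t * (?I x z * H (x + t *\<^sub>R z))) \<partial>lborel \<partial>lborel \<partial>lborel)"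
    by (simp add: nn_integral_cmult[symmetric] mult_ac)
  also have "\<dots> = (\<integral>\<^sup>+x. \<integral>\<^sup>+t. \<integral>\<^sup>+z. ennreal (D\<^sup>2) * (indicator {0..1} t * (?I x z * H (x + t *\<^sub>R z))) \<partial>lborel \<partial>lborel \<partial>lborel)"
    by (intro nn_integral_cong lborel_pair.Fubini') measurable
  also have "\<dots> = (\<integral>\<^sup>+t. \<integral>\<^sup>+x. \<integral>\<^sup>+z. ennreal (D\<^sup>2) * (indicator {0..1} t * (?I x z * H (x + t *\<^sub>R z))) \<partial>lborel \<partial>lborel \<partial>lborel)"
    by (rule lborel_pair.Fubini') measurable
  also have "\<dots> = (\<integral>\<^sup>+t. ennreal (D\<^sup>2) * (indicator {0..1} t * (\<integral>\<^sup>+x. \<integral>\<^sup>+z. ?I x z * H (x + t *\<^sub>R z) \<partial>lborel \<partial>lborel)) \<partial>lborel)"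
    by (simp add: nn_integral_cmult)
  also have "\<dots> = (\<integral>\<^sup>+t. ennreal (D\<^sup>2) * (indicator {0..1} t *
      (\<integral>\<^sup>+x. indicator Q x * (\<integral>\<^sup>+y. indicator Q y * H (x + t *\<^sub>R (y - x)) \<partial>lborel) \<partial>lborel)) \<partial>lborel)"
  proof -
    have "(\<integral>\<^sup>+z. ?I x z * H (x + t *\<^sub>R z) \<partial>lborel) = indicator Q x * (\<integral>\<^sup>+y. indicator Q y * H (x + t *\<^sub>R (y - x)) \<partial>lborel)" for x t
      using nn_integral_translate[of "\<lambda>y. indicator Q y * H (x + t *\<^sub>R (y - x))" x]
      by (simp add: mult.assoc nn_integral_cmult)
    then show ?thesis by (simp only:)
  qed
  also have "\<dots> \<le> (\<integral>\<^sup>+t. ennreal (D\<^sup>2) * (indicator {0..1::real} t *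
      (ennreal (2 ^ CARD('n)) * emeasure lborel Q * (\<integral>\<^sup>+x. indicator Q x * H x \<partial>lborel))) \<partial>lborel)"
    using convex_average_bound'[OF Hm Qm Q]
    by (intro nn_integral_mono, intro mult_left_mono[of "indicator _ _ * _"]) (auto split: split_indicator)
  also have "\<dots> = ennreal (D\<^sup>2) * (ennreal (2 ^ CARD('n)) * emeasure lborel Q * (\<integral>\<^sup>+x. indicator Q x * H x \<partial>lborel))"
    by (simp add: nn_integral_cmult nn_integral_multc)
  finally show ?thesis by (simp add: H_def)
qed

text \<open>Expanding the square for fixed \<open>x\<close> and integrating in \<open>y\<close>, the
  cross term vanishes by the zero mean; what remains is at least the measure of \<open>Q\<close>
  times \<open>(u x)\<^sup>2\<close>.\<close>

lemma mean_zero_bound: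
  fixes u :: "real^'n \<Rightarrow> real"
  assumes Qm[measurable]: "Q \<in> sets borel" and fin: "emeasure lborel Q < \<infinity>"
    and um[measurable]: "u \<in> borel_measurable borel" and i2: "set_integrable lborel Q (\<lambda>x. (u x)\<^sup>2)"
    and mean: "(LINT x:Q|lborel. u x) = 0"
  shows "emeasure lborel Q * (\<integral>\<^sup>+x. indicator Q x * ennreal ((u x)\<^sup>2) \<partial>lborel)
     \<le> (\<integral>\<^sup>+x. indicator Q x * (\<integral>\<^sup>+y. indicator Q y * ennreal ((u y - u x)\<^sup>2) \<partial>lborel) \<partial>lborel)"
proof -
  have iq: "integrable lborel (indicator Q :: real^'n \<Rightarrow> real)" using fin by simp
  have i2': "integrable lborel (\<lambda>x. indicator Q x * (u x)\<^sup>2)" using i2 by (simp add: set_integrable_def)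
  have i1: "integrable lborel (\<lambda>x. indicator Q x * u x)"
  proof (rule Bochner_Integration.integrable_bound)
    show "integrable lborel (\<lambda>x. indicator Q x + indicator Q x * (u x)\<^sup>2)" using iq i2' by simp
    have "\<bar>c\<bar> \<le> 1 + c\<^sup>2" for c :: real
      using zero_le_power2[of "\<bar>c\<bar> - 1"] by (simp add: power2_diff) 
    then show "AE x in lborel. norm (indicator Q x * u x) \<le> norm (indicator Q x + indicator Q x * (u x)\<^sup>2)"
      by (auto split: split_indicator)
  qed simp
  have "emeasure lborel Q * ennreal ((u x)\<^sup>2) \<le> (\<integral>\<^sup>+y. indicator Q y * ennreal ((u y - u x)\<^sup>2) \<partial>lborel)" for x
  proof -
    have e: "indicator Q y * ennreal ((u y - u x)\<^sup>2) = ennreal (indicator Q y * (u y - u x)\<^sup>2)" for y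
      by (auto split: split_indicator)
    have eq: "indicator Q y * (u y - u x)\<^sup>2 = indicator Q y * (u y)\<^sup>2 - 2 * u x * (indicator Q y * u y) + (u x)\<^sup>2 * indicator Q y" for y
      by (simp add: power2_diff algebra_simps)
    have m0: "(LINT y|lborel. indicator Q y * u y) = 0" using mean by (simp add: set_lebesgue_integral_def)
    have mq: "(LINT y|lborel. indicator Q y) = measure lborel Q" by simp
    have "measure lborel Q * (u x)\<^sup>2 \<le> (LINT y|lborel. indicator Q y * (u y)\<^sup>2) + (u x)\<^sup>2 * measure lborel Q"
      using integral_nonneg_AE[of "\<lambda>y. indicator Q y * (u y)\<^sup>2" lborel] by (simp add: mult.commute)
    also have "\<dots> = (LINT y|lborel. indicator Q y * (u y - u x)\<^sup>2)"
      unfolding eq using i1 i2' iq m0 mq by simp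
    finally have "ennreal (measure lborel Q * (u x)\<^sup>2) \<le> ennreal (LINT y|lborel. indicator Q y * (u y - u x)\<^sup>2)"
      by (rule ennreal_leI)
    also have "\<dots> = (\<integral>\<^sup>+y. indicator Q y * ennreal ((u y - u x)\<^sup>2) \<partial>lborel)"
      unfolding e by (rule nn_integral_eq_integral[symmetric]) (unfold eq, use i1 i2' iq in auto, simp flip: eq)
    finally show ?thesis
      using fin by (simp add: ennreal_mult' emeasure_eq_ennreal_measure less_top)
  qed
  then have "(\<integral>\<^sup>+x. indicator Q x * (emeasure lborel Q * ennreal ((u x)\<^sup>2)) \<partial>lborel)
     \<le> (\<integral>\<^sup>+x. indicator Q x * (\<integral>\<^sup>+y. indicator Q y * ennreal ((u y - u x)\<^sup>2) \<partial>lborel) \<partial>lborel)"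
    by (intro nn_integral_mono mult_left_mono) auto
  moreover have "(\<integral>\<^sup>+x. indicator Q x * (emeasure lborel Q * ennreal ((u x)\<^sup>2)) \<partial>lborel)
     = emeasure lborel Q * (\<integral>\<^sup>+x. indicator Q x * ennreal ((u x)\<^sup>2) \<partial>lborel)"
    by (subst nn_integral_cmult[symmetric]) (auto simp: mult.left_commute)
  ultimately show ?thesis by simp
qed

text \<open>Both bounds on the double integral of differences carry the measure of \<open>Q\<close>,
  which is positive and finite and therefore cancels; the constant depends on \<open>Q\<close> only
  through its diameter bound \<open>D\<close>.\<close>

theorem poincare:
  fixes u :: "real^'n \<Rightarrow> real" and g :: "'n \<Rightarrow> real^'n \<Rightarrow> real"
  assumes w: "\<And>i. has_weak_deriv UNIV {#i#} u (g i)"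
    and Qm[measurable]: "Q \<in> sets borel" and Q: "convex Q"
    and D: "\<And>x y. x \<in> Q \<Longrightarrow> y \<in> Q \<Longrightarrow> norm (y - x) \<le> D"
    and fin: "0 < emeasure lborel Q" "emeasure lborel Q < \<infinity>"
    and i2: "set_integrable lborel Q (\<lambda>x. (u x)\<^sup>2)" and mean: "(LINT x:Q|lborel. u x) = 0"
  shows "(\<integral>\<^sup>+x. indicator Q x * ennreal ((u x)\<^sup>2) \<partial>lborel)
    \<le> ennreal (2 ^ CARD('n) * D\<^sup>2) * (\<integral>\<^sup>+x. indicator Q x * ennreal (\<Sum>i\<in>UNIV. (g i x)\<^sup>2) \<partial>lborel)"
proof -
  have um: "u \<in> borel_measurable borel"
    using locally_integrable_measurable[of u] w by (simp add: has_weak_deriv_def)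
  let ?e = "emeasure lborel Q"
  from order_trans[OF mean_zero_bound[OF Qm fin(2) um i2 mean] poincare_double[OF w Qm Q D]]
  have "?e * (\<integral>\<^sup>+x. indicator Q x * ennreal ((u x)\<^sup>2) \<partial>lborel)
    \<le> ?e * (ennreal (2 ^ CARD('n) * D\<^sup>2) * (\<integral>\<^sup>+x. indicator Q x * ennreal (\<Sum>i\<in>UNIV. (g i x)\<^sup>2) \<partial>lborel))"
    by (simp add: ennreal_mult' mult_ac)
  then show ?thesis using fin by (simp add: ennreal_mult_le_mult_iff)
qed

section \<open>Tensor product polynomials\<close>

text \<open>A product of arbitrary univariate polynomials, one per coordinate. Unlike monomials,
  these products are closed under affine substitutions in each coordinate, so degree bounds can be
  checked coordinatewise.\<close>

definition tens :: "('n::finite \<Rightarrow> real poly) \<Rightarrow> real^'n \<Rightarrow> real" where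
  "tens f x = (\<Prod>i\<in>UNIV. poly (f i) (x $ i))"

lemma Ck_poly_coord: "Ck k (\<lambda>x::real^'n. poly f (x $ j))"
  using Ck_coord[of "\<lambda>n. poly ((pderiv ^^ n) f)" k 0 j] poly_DERIV by simp

lemma Ck_tens: "Ck k (tens f)"
  unfolding tens_def[abs_def] by (intro Ck_prod Ck_poly_coord)

lemma tens_upd_smult: "tens (f(i := smult c g)) x = c * tens (f(i := g)) x"
proof -
  have "tens (f(i := h)) x = poly h (x $ i) * (\<Prod>j\<in>UNIV - {i}. poly (f j) (x $ j))" for h
    unfolding tens_def by (subst prod.remove[of UNIV i]) (auto intro!: prod.cong arg_cong2[where f = times])
  then show ?thesis by simp
qed

lemma partial_deriv_tens: "partial_deriv i (tens f) = tens (f(i := pderiv (f i)))"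
proof
  fix x
  have e: "tens (f(i := h)) x = poly h (x $ i) * (\<Prod>j\<in>UNIV - {i}. poly (f j) (x $ j))" for h x
    unfolding tens_def by (subst prod.remove[of UNIV i]) (auto intro!: prod.cong arg_cong2[where f = times])
  have d1: "(\<lambda>x. poly (f i) (x $ i)) differentiable (at x)"
    using Ck_poly_coord[of "Suc 0" "f i" i] by simp
  have c2: "Ck (Suc k) (\<lambda>x. \<Prod>j\<in>F. poly (f j) (x $ j))" for F k
    by (intro Ck_prod Ck_poly_coord)
  have d2: "(\<lambda>x. \<Prod>j\<in>F. poly (f j) (x $ j)) differentiable (at x)" for F x
    using Ck_differentiable[OF c2[of 0 F]] .
  have zero: "partial_deriv i (\<lambda>x. \<Prod>j\<in>F. poly (f j) (x $ j)) x = 0" if "finite F" "i \<notin> F" for F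
    using that
  proof (induction F)
    case (insert j F)
    have "partial_deriv i (\<lambda>x. poly (f j) (x $ j) * (\<Prod>j\<in>F. poly (f j) (x $ j))) x
       = poly (f j) (x $ j) * partial_deriv i (\<lambda>x. \<Prod>j\<in>F. poly (f j) (x $ j)) x
         + partial_deriv i (\<lambda>x. poly (f j) (x $ j)) x * (\<Prod>j\<in>F. poly (f j) (x $ j))"
      using Ck_poly_coord[of "Suc 0" "f j" j] d2 by (intro partial_deriv_mult) auto
    moreover have "partial_deriv i (\<lambda>x. poly (f j) (x $ j)) x = 0"
      using insert.prems by (subst partial_deriv_coord[OF poly_DERIV]) auto
    ultimately show ?case using insert by simp
  qed (simp add: partial_deriv_const)
  have "partial_deriv i (tens f) x = partial_deriv i (\<lambda>x. poly (f i) (x $ i) * (\<Prod>j\<in>UNIV - {i}. poly (f j) (x $ j))) x"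
  proof -
    have "tens f = (\<lambda>x. poly (f i) (x $ i) * (\<Prod>j\<in>UNIV - {i}. poly (f j) (x $ j)))"
      using e[of "f i"] by (simp add: fun_eq_iff)
    then show ?thesis by (simp only:)
  qed
  also have "\<dots> = poly (pderiv (f i)) (x $ i) * (\<Prod>j\<in>UNIV - {i}. poly (f j) (x $ j))"
    using zero[of "UNIV - {i}"] by (subst partial_deriv_mult[OF d1 d2]) (simp add: partial_deriv_coord[OF poly_DERIV])
  finally show "partial_deriv i (tens f) x = tens (f(i := pderiv (f i))) x" by (simp add: e)
qed

definition tens_mono :: "('n::finite \<Rightarrow> nat) \<Rightarrow> real^'n \<Rightarrow> real" where
  "tens_mono \<alpha> x = (\<Prod>i\<in>UNIV. (x $ i) ^ \<alpha> i)"

lemma tens_mono_tens: "tens_mono \<alpha> = tens (\<lambda>i. monom 1 (\<alpha> i))"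
  by (auto simp: tens_mono_def tens_def poly_monom)

lemma Ck_tens_mono: "Ck k (tens_mono \<alpha>)"
  unfolding tens_mono_tens by (rule Ck_tens)

definition degs :: "nat \<Rightarrow> ('n::finite \<Rightarrow> nat) set" where
  "degs p = {\<alpha>. \<forall>i. \<alpha> i \<le> p}"

lemma degs_PiE: "degs p = PiE UNIV (\<lambda>_. {..p})"
  by (auto simp: degs_def)

lemma finite_degs [simp]: "finite (degs p :: ('n::finite \<Rightarrow> nat) set)"
  unfolding degs_PiE by (intro finite_PiE) auto

lemma Qpoly_iff: "q \<in> Qpoly p \<longleftrightarrow> (\<exists>c. q = (\<lambda>x. \<Sum>\<alpha>\<in>degs p. c \<alpha> * tens_mono \<alpha> x))"
  by (auto simp: Qpoly_def tens_mono_def degs_def)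

lemma Qpoly_add: "f \<in> Qpoly p \<Longrightarrow> g \<in> Qpoly p \<Longrightarrow> (\<lambda>x. f x + g x) \<in> Qpoly p"
proof -
  assume "f \<in> Qpoly p" "g \<in> Qpoly p"
  then obtain c c' where "f = (\<lambda>x. \<Sum>\<alpha>\<in>degs p. c \<alpha> * tens_mono \<alpha> x)" "g = (\<lambda>x. \<Sum>\<alpha>\<in>degs p. c' \<alpha> * tens_mono \<alpha> x)"
    by (auto simp: Qpoly_iff)
  then have "(\<lambda>x. f x + g x) = (\<lambda>x. \<Sum>\<alpha>\<in>degs p. (c \<alpha> + c' \<alpha>) * tens_mono \<alpha> x)"
    by (simp add: sum.distrib distrib_right)
  then show ?thesis unfolding Qpoly_iff by (rule exI[where x = "\<lambda>\<alpha>. c \<alpha> + c' \<alpha>"])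
qed

lemma Qpoly_cmult: "f \<in> Qpoly p \<Longrightarrow> (\<lambda>x. k * f x) \<in> Qpoly p"
proof -
  assume "f \<in> Qpoly p"
  then obtain c where "f = (\<lambda>x. \<Sum>\<alpha>\<in>degs p. c \<alpha> * tens_mono \<alpha> x)"
    by (auto simp: Qpoly_iff)
  then have "(\<lambda>x. k * f x) = (\<lambda>x. \<Sum>\<alpha>\<in>degs p. (k * c \<alpha>) * tens_mono \<alpha> x)"
    by (simp add: sum_distrib_left mult.assoc)
  then show ?thesis unfolding Qpoly_iff by (rule exI[where x = "\<lambda>\<alpha>. k * c \<alpha>"])
qed

lemma Qpoly_diff: "f \<in> Qpoly p \<Longrightarrow> g \<in> Qpoly p \<Longrightarrow> (\<lambda>x. f x - g x) \<in> Qpoly p"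
  using Qpoly_add[OF _ Qpoly_cmult[of g p "-1"], of f] by simp

lemma Qpoly_zero: "(\<lambda>x. 0) \<in> Qpoly p"
  unfolding Qpoly_iff by (rule exI[of _ "\<lambda>_. 0"]) simp

lemma Qpoly_sum: "(\<And>i. i \<in> F \<Longrightarrow> f i \<in> Qpoly p) \<Longrightarrow> (\<lambda>x. \<Sum>i\<in>F. f i x) \<in> Qpoly p"
  by (induction F rule: infinite_finite_induct) (auto intro: Qpoly_zero Qpoly_add)

lemma tens_in_Qpoly:
  assumes "\<And>i. degree (f i) \<le> p"
  shows "tens f \<in> Qpoly p"
proof -
  have "poly (f i) t = (\<Sum>k\<le>p. coeff (f i) k * t ^ k)" for i t
    using poly_as_sum_of_monoms'[OF assms, of i, THEN arg_cong, of "\<lambda>q. poly q t"]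
    by (simp add: poly_sum poly_monom)
  then have "tens f x = (\<Sum>\<alpha>\<in>degs p. (\<Prod>i\<in>UNIV. coeff (f i) (\<alpha> i)) * tens_mono \<alpha> x)" for x
    unfolding tens_def tens_mono_def degs_PiE by (simp add: prod_sum_PiE prod.distrib)
  then show ?thesis unfolding Qpoly_iff by (intro exI ext)
qed

lemma tens_mono_in_Qpoly: "\<alpha> \<in> degs p \<Longrightarrow> tens_mono \<alpha> \<in> Qpoly p"
  unfolding tens_mono_tens by (intro tens_in_Qpoly) (auto simp: degs_def degree_monom_eq)

lemma Ck_Qpoly: "q \<in> Qpoly p \<Longrightarrow> Ck k q"
  by (auto simp: Qpoly_iff intro!: Ck_sum Ck_cmult Ck_tens_mono)

lemma Qpoly_continuous: "q \<in> Qpoly p \<Longrightarrow> continuous_on S q"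
  using Ck_continuous[OF Ck_Qpoly[of q p 0]] continuous_on_subset by blast

lemma Qpoly_affine:
  assumes "q \<in> Qpoly p"
  shows "(\<lambda>x. q (b + h *\<^sub>R x)) \<in> Qpoly p"
proof -
  obtain c where c: "q = (\<lambda>x. \<Sum>\<alpha>\<in>degs p. c \<alpha> * tens_mono \<alpha> x)" using assms by (auto simp: Qpoly_iff)
  have "(\<lambda>x. tens_mono \<alpha> (b + h *\<^sub>R x)) \<in> Qpoly p" if "\<alpha> \<in> degs p" for \<alpha>
  proof -
    have "(\<lambda>x. tens_mono \<alpha> (b + h *\<^sub>R x)) = tens (\<lambda>i. [:b $ i, h:] ^ \<alpha> i)"
      by (auto simp: tens_mono_def tens_def poly_power mult.commute)
    moreover have "degree ([:b $ i, h:] ^ \<alpha> i) \<le> p" for i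
    proof -
      have "degree ([:b $ i, h:] ^ \<alpha> i) \<le> degree [:b $ i, h:] * \<alpha> i" by (rule degree_power_le)
      also have "\<dots> \<le> 1 * \<alpha> i" by (intro mult_right_mono) auto
      finally show ?thesis using that by (auto simp: degs_def intro: order_trans)
    qed
    ultimately show ?thesis by (simp add: tens_in_Qpoly)
  qed
  then show ?thesis unfolding c by (intro Qpoly_sum Qpoly_cmult)
qed

lemma partial_deriv_sum:
  assumes "finite F" "\<And>i x. i \<in> F \<Longrightarrow> f i differentiable (at x)"
  shows "partial_deriv j (\<lambda>x. \<Sum>i\<in>F. f i x) x = (\<Sum>i\<in>F. partial_deriv j (f i) x)"
  using assms
  by (induction F) (simp_all add: partial_deriv_const partial_deriv_add differentiable_sum)

lemma Qpoly_partial: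
  assumes "q \<in> Qpoly p"
  shows "partial_deriv i q \<in> Qpoly p"
proof -
  obtain c where c: "q = (\<lambda>x. \<Sum>\<alpha>\<in>degs p. c \<alpha> * tens_mono \<alpha> x)" using assms by (auto simp: Qpoly_iff)
  have d: "tens_mono \<alpha> differentiable (at x)" for \<alpha> and x :: "real^'n" using Ck_tens_mono[of "Suc 0" \<alpha>] by simp
  have "partial_deriv i q = (\<lambda>x. \<Sum>\<alpha>\<in>degs p. c \<alpha> * partial_deriv i (tens_mono \<alpha>) x)"
    unfolding c by (rule ext, subst partial_deriv_sum)
      (auto intro!: sum.cong partial_deriv_cmult d differentiable_mult simp del: finite_degs intro: finite_degs)
  moreover have "partial_deriv i (tens_mono \<alpha>) \<in> Qpoly p" if "\<alpha> \<in> degs p" for \<alpha>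
    unfolding tens_mono_tens partial_deriv_tens
    using that by (intro tens_in_Qpoly) (auto simp: degs_def degree_monom_eq degree_pderiv intro: order_trans[OF diff_le_self])
  ultimately show ?thesis by (auto intro!: Qpoly_sum Qpoly_cmult)
qed

lemma Qpoly_pd: "q \<in> Qpoly p \<Longrightarrow> pd js q \<in> Qpoly p"
  by (induction js) (auto intro: Qpoly_partial)

text \<open>Induction over the set of coordinates, with exponents as dependent functions on that
  set. With the other coordinates fixed, the sum is a univariate polynomial with infinitely many
  zeros, so its coefficients vanish, and these are sums over one coordinate fewer.\<close>

lemma tens_mono_coeffs_zero:
  fixes c :: "('n::finite \<Rightarrow> nat) \<Rightarrow> real"
  assumes ab: "\<And>i. a $ i < b $ i"
    and z: "\<And>x. x \<in> box a b \<Longrightarrow> (\<Sum>\<alpha>\<in>degs p. c \<alpha> * tens_mono \<alpha> x) = 0"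
    and \<alpha>: "\<alpha> \<in> degs p"
  shows "c \<alpha> = 0"
proof -
  have gen: "c \<alpha> = 0"
    if "finite A" "\<And>x. (\<And>i. i \<in> A \<Longrightarrow> a $ i < x i \<and> x i < b $ i) \<Longrightarrow> (\<Sum>\<alpha>\<in>PiE A (\<lambda>_. {..p}). c \<alpha> * (\<Prod>i\<in>A. x i ^ \<alpha> i)) = 0"
      "\<alpha> \<in> PiE A (\<lambda>_. {..p})"
    for A :: "'n set" and c and \<alpha>
    using that
  proof (induction A arbitrary: c \<alpha>)
    case empty
    then show ?case by simp
  next
    case (insert j A)
    let ?P = "PiE A (\<lambda>_. {..p})"
    define c' where "c' k \<beta> = c (\<beta>(j := k))" for k \<beta>
    have expand: "(\<Sum>\<alpha>\<in>PiE (insert j A) (\<lambda>_. {..p}). c \<alpha> * (\<Prod>i\<in>insert j A. x i ^ \<alpha> i))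
       = (\<Sum>k\<le>p. (\<Sum>\<beta>\<in>?P. c' k \<beta> * (\<Prod>i\<in>A. x i ^ \<beta> i)) * x j ^ k)" for x
    proof -
      have "PiE (insert j A) (\<lambda>_. {..p}) = (\<lambda>(k, \<beta>). \<beta>(j := k)) ` ({..p} \<times> ?P)"
        by (rule PiE_insert_eq)
      moreover have "inj_on (\<lambda>(k, \<beta>). \<beta>(j := k)) ({..p} \<times> ?P)"
        using insert.hyps(2) by (rule inj_combinator)
      ultimately have "(\<Sum>\<alpha>\<in>PiE (insert j A) (\<lambda>_. {..p}). c \<alpha> * (\<Prod>i\<in>insert j A. x i ^ \<alpha> i))
        = (\<Sum>(k, \<beta>)\<in>{..p} \<times> ?P. c (\<beta>(j := k)) * (\<Prod>i\<in>insert j A. x i ^ (\<beta>(j := k)) i))"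
        by (simp add: sum.reindex case_prod_unfold)
      also have "\<dots> = (\<Sum>k\<le>p. \<Sum>\<beta>\<in>?P. c (\<beta>(j := k)) * (\<Prod>i\<in>insert j A. x i ^ (\<beta>(j := k)) i))"
        by (simp add: sum.cartesian_product)
      also have "\<dots> = (\<Sum>k\<le>p. (\<Sum>\<beta>\<in>?P. c' k \<beta> * (\<Prod>i\<in>A. x i ^ \<beta> i)) * x j ^ k)"
      proof (intro sum.cong refl)
        fix k
        have "(\<Prod>i\<in>insert j A. x i ^ (\<beta>(j := k)) i) = x j ^ k * (\<Prod>i\<in>A. x i ^ \<beta> i)" for \<beta>
        proof -
          have "(\<Prod>i\<in>A. x i ^ (\<beta>(j := k)) i) = (\<Prod>i\<in>A. x i ^ \<beta> i)"
            using insert.hyps by (intro prod.cong) auto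
          then show ?thesis using insert.hyps by simp
        qed
        then show "(\<Sum>\<beta>\<in>?P. c (\<beta>(j := k)) * (\<Prod>i\<in>insert j A. x i ^ (\<beta>(j := k)) i))
          = (\<Sum>\<beta>\<in>?P. c' k \<beta> * (\<Prod>i\<in>A. x i ^ \<beta> i)) * x j ^ k"
          by (simp add: c'_def sum_distrib_left sum_distrib_right mult_ac)
      qed
      finally show ?thesis .
    qed
    have inner: "(\<Sum>\<beta>\<in>?P. c' k \<beta> * (\<Prod>i\<in>A. x i ^ \<beta> i)) = 0"
      if x: "\<And>i. i \<in> A \<Longrightarrow> a $ i < x i \<and> x i < b $ i" and k: "k \<le> p" for x k
    proof -
      define e where "e k = (\<Sum>\<beta>\<in>?P. c' k \<beta> * (\<Prod>i\<in>A. x i ^ \<beta> i))" for k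
      have "(\<Sum>k\<le>p. e k * t ^ k) = 0" if t: "t \<in> {a $ j<..<b $ j}" for t
      proof -
        have "(\<Sum>\<alpha>\<in>PiE (insert j A) (\<lambda>_. {..p}). c \<alpha> * (\<Prod>i\<in>insert j A. (x(j := t)) i ^ \<alpha> i)) = 0"
          using x t by (intro insert.prems(1)) auto
        moreover have "(\<Prod>i\<in>A. (x(j := t)) i ^ \<beta> i) = (\<Prod>i\<in>A. x i ^ \<beta> i)" for \<beta>
          using insert.hyps by (intro prod.cong) auto
        ultimately show ?thesis by (simp only: expand e_def fun_upd_same)
      qed
      then have "{a $ j<..<b $ j} \<subseteq> {t. (\<Sum>k\<le>p. e k * t ^ k) = 0}" by blast
      then have "infinite {t. (\<Sum>k\<le>p. e k * t ^ k) = 0}"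
        using infinite_Ioo[OF ab[of j]] finite_subset by blast
      then have "e k = 0" using polyfun_finite_roots[of e p] k by blast
      then show ?thesis by (simp add: e_def)
    qed
    have aj: "\<alpha> j \<le> p" and ar: "\<alpha>(j := undefined) \<in> ?P"
      using insert.prems(2) insert.hyps(2) by (auto simp: PiE_iff extensional_def)
    have "c' (\<alpha> j) (\<alpha>(j := undefined)) = 0"
      using insert.IH[of "c' (\<alpha> j)", OF inner[OF _ aj] ar] by blast
    then show ?case by (simp add: c'_def)
  qed
  show ?thesis
  proof (rule gen[of UNIV c \<alpha>])
    fix x :: "'n \<Rightarrow> real" assume "\<And>i. i \<in> UNIV \<Longrightarrow> a $ i < x i \<and> x i < b $ i"
    then have "(\<chi> i. x i) \<in> box a b" by (simp add: mem_box_cart)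
    from z[OF this] show "(\<Sum>\<alpha>\<in>PiE UNIV (\<lambda>_. {..p}). c \<alpha> * (\<Prod>i\<in>UNIV. x i ^ \<alpha> i)) = 0"
      by (simp add: degs_PiE tens_mono_def)
  qed (use \<alpha> in \<open>auto simp: degs_PiE\<close>)
qed

lemma Qpoly_eqI:
  assumes q: "q \<in> Qpoly p" "q' \<in> Qpoly p" and ab: "\<And>i. a $ i < b $ i"
    and z: "\<And>x. x \<in> box a b \<Longrightarrow> q x = q' x"
  shows "q = q'"
proof -
  have "(\<lambda>x. q x - q' x) \<in> Qpoly p" by (rule Qpoly_diff[OF q])
  then obtain c where c: "(\<lambda>x. q x - q' x) = (\<lambda>x. \<Sum>\<alpha>\<in>degs p. c \<alpha> * tens_mono \<alpha> x)" by (auto simp: Qpoly_iff)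
  have "c \<alpha> = 0" if "\<alpha> \<in> degs p" for \<alpha>
  proof (rule tens_mono_coeffs_zero[OF ab _ that])
    fix x assume "x \<in> box a b"
    then show "(\<Sum>\<alpha>\<in>degs p. c \<alpha> * tens_mono \<alpha> x) = 0" using z fun_cong[OF c, of x] by simp
  qed
  then have "q x - q' x = 0" for x using fun_cong[OF c, of x] by simp
  then show ?thesis by auto
qed

section \<open>Stability of polynomials on the unit cube\<close>

text \<open>The zero set of \<open>f\<close> is closed, and a closed set that contains almost every
  point of an open box contains the whole box.\<close>

lemma continuous_zero_AE:
  fixes f :: "real^'n \<Rightarrow> real"
  assumes f: "continuous_on UNIV f" and z: "AE x in lborel. x \<in> box a b \<longrightarrow> f x = 0" and x: "x \<in> box a b"
  shows "f x = 0"
proof -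
  have "closed {x. f x = 0}"
    using continuous_closed_vimage[of "{0::real}" f] f by (simp add: continuous_on_eq_continuous_at vimage_def)
  moreover have "AE x in lebesgue. x \<in> box a b \<longrightarrow> x \<in> {x. f x = 0}"
    using z by (auto intro: AE_completion)
  ultimately show ?thesis
    using mem_closed_if_AE_lebesgue_open[of "box a b" "{x. f x = 0}" x] x by auto
qed

text \<open>The squared norm is a continuous quadratic form in the coefficients, positive on the
  vectors of maximum norm 1 by linear independence of the monomials. Its minimum \<open>m\<close>
  over this compact set yields the constant \<open>1 / m\<close>.\<close>

lemma unit_cube_coeff_bound:
  "\<exists>C>0. \<forall>c. \<forall>\<alpha>\<in>(degs p :: ('n::finite \<Rightarrow> nat) set).
     (c \<alpha>)\<^sup>2 \<le> C * (LINT x:cbox 0 1|lborel. (\<Sum>\<alpha>\<in>degs p. c \<alpha> * tens_mono \<alpha> (x::real^'n))\<^sup>2)"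
proof -
  let ?D = "degs p :: ('n \<Rightarrow> nat) set" and ?Q = "cbox 0 1 :: (real^'n) set"
  let ?q = "\<lambda>c x. \<Sum>\<alpha>\<in>?D. c \<alpha> * tens_mono \<alpha> (x::real^'n)"
  define B where "B c = (LINT x:?Q|lborel. (?q c x)\<^sup>2)" for c
  define G where "G \<alpha> \<beta> = (LINT x:?Q|lborel. tens_mono \<alpha> x * tens_mono \<beta> x)" for \<alpha> \<beta> :: "'n \<Rightarrow> nat"
  have cm: "continuous_on S (tens_mono \<alpha>)" for S and \<alpha> :: "'n \<Rightarrow> nat"
    using Ck_continuous[OF Ck_tens_mono[of 0 \<alpha>]] continuous_on_subset by blast
  have int: "set_integrable lborel ?Q f" if "continuous_on UNIV f" for f :: "real^'n \<Rightarrow> real"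
    unfolding set_integrable_def using borel_integrable_compact[OF compact_cbox continuous_on_subset[OF that]] by auto
  have B_eq: "B c = (\<Sum>\<alpha>\<in>?D. \<Sum>\<beta>\<in>?D. c \<alpha> * c \<beta> * G \<alpha> \<beta>)" for c
  proof -
    have "(?q c x)\<^sup>2 = (\<Sum>\<alpha>\<in>?D. \<Sum>\<beta>\<in>?D. (c \<alpha> * c \<beta>) * (tens_mono \<alpha> x * tens_mono \<beta> x))" for x
      by (simp add: power2_eq_square sum_product mult_ac)
    then have "B c = (LINT x:?Q|lborel. (\<Sum>\<alpha>\<in>?D. \<Sum>\<beta>\<in>?D. (c \<alpha> * c \<beta>) * (tens_mono \<alpha> x * tens_mono \<beta> x)))"
      by (simp add: B_def)
    also have "\<dots> = (\<Sum>\<alpha>\<in>?D. \<Sum>\<beta>\<in>?D. (LINT x:?Q|lborel. (c \<alpha> * c \<beta>) * (tens_mono \<alpha> x * tens_mono \<beta> x)))"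
    proof -
      have i: "integrable lborel (\<lambda>x. indicator ?Q x *\<^sub>R ((c \<alpha> * c \<beta>) * (tens_mono \<alpha> x * tens_mono \<beta> x)))" for \<alpha> \<beta> :: "'n \<Rightarrow> nat"
        using int[of "\<lambda>x. (c \<alpha> * c \<beta>) * (tens_mono \<alpha> x * tens_mono \<beta> x)"]
        by (simp add: set_integrable_def continuous_intros cm)
      show ?thesis unfolding set_lebesgue_integral_def scaleR_sum_right
        using i by (simp only: Bochner_Integration.integral_sum Bochner_Integration.integrable_sum)
    qed
    finally show ?thesis by (simp add: G_def)
  qed
  \<comment> \<open>Coefficient vectors are functions on an infinite type; pinning the irrelevant
    coordinates to 0 makes this set a product of compact sets, so that Tychonoff applies.\<close>
  define K where "K = PiE UNIV (\<lambda>\<alpha>. if \<alpha> \<in> ?D then {-1..1} else {0::real})"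
  \<comment> \<open>The unit sphere of the maximum norm: some relevant coefficient attains absolute
    value 1.\<close>
  define K1 where "K1 = K \<inter> (\<Union>\<alpha>\<in>?D. {c. \<bar>c \<alpha>\<bar> = 1})"
  have "compact K"
    unfolding K_def
    using compactin_PiE[of "\<lambda>_. euclidean" UNIV "\<lambda>\<alpha>::'n \<Rightarrow> nat. if \<alpha> \<in> ?D then {-1..1} else {0::real}"]
    by (simp add: euclidean_product_topology)
  moreover have "closed {c :: ('n \<Rightarrow> nat) \<Rightarrow> real. \<bar>c \<alpha>\<bar> = 1}" for \<alpha>
    by (intro closed_Collect_eq continuous_intros continuous_on_product_coordinates)
  ultimately have K1: "compact K1"
    unfolding K1_def by (intro compact_Int_closed closed_UN) auto
  have contB: "continuous_on K1 B"
    unfolding B_eq[abs_def]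
    by (intro continuous_intros continuous_on_subset[OF continuous_on_product_coordinates]) auto
  have pos: "B c > 0" if c: "c \<in> K1" for c
  proof -
    have nn: "B c \<ge> 0" unfolding B_def set_lebesgue_integral_def by (rule integral_nonneg_AE) (auto split: split_indicator)
    have "B c \<noteq> 0"
    proof
      assume B0: "B c = 0"
      have cq: "continuous_on UNIV (?q c)" by (intro continuous_intros cm)
      have "integrable lborel (\<lambda>x. indicator ?Q x *\<^sub>R (?q c x)\<^sup>2)"
        using int[of "\<lambda>x. (?q c x)\<^sup>2"] cq by (simp add: set_integrable_def continuous_intros)
      then have "AE x in lborel. indicator ?Q x *\<^sub>R (?q c x)\<^sup>2 = 0"
        using B0 unfolding B_def set_lebesgue_integral_def
        by (subst (asm) integral_nonneg_eq_0_iff_AE) (auto split: split_indicator)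
      then have ae: "AE x in lborel. x \<in> box 0 1 \<longrightarrow> ?q c x = 0"
      proof eventually_elim
        case (elim x)
        then show ?case using box_subset_cbox[of "0::real^'n" 1] by (auto simp: indicator_def split: if_splits)
      qed
      have "c \<alpha> = 0" if "\<alpha> \<in> ?D" for \<alpha>
      proof (rule tens_mono_coeffs_zero[OF _ _ that])
        show "(0::real^'n) $ i < 1 $ i" for i by simp
        show "?q c x = 0" if "x \<in> box 0 1" for x by (rule continuous_zero_AE[OF cq ae that])
      qed
      with c show False by (auto simp: K1_def)
    qed
    with nn show ?thesis by simp
  qed
  obtain m where m: "m > 0" "\<And>c. c \<in> K1 \<Longrightarrow> m \<le> B c"
  proof (cases "K1 = {}")
    case True
    then show ?thesis using that[of 1] by simp
  next
    case False
    from continuous_attains_inf[OF K1 this contB] obtain c0 where "c0 \<in> K1" "\<And>c. c \<in> K1 \<Longrightarrow> B c0 \<le> B c" by blast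
    then show ?thesis using that[of "B c0"] pos by blast
  qed
  have "(c \<alpha>)\<^sup>2 \<le> (1 / m) * B c" if \<alpha>: "\<alpha> \<in> ?D" for c \<alpha>
  proof -
    define M where "M = Max ((\<lambda>\<beta>. \<bar>c \<beta>\<bar>) ` ?D)"
    have M: "\<bar>c \<beta>\<bar> \<le> M" if "\<beta> \<in> ?D" for \<beta> using that by (auto simp: M_def)
    have nn: "B c \<ge> 0" unfolding B_def set_lebesgue_integral_def by (rule integral_nonneg_AE) (auto split: split_indicator)
    show ?thesis
    proof (cases "M = 0")
      case True
      then show ?thesis using M[OF \<alpha>] nn m(1) by simp
    next
      case False
      then have Mp: "M > 0" using M[OF \<alpha>] by linarith
      obtain \<beta> where \<beta>: "\<beta> \<in> ?D" "\<bar>c \<beta>\<bar> = M"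
      proof -
        have "M \<in> (\<lambda>\<beta>. \<bar>c \<beta>\<bar>) ` ?D" unfolding M_def using \<alpha> by (intro Max_in) auto
        then show ?thesis using that by auto
      qed
      \<comment> \<open>Division by the maximum norm places the vector on the sphere; the quadratic
        form scales by the square of that norm.\<close>
      define e where "e \<gamma> = (if \<gamma> \<in> ?D then c \<gamma> / M else 0)" for \<gamma>
      have "e \<in> K1"
      proof -
        have "-1 \<le> c \<gamma> / M \<and> c \<gamma> / M \<le> 1" if "\<gamma> \<in> ?D" for \<gamma>
          using M[OF that] Mp by (simp add: field_simps abs_le_iff)
        then have "e \<in> K" by (auto simp: K_def e_def PiE_iff)
        moreover have "\<bar>e \<beta>\<bar> = 1" using \<beta> Mp by (simp add: e_def abs_divide)
        ultimately show ?thesis using \<beta>(1) by (auto simp: K1_def)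
      qed
      then have "m \<le> B e" by (rule m(2))
      also have "B e = B c / M\<^sup>2"
        unfolding B_eq by (simp add: e_def sum_divide_distrib power2_eq_square)
      finally have "M\<^sup>2 \<le> (1 / m) * B c" using Mp m(1) by (simp add: field_simps)
      moreover have "(c \<alpha>)\<^sup>2 \<le> M\<^sup>2" using M[OF \<alpha>] by (simp add: abs_le_square_iff[symmetric])
      ultimately show ?thesis by linarith
    qed
  qed
  then show ?thesis using m(1) by (intro exI[of _ "1 / m"]) (auto simp: B_def)
qed

section \<open>Scaled polynomial estimates\<close>

definition cube :: "real^'n \<Rightarrow> real \<Rightarrow> (real^'n) set" where
  "cube b h = cbox b (b + h *\<^sub>R 1)"

text \<open>The squared norm on a set, with values in \<open>ennreal\<close>, so that it may be
  infinite and can be compared and summed before any integrability is known.\<close>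

definition l2sq :: "(real^'n) set \<Rightarrow> (real^'n \<Rightarrow> real) \<Rightarrow> ennreal" where
  "l2sq A f = (\<integral>\<^sup>+x. indicator A x * ennreal ((f x)\<^sup>2) \<partial>lborel)"

lemma mem_cube: "x \<in> cube b h \<longleftrightarrow> (\<forall>i. b $ i \<le> x $ i \<and> x $ i \<le> b $ i + h)"
  by (auto simp: cube_def mem_box_cart)

lemma cube_facts [measurable, simp]:
  "cube b h \<in> sets borel" "compact (cube b h)" "convex (cube b h)"
  by (auto simp: cube_def)

lemma emeasure_cube:
  assumes "h > 0"
  shows "emeasure lborel (cube b h :: (real^'n) set) = ennreal (h ^ CARD('n))"
proof -
  have "emeasure lborel (cube b h) = ennreal (\<Prod>j\<in>Basis. (h *\<^sub>R (1::real^'n)) \<bullet> j)"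
    using assms unfolding cube_def
    by (subst emeasure_lborel_cbox_eq) (auto simp: Basis_vec_def inner_axis algebra_simps)
  also have "(\<Prod>j\<in>Basis. (h *\<^sub>R (1::real^'n)) \<bullet> j) = (\<Prod>j\<in>(Basis :: (real^'n) set). h)"
    by (rule prod.cong) (auto simp: Basis_vec_def inner_axis)
  finally show ?thesis by simp
qed

lemma l2sq_mono: "A \<subseteq> B \<Longrightarrow> l2sq A f \<le> l2sq B f"
  unfolding l2sq_def by (intro nn_integral_mono mult_right_mono) (auto split: split_indicator)

lemma l2sq_cong: "(\<And>x. x \<in> A \<Longrightarrow> f x = g x) \<Longrightarrow> l2sq A f = l2sq A g"
  unfolding l2sq_def by (intro nn_integral_cong) (auto split: split_indicator)

lemma l2sq_triangle:
  assumes [measurable]: "A \<in> sets borel" "f \<in> borel_measurable borel" "g \<in> borel_measurable borel"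
  shows "l2sq A (\<lambda>x. f x + g x) \<le> 2 * l2sq A f + 2 * l2sq A g"
proof -
  have "ennreal ((f x + g x)\<^sup>2) \<le> 2 * ennreal ((f x)\<^sup>2) + 2 * ennreal ((g x)\<^sup>2)" for x
  proof -
    have "(f x + g x)\<^sup>2 \<le> 2 * (f x)\<^sup>2 + 2 * (g x)\<^sup>2"
      using zero_le_power2[of "f x - g x"] by (simp add: power2_sum power2_diff)
    then have "ennreal ((f x + g x)\<^sup>2) \<le> ennreal (2 * (f x)\<^sup>2 + 2 * (g x)\<^sup>2)" by (rule ennreal_leI)
    then show ?thesis by (simp add: ennreal_plus ennreal_mult')
  qed
  then have "l2sq A (\<lambda>x. f x + g x) \<le> (\<integral>\<^sup>+x. 2 * (indicator A x * ennreal ((f x)\<^sup>2)) + 2 * (indicator A x * ennreal ((g x)\<^sup>2)) \<partial>lborel)"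
    unfolding l2sq_def by (intro nn_integral_mono) (auto split: split_indicator)
  also have "\<dots> = 2 * l2sq A f + 2 * l2sq A g"
    unfolding l2sq_def by (simp add: nn_integral_add nn_integral_cmult)
  finally show ?thesis .
qed

lemma set_integrable_continuous:
  fixes f :: "real^'n \<Rightarrow> real"
  assumes "continuous_on UNIV f" "compact S"
  shows "set_integrable lborel S f"
  using locally_integrable_continuous[OF assms(1), of UNIV] assms(2) unfolding locally_integrable_def by blast

lemma l2sq_continuous:
  fixes f :: "real^'n \<Rightarrow> real"
  assumes f: "continuous_on UNIV f" and S: "compact S"
  shows "l2sq S f = ennreal (LINT x:S|lborel. (f x)\<^sup>2)"
proof -
  have "integrable lborel (\<lambda>x. indicator S x * (f x)\<^sup>2)"
    using set_integrable_continuous[OF _ S, of "\<lambda>x. (f x)\<^sup>2"] f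
    by (simp add: set_integrable_def continuous_intros)
  then have "ennreal (LINT x|lborel. indicator S x * (f x)\<^sup>2) = (\<integral>\<^sup>+x. ennreal (indicator S x * (f x)\<^sup>2) \<partial>lborel)"
    by (intro nn_integral_eq_integral[symmetric]) auto
  also have "\<dots> = l2sq S f" unfolding l2sq_def
    by (intro nn_integral_cong) (auto split: split_indicator)
  finally show ?thesis by (simp add: set_lebesgue_integral_def)
qed

lemma pd_scale:
  assumes "Ck (length js) f"
  shows "pd js (\<lambda>x. f (b + h *\<^sub>R x)) = (\<lambda>x. h ^ length js * pd js f (b + h *\<^sub>R x))"
  using assms
proof (induction js)
  case (Cons i js)
  have g: "pd js f differentiable (at x)" for x
  proof -
    have "Ck (length js + Suc 0) f" using Cons.prems by (simp del: Ck.simps)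
    from Ck_differentiable[OF Ck_pd[OF this]] show ?thesis .
  qed
  have s: "((\<lambda>x. b + h *\<^sub>R x) has_derivative (\<lambda>y. h *\<^sub>R y)) (at x)" for x
    by (auto intro!: derivative_eq_intros)
  have pt: "partial_deriv i (\<lambda>x. h ^ length js * pd js f (b + h *\<^sub>R x)) x = h ^ length (i # js) * pd (i # js) f (b + h *\<^sub>R x)" for x
  proof -
    from has_derivative_compose[OF s has_derivative_partials[OF g]]
    have "((\<lambda>x. pd js f (b + h *\<^sub>R x)) has_derivative
      (\<lambda>y. \<Sum>j\<in>UNIV. partial_deriv j (pd js f) (b + h *\<^sub>R x) * (h *\<^sub>R y) $ j)) (at x)" .
    from partial_deriv_eqI[OF has_derivative_mult_right[OF this, of "h ^ length js"], of i]
    have "partial_deriv i (\<lambda>x. h ^ length js * pd js f (b + h *\<^sub>R x)) x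
      = h ^ length js * (\<Sum>j\<in>UNIV. axis i 1 $ j * (h * partial_deriv j (pd js f) (b + h *\<^sub>R x)))"
      by (simp add: mult_ac)
    then show ?thesis by (simp only: axis_mult_sum) simp
  qed
  have e: "pd js (\<lambda>x. f (b + h *\<^sub>R x)) = (\<lambda>x. h ^ length js * pd js f (b + h *\<^sub>R x))"
    using Cons Ck_SucD[of "length js" f] by simp
  show ?case unfolding pd_simps(2)[of i js "\<lambda>x. f (b + h *\<^sub>R x)"] e using pt by (intro ext)
qed simp

text \<open>The derivative at a point is a combination of derivatives of monomials, bounded on a
  fixed box, with coefficients controlled by the norm on the unit cube. The point may lie outside
  the unit cube, which is what a bound for polynomial extension requires.\<close>

lemma unit_cube_bound:
  "\<exists>C\<ge>0. \<forall>q\<in>Qpoly p. \<forall>x::real^'n. (\<forall>i. \<bar>x $ i\<bar> \<le> R) \<longrightarrow>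
     (pd js q x)\<^sup>2 \<le> C * (LINT x:cbox 0 1|lborel. (q x)\<^sup>2)"
proof -
  let ?D = "degs p :: ('n \<Rightarrow> nat) set"
  obtain C1 where C1: "C1 > 0" "\<And>c \<alpha>. \<alpha> \<in> ?D \<Longrightarrow>
     (c \<alpha>)\<^sup>2 \<le> C1 * (LINT x:cbox 0 1|lborel. (\<Sum>\<alpha>\<in>?D. c \<alpha> * tens_mono \<alpha> (x::real^'n))\<^sup>2)"
    using unit_cube_coeff_bound[of p, where 'n = 'n] by blast
  let ?B = "cbox (\<chi> i. - R) (\<chi> i. R) :: (real^'n) set"
  have "\<exists>M\<ge>0. \<forall>x\<in>?B. \<bar>pd js (tens_mono \<alpha>) x\<bar> \<le> M" for \<alpha> :: "'n \<Rightarrow> nat"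
  proof -
    have "continuous_on UNIV (pd js (tens_mono \<alpha>))"
      by (rule Ck_continuous[OF Ck_pd[of js 0, OF Ck_tens_mono]])
    then have "bounded (pd js (tens_mono \<alpha>) ` ?B)"
      by (intro compact_imp_bounded compact_continuous_image) (auto intro: continuous_on_subset[of UNIV])
    then obtain M where "\<And>x. x \<in> ?B \<Longrightarrow> \<bar>pd js (tens_mono \<alpha>) x\<bar> \<le> M" by (auto simp: bounded_iff)
    then show ?thesis by (intro exI[of _ "max M 0"]) (auto simp: max.coboundedI1)
  qed
  then obtain M where M: "\<And>\<alpha>. M \<alpha> \<ge> 0" "\<And>\<alpha> x. x \<in> ?B \<Longrightarrow> \<bar>pd js (tens_mono \<alpha>) x\<bar> \<le> M \<alpha>"
    by metis
  define S where "S = sum M ?D"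
  have "(pd js q x)\<^sup>2 \<le> (S\<^sup>2 * C1) * (LINT x:cbox 0 1|lborel. (q x)\<^sup>2)"
    if q: "q \<in> Qpoly p" and x: "\<And>i. \<bar>x $ i\<bar> \<le> R" for q and x :: "real^'n"
  proof -
    obtain c where c: "q = (\<lambda>x. \<Sum>\<alpha>\<in>?D. c \<alpha> * tens_mono \<alpha> x)" using q by (auto simp: Qpoly_iff)
    define B where "B = (LINT x:cbox 0 1|lborel. (q x)\<^sup>2)"
    have B: "B \<ge> 0" unfolding B_def set_lebesgue_integral_def by (rule integral_nonneg_AE) (auto split: split_indicator)
    have cb: "\<bar>c \<alpha>\<bar> \<le> sqrt (C1 * B)" if "\<alpha> \<in> ?D" for \<alpha>
      using C1(2)[OF that, of c] by (simp add: B_def c real_le_rsqrt)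
    have xB: "x \<in> ?B" using x by (simp add: mem_box_cart abs_le_iff) (metis minus_le_iff)
    have "pd js q x = (\<Sum>\<alpha>\<in>?D. c \<alpha> * pd js (tens_mono \<alpha>) x)"
      unfolding c by (simp add: pd_sum pd_cmult Ck_cmult Ck_tens_mono)
    then have "\<bar>pd js q x\<bar> \<le> (\<Sum>\<alpha>\<in>?D. \<bar>c \<alpha>\<bar> * \<bar>pd js (tens_mono \<alpha>) x\<bar>)"
      by (metis (no_types, lifting) abs_mult sum.cong sum_abs)
    also have "\<dots> \<le> (\<Sum>\<alpha>\<in>?D. sqrt (C1 * B) * M \<alpha>)"
      using cb M(2)[OF xB] C1(1) B by (intro sum_mono mult_mono) auto
    finally have "\<bar>pd js q x\<bar> \<le> sqrt (C1 * B) * S" by (simp add: S_def sum_distrib_left)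
    then have "\<bar>pd js q x\<bar>\<^sup>2 \<le> (sqrt (C1 * B) * S)\<^sup>2" by (intro power_mono) auto
    then show ?thesis using C1(1) B by (simp add: power_mult_distrib B_def mult_ac)
  qed
  then show ?thesis using C1(1) by (intro exI[of _ "S\<^sup>2 * C1"]) auto
qed

text \<open>Scaling of the unit cube estimate. The volume factor \<open>h ^ CARD('n)\<close> appears
  on both sides and cancels; each derivative contributes a factor \<open>1 / h\<close>,
  squared.\<close>

lemma cube_poly_bound_list:
  "\<exists>C\<ge>0. \<forall>h>0. \<forall>(b::real^'n) b' q. q \<in> Qpoly p \<longrightarrow> (\<forall>i. \<bar>b' $ i - b $ i\<bar> \<le> R * h) \<longrightarrow>
     l2sq (cube b' h) (pd js q) \<le> ennreal (C / h ^ (2 * length js)) * l2sq (cube b h) q"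
proof -
  \<comment> \<open>A point of the cube at \<open>b'\<close> is at distance at most
    \<open>R * h\<close> plus one side length from \<open>b\<close> in every coordinate, hence
    \<open>R + 1\<close> after scaling.\<close>
  obtain C where C: "C \<ge> 0" "\<And>q x. q \<in> Qpoly p \<Longrightarrow> (\<And>i. \<bar>(x::real^'n) $ i\<bar> \<le> R + 1) \<Longrightarrow>
     (pd js q x)\<^sup>2 \<le> C * (LINT x:cbox 0 1|lborel. (q x)\<^sup>2)"
    using unit_cube_bound[of p "R + 1" js] by blast
  have "l2sq (cube b' h) (pd js q) \<le> ennreal (C / h ^ (2 * length js)) * l2sq (cube b h) q"
    if h: "h > 0" and q: "q \<in> Qpoly p" and bb: "\<And>i. \<bar>b' $ i - b $ i\<bar> \<le> R * h" for h b b' and q :: "real^'n \<Rightarrow> real"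
  proof -
    let ?q = "\<lambda>x. q (b + h *\<^sub>R x)"
    have qh: "?q \<in> Qpoly p" by (rule Qpoly_affine[OF q])
    have [measurable]: "q \<in> borel_measurable borel" using Qpoly_continuous[OF q] by (rule borel_measurable_continuous_onI)
    have scale: "l2sq (cube b h) q = ennreal (h ^ CARD('n)) * l2sq (cbox 0 1) ?q"
    proof -
      have "b + h *\<^sub>R x \<in> cube b h \<longleftrightarrow> x \<in> cbox 0 1" for x
        using h by (simp add: mem_cube mem_box_cart zero_le_mult_iff)
      then have "indicator (cube b h) (b + h *\<^sub>R x) = (indicator (cbox 0 1) x :: ennreal)" for x
        by (simp add: indicator_def)
      then show ?thesis unfolding l2sq_def
        by (subst nn_integral_affine[OF _ h, of _ b]) simp_all
    qed
    have pt: "ennreal ((pd js q y)\<^sup>2) \<le> ennreal (C / h ^ (2 * length js)) * l2sq (cbox 0 1) ?q" if y: "y \<in> cube b' h" for y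
    proof -
      define x where "x = (1 / h) *\<^sub>R (y - b)"
      have yx: "y = b + h *\<^sub>R x" using h by (simp add: x_def)
      have "\<bar>y $ i - b $ i\<bar> \<le> (R + 1) * h" for i
        using y bb[of i] h unfolding mem_cube by (auto simp: algebra_simps abs_le_iff dest!: spec[of _ i])
      then have "\<bar>x $ i\<bar> \<le> R + 1" for i
        using h by (simp add: x_def abs_mult pos_divide_le_eq)
      from C(2)[OF qh this]
      have "(h ^ length js * pd js q y)\<^sup>2 \<le> C * (LINT x:cbox 0 1|lborel. (?q x)\<^sup>2)"
        by (simp add: pd_scale[OF Ck_Qpoly[OF q]] yx)
      then have "(pd js q y)\<^sup>2 \<le> C / h ^ (2 * length js) * (LINT x:cbox 0 1|lborel. (?q x)\<^sup>2)"
        using h by (simp add: power_mult_distrib field_simps power_mult[symmetric] mult.commute)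
      then have "ennreal ((pd js q y)\<^sup>2) \<le> ennreal (C / h ^ (2 * length js) * (LINT x:cbox 0 1|lborel. (?q x)\<^sup>2))"
        by (rule ennreal_leI)
      also have "\<dots> = ennreal (C / h ^ (2 * length js)) * ennreal (LINT x:cbox 0 1|lborel. (?q x)\<^sup>2)"
        using C(1) h by (intro ennreal_mult') simp
      also have "\<dots> = ennreal (C / h ^ (2 * length js)) * l2sq (cbox 0 1) ?q"
        by (simp add: l2sq_continuous[OF Qpoly_continuous[OF qh], of "cbox 0 1"])
      finally show ?thesis .
    qed
    have "l2sq (cube b' h) (pd js q) \<le> (\<integral>\<^sup>+x. indicator (cube b' h) x * (ennreal (C / h ^ (2 * length js)) * l2sq (cbox 0 1) ?q) \<partial>lborel)"
      unfolding l2sq_def[of "cube b' h"] using pt by (intro nn_integral_mono) (auto split: split_indicator)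
    also have "\<dots> = ennreal (C / h ^ (2 * length js)) * l2sq (cube b h) q"
      by (simp add: nn_integral_multc emeasure_cube[OF h] scale mult_ac)
    finally show ?thesis .
  qed
  then show ?thesis using C(1) by blast
qed

lemma finite_lists_le: "finite {js :: 'n::finite list. length js \<le> m}"
  using finite_lists_length_le[of "UNIV :: 'n set" m] by simp

text \<open>One estimate with two uses. With \<open>js = []\<close> and different corners it bounds
  the extension of a polynomial to a nearby cube; with equal corners it is the inverse inequality.
  Only finitely many lists occur, so their constants can be added.\<close>

theorem cube_poly_bound:
  "\<exists>C\<ge>0. \<forall>h>0. \<forall>(b::real^'n) b' q js. length js \<le> m \<longrightarrow> q \<in> Qpoly p \<longrightarrow> (\<forall>i. \<bar>b' $ i - b $ i\<bar> \<le> R * h) \<longrightarrow>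
     l2sq (cube b' h) (pd js q) \<le> ennreal (C / h ^ (2 * length js)) * l2sq (cube b h) q"
proof -
  obtain C where C: "\<And>js. C js \<ge> 0" "\<And>js h (b::real^'n) b' q. h > 0 \<Longrightarrow> q \<in> Qpoly p \<Longrightarrow> (\<forall>i. \<bar>b' $ i - b $ i\<bar> \<le> R * h) \<Longrightarrow>
     l2sq (cube b' h) (pd js q) \<le> ennreal (C js / h ^ (2 * length js)) * l2sq (cube b h) q"
    using cube_poly_bound_list[of p R, where 'n = 'n] by metis
  define C' where "C' = sum C {js. length js \<le> m}"
  have "C js \<le> C'" if "length js \<le> m" for js
    unfolding C'_def using that C(1) finite_lists_le by (intro member_le_sum) auto
  then have "ennreal (C js / h ^ (2 * length js)) * r \<le> ennreal (C' / h ^ (2 * length js)) * r"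
    if "length js \<le> m" "h > 0" for js h r
    using that by (intro mult_right_mono ennreal_leI divide_right_mono) auto
  moreover have "C' \<ge> 0" using C(1) by (simp add: C'_def sum_nonneg)
  ultimately show ?thesis using C(2) by (intro exI[of _ C']) (blast intro: order_trans)
qed

section \<open>Polynomials with prescribed means of derivatives\<close>

text \<open>Monomials are indexed by the same multisets as derivatives, so that derivatives of order
  \<open>n\<close> act diagonally on the monomials of degree \<open>n\<close>.\<close>

definition mono_ms :: "'n::finite multiset \<Rightarrow> real^'n \<Rightarrow> real" where
  "mono_ms \<alpha> = tens_mono (count \<alpha>)"

lemma Ck_mono_ms: "Ck k (mono_ms \<alpha>)"
  by (simp add: mono_ms_def Ck_tens_mono)

lemma mono_ms_empty: "mono_ms {#} = (\<lambda>x. 1)"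
  by (simp add: mono_ms_def tens_mono_def[abs_def])

lemma partial_deriv_mono_ms:
  "partial_deriv i (mono_ms \<alpha>) = (\<lambda>x. real (count \<alpha> i) * mono_ms (\<alpha> - {#i#}) x)"
proof -
  have "partial_deriv i (mono_ms \<alpha>) = tens ((\<lambda>j. monom 1 (count \<alpha> j))(i := smult (real (count \<alpha> i)) (monom 1 (count \<alpha> i - 1))))"
    by (simp add: mono_ms_def tens_mono_tens partial_deriv_tens pderiv_monom smult_monom)
  also have "\<dots> = (\<lambda>x. real (count \<alpha> i) * tens ((\<lambda>j. monom 1 (count \<alpha> j))(i := monom 1 (count \<alpha> i - 1))) x)"
    by (rule ext) (rule tens_upd_smult)
  also have "(\<lambda>j. monom (1::real) (count \<alpha> j))(i := monom 1 (count \<alpha> i - 1)) = (\<lambda>j. monom 1 (count (\<alpha> - {#i#}) j))"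
    by auto
  finally show ?thesis by (simp add: mono_ms_def tens_mono_tens)
qed

text \<open>The numerical factor produced when the monomial \<alpha> is differentiated along
  \<open>js\<close>. Truncated subtraction makes it 0 as soon as the exponent of some coordinate is
  exhausted.\<close>

primrec dcoef :: "'n list \<Rightarrow> 'n multiset \<Rightarrow> real" where
  "dcoef [] \<alpha> = 1"
| "dcoef (i # js) \<alpha> = dcoef js \<alpha> * real (count (\<alpha> - mset js) i)"

lemma pd_mono_ms: "pd js (mono_ms \<alpha>) = (\<lambda>x. dcoef js \<alpha> * mono_ms (\<alpha> - mset js) x)"
proof (induction js)
  case (Cons i js)
  have "mono_ms (\<alpha> - mset js) differentiable (at x)" for x
    using Ck_mono_ms[of "Suc 0" "\<alpha> - mset js"] by simp
  then show ?case by (simp add: Cons partial_deriv_cmult partial_deriv_mono_ms mult.assoc)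
qed simp

lemma dcoef_neq_0: "mset js \<subseteq># \<alpha> \<Longrightarrow> dcoef js \<alpha> \<noteq> 0"
proof (induction js)
  case (Cons i js)
  have le: "count (add_mset i (mset js)) j \<le> count \<alpha> j" for j
    using Cons.prems by (simp add: subseteq_mset_def)
  have "count (mset js) j \<le> count \<alpha> j" for j using le[of j] by (cases "i = j") auto
  then have "mset js \<subseteq># \<alpha>" by (simp add: subseteq_mset_def)
  moreover have "Suc (count (mset js) i) \<le> count \<alpha> i" using le[of i] by simp
  ultimately show ?case using Cons.IH by simp
qed simp

lemma dcoef_eq_0: "\<not> mset js \<subseteq># \<alpha> \<Longrightarrow> dcoef js \<alpha> = 0"
proof (induction js)
  case (Cons i js)
  show ?case
  proof (cases "mset js \<subseteq># \<alpha>")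
    case True
    have "count \<alpha> i \<le> count (mset js) i"
    proof (rule ccontr)
      assume "\<not> ?thesis"
      then have "mset (i # js) \<subseteq># \<alpha>" using True by (auto simp: subseteq_mset_def Suc_le_eq)
      with Cons.prems show False by simp
    qed
    then show ?thesis by simp
  next
    case False
    with Cons.IH show ?thesis by simp
  qed
qed simp

lemma pd_mono_ms_high:
  fixes js :: "'n::finite list"
  assumes "size \<alpha> \<le> length js" "mset js \<noteq> \<alpha>"
  shows "pd js (mono_ms \<alpha>) = (\<lambda>x. 0)"
proof -
  have "\<not> mset js \<subseteq># \<alpha>"
  proof
    assume "mset js \<subseteq># \<alpha>"
    moreover have "\<not> mset js \<subset># \<alpha>" using assms(1) mset_subset_size[of "mset js" \<alpha>] by auto
    ultimately show False using assms(2) by (auto simp: subset_mset.le_less)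
  qed
  then show ?thesis by (simp add: pd_mono_ms dcoef_eq_0)
qed

lemma pd_mono_ms_same: "mset js = \<alpha> \<Longrightarrow> pd js (mono_ms \<alpha>) = (\<lambda>x. dcoef js \<alpha>)"
  by (simp add: pd_mono_ms mono_ms_empty)

text \<open>Inherited from the symmetry of mixed derivatives instead of from the recursion: both
  numbers are the same constant derivative of one monomial.\<close>

lemma dcoef_perm: "mset (js :: 'n::finite list) = mset js' \<Longrightarrow> dcoef js (mset js) = dcoef js' (mset js)"
  using pd_mono_ms_same[of js "mset js"] pd_mono_ms_same[of js' "mset js"]
    pd_perm[of js js' "mono_ms (mset js)", OF _ Ck_mono_ms] by (metis (full_types))

lemma finite_size_multiset [simp]: "finite {\<alpha> :: 'n::finite multiset. size \<alpha> = n}"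
proof -
  have "{\<alpha> :: 'n multiset. size \<alpha> = n} \<subseteq> mset ` {js. length js \<le> n}"
  proof
    fix \<alpha> :: "'n multiset" assume "\<alpha> \<in> {\<alpha>. size \<alpha> = n}"
    moreover obtain js where "mset js = \<alpha>" using ex_mset by blast
    ultimately show "\<alpha> \<in> mset ` {js. length js \<le> n}" by (intro image_eqI[of _ _ js]) auto
  qed
  then show ?thesis using finite_lists_le finite_subset by blast
qed

lemma finite_size_le_multiset [simp]:
  "finite {\<alpha> :: 'n::finite multiset. size \<alpha> \<le> n}" "finite {\<alpha> :: 'n::finite multiset. size \<alpha> < n}"
proof -
  have "{\<alpha> :: 'n multiset. size \<alpha> \<le> n} = (\<Union>k\<le>n. {\<alpha>. size \<alpha> = k})" by auto
  then show "finite {\<alpha> :: 'n multiset. size \<alpha> \<le> n}" by simp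
  then show "finite {\<alpha> :: 'n multiset. size \<alpha> < n}" by (rule rev_finite_subset) auto
qed

text \<open>Polynomials of total degree below \<open>n\<close>. The strict bound lets
  \<open>n = 0\<close> stand for the zero polynomial alone, which starts the induction on
  \<open>n\<close>.\<close>

definition polys_lt :: "nat \<Rightarrow> (real^'n \<Rightarrow> real) set" where
  "polys_lt n = range (\<lambda>c x. \<Sum>\<alpha> | size \<alpha> < n. c \<alpha> * mono_ms \<alpha> x)"

lemma Ck_polys_lt: "q \<in> polys_lt n \<Longrightarrow> Ck k q"
  by (auto simp: polys_lt_def intro!: Ck_sum Ck_cmult Ck_mono_ms)

lemma polys_lt_subset_Qpoly: "n \<le> Suc p \<Longrightarrow> (polys_lt n :: (real^'n \<Rightarrow> real) set) \<subseteq> Qpoly p"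
proof -
  assume n: "n \<le> Suc p"
  have "mono_ms \<alpha> \<in> Qpoly p" if "size \<alpha> < n" for \<alpha> :: "'n multiset"
  proof -
    have "count \<alpha> i \<le> p" for i using that n count_le_size[of \<alpha> i] by linarith
    then show ?thesis unfolding mono_ms_def by (intro tens_mono_in_Qpoly) (simp add: degs_def)
  qed
  then show ?thesis by (auto simp: polys_lt_def intro!: Qpoly_sum Qpoly_cmult)
qed

lemma pd_polys_lt: "q \<in> polys_lt n \<Longrightarrow> n \<le> length js \<Longrightarrow> pd js q = (\<lambda>x. 0)"
proof -
  assume "q \<in> polys_lt n" and n: "n \<le> length js"
  then obtain c where c: "q = (\<lambda>x. \<Sum>\<alpha> | size \<alpha> < n. c \<alpha> * mono_ms \<alpha> x)" by (auto simp: polys_lt_def)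
  have "pd js (mono_ms \<alpha>) = (\<lambda>x. 0)" if "size \<alpha> < n" for \<alpha>
    using that n by (intro pd_mono_ms_high) auto
  then show ?thesis unfolding c by (simp add: pd_sum pd_cmult Ck_cmult Ck_mono_ms)
qed

lemma pd_polys_lt_top:
  assumes "q \<in> polys_lt (Suc n)" "length js = n"
  shows "\<exists>k. pd js q = (\<lambda>x. k)"
proof -
  obtain c where c: "q = (\<lambda>x. \<Sum>\<alpha> | size \<alpha> < Suc n. c \<alpha> * mono_ms \<alpha> x)" using assms by (auto simp: polys_lt_def)
  have "\<exists>k. pd js (mono_ms \<alpha>) = (\<lambda>x. k)" if "size \<alpha> < Suc n" for \<alpha>
    using that assms(2) pd_mono_ms_high[of \<alpha> js] pd_mono_ms_same[of js \<alpha>] by fastforce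
  then obtain k where "\<And>\<alpha>. size \<alpha> < Suc n \<Longrightarrow> pd js (mono_ms \<alpha>) = (\<lambda>x. k \<alpha>)" by metis
  then have "pd js q = (\<lambda>x. \<Sum>\<alpha> | size \<alpha> < Suc n. c \<alpha> * k \<alpha>)"
    unfolding c by (simp add: pd_sum pd_cmult Ck_cmult Ck_mono_ms)
  then show ?thesis by blast
qed

text \<open>The linear system is triangular: derivatives of order \<open>n\<close> annihilate all
  lower degrees and are constant on the part of degree \<open>n\<close>. That part is thus fixed by
  the means of order \<open>n\<close>, and the induction hypothesis supplies the rest.\<close>

theorem prescribed_means:
  fixes Q :: "(real^'n) set"
  assumes Q: "compact Q" and pos: "measure lborel Q > 0"
  shows "\<exists>q\<in>polys_lt n. \<forall>js. length js < n \<longrightarrow> (LINT x:Q|lborel. pd js q x) = A (mset js)"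
proof (induction n arbitrary: A)
  case 0
  show ?case by (auto simp: polys_lt_def)
next
  case (Suc n)
  have int: "set_integrable lborel Q f" if "continuous_on UNIV f" for f :: "real^'n \<Rightarrow> real"
    by (rule set_integrable_continuous[OF that Q])
  have cst: "(LINT x:Q|lborel. k) = k * measure lborel Q" for k :: real
    using Q by (simp add: set_lebesgue_integral_def compact_imp_closed)
  obtain lst where lst: "\<And>\<alpha> :: 'n multiset. mset (lst \<alpha>) = \<alpha>" using ex_mset by metis
  \<comment> \<open>The derivative of this monomial of its own order is the constant
    \<open>dcoef\<close>, so its integral over \<open>Q\<close> carries that constant and the
    measure of \<open>Q\<close>; both are divided out.\<close>
  define a where "a \<alpha> = A \<alpha> / (dcoef (lst \<alpha>) \<alpha> * measure lborel Q)" for \<alpha>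
  define t where "t x = (\<Sum>\<alpha> | size \<alpha> = n. a \<alpha> * mono_ms \<alpha> x)" for x
  have tC: "Ck k t" for k unfolding t_def[abs_def] by (intro Ck_sum Ck_cmult Ck_mono_ms)
  have pdt: "pd js t = (\<lambda>x. \<Sum>\<alpha> | size \<alpha> = n. a \<alpha> * pd js (mono_ms \<alpha>) x)" for js
    unfolding t_def[abs_def] by (simp add: pd_sum pd_cmult Ck_cmult Ck_mono_ms)
  have top: "(LINT x:Q|lborel. pd js t x) = A (mset js)" if "length js = n" for js
  proof -
    have "a \<alpha> * pd js (mono_ms \<alpha>) x = (if \<alpha> = mset js then a \<alpha> * dcoef js \<alpha> else 0)" if "size \<alpha> = n" for \<alpha> x
      using that \<open>length js = n\<close> pd_mono_ms_high[of \<alpha> js] pd_mono_ms_same[of js \<alpha>] by auto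
    then have "pd js t x = (\<Sum>\<alpha> | size \<alpha> = n. if \<alpha> = mset js then a \<alpha> * dcoef js \<alpha> else 0)" for x
      unfolding pdt by (intro sum.cong) auto
    then have "pd js t = (\<lambda>x. a (mset js) * dcoef js (mset js))"
      using that by (simp add: fun_eq_iff)
    moreover have "dcoef js (mset js) = dcoef (lst (mset js)) (mset js)"
      by (rule dcoef_perm) (simp add: lst)
    moreover have "dcoef (lst (mset js)) (mset js) \<noteq> 0" by (rule dcoef_neq_0) (simp add: lst)
    ultimately show ?thesis using pos by (simp add: cst a_def)
  qed
  \<comment> \<open>The top-degree part \<open>t\<close> also contributes to the means of lower
    order; these contributions are subtracted from the targets, which is why the induction keeps
    \<open>A\<close> arbitrary.\<close>
  obtain q' where q': "q' \<in> polys_lt n" "\<And>js. length js < n \<Longrightarrow> (LINT x:Q|lborel. pd js q' x) = A (mset js) - (LINT x:Q|lborel. pd (lst (mset js)) t x)"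
    using Suc.IH[of "\<lambda>\<alpha>. A \<alpha> - (LINT x:Q|lborel. pd (lst \<alpha>) t x)"] by blast
  obtain c' where c': "q' = (\<lambda>x. \<Sum>\<alpha> | size \<alpha> < n. c' \<alpha> * mono_ms \<alpha> x)" using q'(1) by (auto simp: polys_lt_def)
  define q where "q x = q' x + t x" for x
  have "q \<in> polys_lt (Suc n)"
  proof -
    let ?c = "\<lambda>\<alpha>. if size \<alpha> < n then c' \<alpha> else a \<alpha>"
    have "{\<alpha> :: 'n multiset. size \<alpha> < Suc n} = {\<alpha>. size \<alpha> < n} \<union> {\<alpha>. size \<alpha> = n}" by auto
    then have "(\<Sum>\<alpha> | size \<alpha> < Suc n. ?c \<alpha> * mono_ms \<alpha> x) = (\<Sum>\<alpha> | size \<alpha> < n. ?c \<alpha> * mono_ms \<alpha> x) + (\<Sum>\<alpha> | size \<alpha> = n. ?c \<alpha> * mono_ms \<alpha> x)" for x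
      by (simp add: sum.union_disjoint disjoint_iff)
    also have "\<dots> x = q x" for x
      unfolding q_def c' t_def by (intro arg_cong2[where f = "(+)"] sum.cong) auto
    finally have "q = (\<lambda>x. \<Sum>\<alpha> | size \<alpha> < Suc n. ?c \<alpha> * mono_ms \<alpha> x)" by (simp add: fun_eq_iff)
    then show ?thesis unfolding polys_lt_def by (rule image_eqI[where x = ?c]) simp
  qed
  moreover have "(LINT x:Q|lborel. pd js q x) = A (mset js)" if js: "length js < Suc n" for js
  proof -
    have pdq: "pd js q = (\<lambda>x. pd js q' x + pd js t x)"
      unfolding q_def[abs_def] by (rule pd_add[OF Ck_polys_lt[OF q'(1)] tC])
    have c: "continuous_on UNIV (pd js q')" "continuous_on UNIV (pd js t)"
      using Ck_continuous[OF Ck_pd[of js 0]] Ck_polys_lt[OF q'(1)] tC by auto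
    have s: "(LINT x:Q|lborel. pd js q x) = (LINT x:Q|lborel. pd js q' x) + (LINT x:Q|lborel. pd js t x)"
      unfolding pdq by (rule set_integral_add(2)[OF int[OF c(1)] int[OF c(2)]])
    show ?thesis
    proof (cases "length js = n")
      case True
      then show ?thesis using s top pd_polys_lt[OF q'(1), of js] by (simp add: cst)
    next
      case False
      have "pd (lst (mset js)) t = pd js t" by (rule pd_perm[OF _ tC]) (simp add: lst)
      then show ?thesis using s q'(2)[of js] False js by simp
    qed
  qed
  ultimately show ?case by blast
qed

section \<open>Polynomial approximation of Sobolev functions on cubes\<close>

text \<open>In the fractional case the inner integral extends over the whole space and not only over the
  cube under consideration: this makes the local seminorms integrals of one fixed density, which can
  be summed over overlapping cubes.\<close>

definition sob_density :: "real \<Rightarrow> ('n::finite multiset \<Rightarrow> real^'n \<Rightarrow> real) \<Rightarrow> real^'n \<Rightarrow> ennreal" where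
  "sob_density s W x =
     (if frac s = 0 then \<Sum>\<beta> | size \<beta> = nat \<lfloor>s\<rfloor>. ennreal ((W \<beta> x)\<^sup>2)
      else \<Sum>\<beta> | size \<beta> = nat \<lfloor>s\<rfloor>.
        (\<integral>\<^sup>+y. ennreal ((W \<beta> x - W \<beta> y)\<^sup>2 / norm (x - y) powr (real CARD('n) + 2 * frac s)) \<partial>lborel))"

lemma has_weak_deriv_multi_deriv:
  assumes "\<And>k. Ck k q"
  shows "has_weak_deriv U \<alpha> q (multi_deriv \<alpha> q)"
proof -
  obtain js where js: "mset js = \<alpha>" using ex_mset by blast
  have "has_weak_deriv U \<alpha> q (pd js q)" by (rule has_weak_deriv_Ck[OF assms js order_refl])
  then show ?thesis using multi_deriv_eq_pd[OF js assms] by simp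
qed

lemma cube_norm_le:
  fixes x y :: "real^'n"
  assumes "x \<in> cube b h" "y \<in> cube b h" "h > 0"
  shows "norm (y - x) \<le> sqrt CARD('n) * h"
proof -
  have "\<bar>(y - x) $ i\<bar> \<le> h" for i
  proof -
    have "b $ i \<le> x $ i" "x $ i \<le> b $ i + h" "b $ i \<le> y $ i" "y $ i \<le> b $ i + h"
      using assms(1,2) by (auto simp: mem_cube)
    then show ?thesis by (simp add: abs_le_iff)
  qed
  then have "((y - x) $ i)\<^sup>2 \<le> h\<^sup>2" for i using abs_le_square_iff[of "(y - x) $ i" h] assms(3) by simp
  then have "(\<Sum>i\<in>UNIV. ((y - x) $ i)\<^sup>2) \<le> (\<Sum>i\<in>(UNIV::'n set). h\<^sup>2)" by (intro sum_mono)
  then have "sqrt (\<Sum>i\<in>UNIV. ((y - x) $ i)\<^sup>2) \<le> sqrt (CARD('n) * h\<^sup>2)" by simp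
  then show ?thesis using assms(3) by (simp add: norm_vec_def L2_set_def real_sqrt_mult)
qed

text \<open>For fixed \<open>i\<close>, adding \<open>i\<close> is injective on multi-indices, so
  each multi-index of order \<open>Suc j\<close> is counted at most once for every
  direction.\<close>

lemma sum_add_mset_le:
  fixes f :: "'n::finite multiset \<Rightarrow> ennreal"
  shows "(\<Sum>\<alpha> | size \<alpha> = j. \<Sum>i\<in>UNIV. f (add_mset i \<alpha>)) \<le> of_nat CARD('n) * (\<Sum>\<alpha> | size \<alpha> = Suc j. f \<alpha>)"
proof -
  have "(\<Sum>\<alpha> | size \<alpha> = j. f (add_mset i \<alpha>)) \<le> (\<Sum>\<alpha> | size \<alpha> = Suc j. f \<alpha>)" for i
  proof -
    have "(\<Sum>\<alpha> | size \<alpha> = j. f (add_mset i \<alpha>)) = sum f (add_mset i ` {\<alpha>. size \<alpha> = j})"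
      by (subst sum.reindex) (auto simp: inj_on_def)
    also have "\<dots> \<le> (\<Sum>\<alpha> | size \<alpha> = Suc j. f \<alpha>)" by (rule sum_mono2) auto
    finally show ?thesis .
  qed
  then have "(\<Sum>i\<in>UNIV. \<Sum>\<alpha> | size \<alpha> = j. f (add_mset i \<alpha>)) \<le> (\<Sum>i\<in>(UNIV :: 'n set). (\<Sum>\<alpha> | size \<alpha> = Suc j. f \<alpha>))"
    by (intro sum_mono)
  also have "\<dots> = of_nat CARD('n) * (\<Sum>\<alpha> | size \<alpha> = Suc j. f \<alpha>)" by simp
  finally show ?thesis by (subst sum.swap)
qed

text \<open>The number \<open>n\<close> of orders with prescribed means is kept apart from the
  number \<open>N\<close> of available derivatives: the integer case uses \<open>n = N\<close>,
  while the fractional case also needs zero means at the top order. A step from order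
  \<open>j\<close> to the next uses the zero means at order \<open>j\<close>, hence the restriction
  \<open>J \<le> n\<close>.\<close>

lemma bramble_hilbert_chain:
  fixes W :: "'n::finite multiset \<Rightarrow> real^'n \<Rightarrow> real" and b :: "real^'n"
  assumes W: "\<And>\<alpha>. size \<alpha> \<le> N \<Longrightarrow> has_weak_deriv UNIV \<alpha> w (W \<alpha>)"
    and L2: "\<And>\<alpha>. size \<alpha> \<le> N \<Longrightarrow> integrable lborel (\<lambda>x. (W \<alpha> x)\<^sup>2)"
    and h: "h > 0"
  defines "Q \<equiv> cube b h"
  shows "\<exists>q\<in>polys_lt n.
     (\<forall>\<alpha>. size \<alpha> \<le> N \<longrightarrow> size \<alpha> < n \<longrightarrow> (LINT x:Q|lborel. W \<alpha> x - multi_deriv \<alpha> q x) = 0) \<and>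
     (\<forall>\<alpha>. size \<alpha> \<le> N \<longrightarrow> set_integrable lborel Q (\<lambda>x. (W \<alpha> x - multi_deriv \<alpha> q x)\<^sup>2)) \<and>
     (\<forall>j J. j \<le> J \<longrightarrow> J \<le> N \<longrightarrow> J \<le> n \<longrightarrow>
        (\<Sum>\<alpha> | size \<alpha> = j. l2sq Q (\<lambda>x. W \<alpha> x - multi_deriv \<alpha> q x))
        \<le> ennreal ((2 ^ CARD('n) * (real CARD('n))\<^sup>2 * h\<^sup>2) ^ (J - j)) * (\<Sum>\<alpha> | size \<alpha> = J. l2sq Q (\<lambda>x. W \<alpha> x - multi_deriv \<alpha> q x)))"
proof -
  have eQ: "emeasure lborel Q = ennreal (h ^ CARD('n))" unfolding Q_def by (rule emeasure_cube[OF h])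
  have Qc: "compact Q" "Q \<in> sets borel" "convex Q" by (auto simp: Q_def)
  have mQ: "measure lborel Q > 0" using eQ h by (simp add: measure_def)
  obtain q where q: "q \<in> polys_lt n" "\<And>js. length js < n \<Longrightarrow> (LINT x:Q|lborel. pd js q x) = (LINT x:Q|lborel. W (mset js) x)"
    using prescribed_means[OF Qc(1) mQ, of n "\<lambda>\<alpha>. LINT x:Q|lborel. W \<alpha> x"] by blast
  have qC: "Ck k q" for k by (rule Ck_polys_lt[OF q(1)])
  have md: "multi_deriv \<alpha> q = pd js q" if "mset js = \<alpha>" for \<alpha> js by (rule multi_deriv_eq_pd[OF that qC])
  have mdc: "continuous_on UNIV (multi_deriv \<alpha> q)" for \<alpha>
  proof -
    obtain js where js: "mset js = \<alpha>" using ex_mset by blast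
    show ?thesis unfolding md[OF js] by (rule Ck_continuous[OF Ck_pd[of js 0, OF qC]])
  qed
  define V where "V \<alpha> x = W \<alpha> x - multi_deriv \<alpha> q x" for \<alpha> x
  have Wm: "W \<alpha> \<in> borel_measurable borel" and Wi: "set_integrable lborel Q (W \<alpha>)" if "size \<alpha> \<le> N" for \<alpha>
  proof -
    have "locally_integrable UNIV (W \<alpha>)" using W[OF that] by (simp add: has_weak_deriv_def)
    then show "W \<alpha> \<in> borel_measurable borel" "set_integrable lborel Q (W \<alpha>)"
      using locally_integrable_measurable[of "W \<alpha>"] Qc(1) by (simp_all add: locally_integrable_def)
  qed
  have mdm: "multi_deriv \<alpha> q \<in> borel_measurable borel" for \<alpha>
    by (rule borel_measurable_continuous_onI[OF mdc])
  have mean: "(LINT x:Q|lborel. V \<alpha> x) = 0" if "size \<alpha> \<le> N" "size \<alpha> < n" for \<alpha>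
  proof -
    obtain js where js: "mset js = \<alpha>" using ex_mset by blast
    then have "length js < n" using that by auto
    then have "(LINT x:Q|lborel. multi_deriv \<alpha> q x) = (LINT x:Q|lborel. W \<alpha> x)"
      using q(2)[of js] js by (simp add: md[OF js])
    then show ?thesis unfolding V_def
      using set_integral_diff(2)[OF Wi[OF that(1)] set_integrable_continuous[OF mdc Qc(1), of \<alpha>]] by simp
  qed
  have sq: "set_integrable lborel Q (\<lambda>x. (V \<alpha> x)\<^sup>2)" if a: "size \<alpha> \<le> N" for \<alpha>
    unfolding set_integrable_def
  proof (rule Bochner_Integration.integrable_bound)
    note [measurable] = Wm[OF a] mdm[of \<alpha>] Qc(2)
    show "integrable lborel (\<lambda>x. 2 * (W \<alpha> x)\<^sup>2 + 2 * (indicator Q x *\<^sub>R (multi_deriv \<alpha> q x)\<^sup>2))"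
      using L2[OF a] set_integrable_continuous[OF _ Qc(1), of "\<lambda>x. (multi_deriv \<alpha> q x)\<^sup>2"]
      by (simp add: set_integrable_def continuous_intros mdc)
    show "(\<lambda>x. indicator Q x *\<^sub>R (V \<alpha> x)\<^sup>2) \<in> borel_measurable lborel" unfolding V_def by measurable
    have "(c - e)\<^sup>2 \<le> 2 * c\<^sup>2 + 2 * e\<^sup>2" for c e :: real
      using zero_le_power2[of "c + e"] by (simp add: power2_sum power2_diff)
    then show "AE x in lborel. norm (indicator Q x *\<^sub>R (V \<alpha> x)\<^sup>2) \<le> norm (2 * (W \<alpha> x)\<^sup>2 + 2 * (indicator Q x *\<^sub>R (multi_deriv \<alpha> q x)\<^sup>2))"
      by (auto simp: V_def split: split_indicator)
  qed
  define D where "D = sqrt CARD('n) * h"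
  define S where "S j = (\<Sum>\<alpha> | size \<alpha> = j. l2sq Q (V \<alpha>))" for j
  \<comment> \<open>The power of 2 comes from the Poincare inequality, one factor
    \<open>CARD('n) * h\<^sup>2\<close> is the squared diameter, and the other
    \<open>CARD('n)\<close> is the multiplicity of multi-indices.\<close>
  define K where "K = 2 ^ CARD('n) * (real CARD('n))\<^sup>2 * h\<^sup>2"
  have K: "K \<ge> 0" by (simp add: K_def)
  have step: "S j \<le> ennreal K * S (Suc j)" if j: "Suc j \<le> N" "Suc j \<le> n" for j
  proof -
    have "l2sq Q (V \<alpha>) \<le> ennreal (2 ^ CARD('n) * D\<^sup>2) * (\<Sum>i\<in>UNIV. l2sq Q (V (add_mset i \<alpha>)))" if a: "size \<alpha> = j" for \<alpha>
    proof -
      have wd: "has_weak_deriv UNIV \<beta> (\<lambda>x. w x - q x) (V \<beta>)" if "size \<beta> \<le> N" for \<beta>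
        unfolding V_def using has_weak_deriv_diff[OF W[OF that] has_weak_deriv_multi_deriv[OF qC]] .
      have st: "has_weak_deriv UNIV {#i#} (V \<alpha>) (V (add_mset i \<alpha>))" for i
        using a j by (intro has_weak_deriv_step[of UNIV \<alpha> "\<lambda>x. w x - q x"] wd) auto
      have Vm: "V (add_mset i \<alpha>) \<in> borel_measurable borel" for i
        using locally_integrable_measurable[of "V (add_mset i \<alpha>)"] st by (simp add: has_weak_deriv_def)
      have "l2sq Q (V \<alpha>) \<le> ennreal (2 ^ CARD('n) * D\<^sup>2) * (\<integral>\<^sup>+x. indicator Q x * ennreal (\<Sum>i\<in>UNIV. (V (add_mset i \<alpha>) x)\<^sup>2) \<partial>lborel)"
        unfolding l2sq_def
      proof (rule poincare[OF st Qc(2,3)])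
        show "norm (y - x) \<le> D" if "x \<in> Q" "y \<in> Q" for x y
          using cube_norm_le[of x b h y] that h by (simp add: Q_def D_def)
        show "0 < emeasure lborel Q" "emeasure lborel Q < \<infinity>" using eQ h by auto
        show "set_integrable lborel Q (\<lambda>x. (V \<alpha> x)\<^sup>2)" "(LINT x:Q|lborel. V \<alpha> x) = 0"
          using a j by (auto intro: sq mean)
      qed
      also have "(\<integral>\<^sup>+x. indicator Q x * ennreal (\<Sum>i\<in>UNIV. (V (add_mset i \<alpha>) x)\<^sup>2) \<partial>lborel) = (\<Sum>i\<in>UNIV. l2sq Q (V (add_mset i \<alpha>)))"
      proof -
        have e: "indicator Q x * ennreal (\<Sum>i\<in>UNIV. (V (add_mset i \<alpha>) x)\<^sup>2)
          = (\<Sum>i\<in>UNIV. indicator Q x * ennreal ((V (add_mset i \<alpha>) x)\<^sup>2))" for x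
          by (simp add: sum_distrib_left[symmetric])
        show ?thesis unfolding l2sq_def e
        proof (rule nn_integral_sum)
          fix i
          note [measurable] = Vm[of i] Qc(2)
          show "(\<lambda>x. indicator Q x * ennreal ((V (add_mset i \<alpha>) x)\<^sup>2)) \<in> borel_measurable lborel" by measurable
        qed
      qed
      finally show ?thesis .
    qed
    then have "S j \<le> (\<Sum>\<alpha> | size \<alpha> = j. ennreal (2 ^ CARD('n) * D\<^sup>2) * (\<Sum>i\<in>UNIV. l2sq Q (V (add_mset i \<alpha>))))"
      unfolding S_def by (intro sum_mono) auto
    also have "\<dots> = ennreal (2 ^ CARD('n) * D\<^sup>2) * (\<Sum>\<alpha> | size \<alpha> = j. \<Sum>i\<in>UNIV. l2sq Q (V (add_mset i \<alpha>)))"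
      by (simp add: sum_distrib_left)
    also have "\<dots> \<le> ennreal (2 ^ CARD('n) * D\<^sup>2) * (of_nat CARD('n) * S (Suc j))"
      unfolding S_def by (intro mult_left_mono sum_add_mset_le) auto
    also have "\<dots> = ennreal K * S (Suc j)"
    proof -
      have "ennreal (2 ^ CARD('n) * D\<^sup>2) * of_nat CARD('n) = ennreal (2 ^ CARD('n) * D\<^sup>2 * real CARD('n))"
        by (simp add: ennreal_mult' ennreal_of_nat_eq_real_of_nat)
      also have "2 ^ CARD('n) * D\<^sup>2 * real CARD('n) = K" by (simp add: K_def D_def power_mult_distrib power2_eq_square)
      finally show ?thesis by (simp add: mult.assoc[symmetric])
    qed
    finally show ?thesis .
  qed
  have chain: "S j \<le> ennreal (K ^ (J - j)) * S J" if "j \<le> J" "J \<le> N" "J \<le> n" for j J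
    using that
  proof (induction J rule: dec_induct)
    case (step k)
    then have "S j \<le> ennreal (K ^ (k - j)) * S k" by simp
    also have "\<dots> \<le> ennreal (K ^ (k - j)) * (ennreal K * S (Suc k))"
      using step.prems by (intro mult_left_mono \<open>\<And>j. Suc j \<le> N \<Longrightarrow> Suc j \<le> n \<Longrightarrow> S j \<le> ennreal K * S (Suc j)\<close>) auto
    also have "\<dots> = ennreal (K ^ (Suc k - j)) * S (Suc k)"
    proof -
      have "ennreal (K ^ (k - j)) * ennreal K = ennreal (K ^ (k - j) * K)"
        using K by (intro ennreal_mult'[symmetric]) simp
      also have "K ^ (k - j) * K = K ^ (Suc k - j)" using step.hyps by (simp add: Suc_diff_le)
      finally show ?thesis by (simp only: mult.assoc[symmetric])
    qed
    finally show ?case .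
  qed simp
  show ?thesis
    using q(1) mean sq chain unfolding V_def S_def K_def by (intro bexI[of _ q]) auto
qed

lemma sob_density_measurable:
  assumes [measurable]: "\<And>\<beta>. size \<beta> = nat \<lfloor>s\<rfloor> \<Longrightarrow> W \<beta> \<in> borel_measurable borel"
  shows "sob_density s W \<in> borel_measurable borel"
  unfolding sob_density_def[abs_def] by (cases "frac s = 0") simp_all

text \<open>By \<open>uf\<close>, \<open>u\<close> and \<open>f\<close> differ by a constant, so
  their differences agree. On the cube the distance is at most the diameter, which bounds the
  squared difference by a multiple of the fractional kernel; enlarging the inner integral to the
  whole space only increases the right-hand side.\<close>

lemma slobodeckij_mean_bound:
  fixes u f :: "real^'n \<Rightarrow> real"
  assumes [measurable]: "f \<in> borel_measurable borel" "u \<in> borel_measurable borel"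
    and uf: "\<And>x y. u x - u y = f x - f y" and \<sigma>: "\<sigma> \<ge> 0" and h: "h > 0"
    and mean: "(LINT x:cube b h|lborel. u x) = 0" and i2: "set_integrable lborel (cube b h) (\<lambda>x. (u x)\<^sup>2)"
  shows "l2sq (cube b h) u \<le> ennreal (sqrt CARD('n) powr (real CARD('n) + 2 * \<sigma>) * h powr (2 * \<sigma>)) *
     (\<integral>\<^sup>+x. indicator (cube b h) x * (\<integral>\<^sup>+y. ennreal ((f x - f y)\<^sup>2 / norm (x - y) powr (real CARD('n) + 2 * \<sigma>)) \<partial>lborel) \<partial>lborel)"
proof -
  let ?Q = "cube b h" and ?d = "real CARD('n) + 2 * \<sigma>"
  define D where "D = sqrt CARD('n) * h"
  have D: "D > 0" using h by (simp add: D_def)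
  let ?r = "\<integral>\<^sup>+x. indicator ?Q x * (\<integral>\<^sup>+y. ennreal ((f x - f y)\<^sup>2 / norm (x - y) powr ?d) \<partial>lborel) \<partial>lborel"
  have eQ: "emeasure lborel ?Q = ennreal (h ^ CARD('n))" by (rule emeasure_cube[OF h])
  have pt: "ennreal ((u y - u x)\<^sup>2) \<le> ennreal (D powr ?d) * ennreal ((f x - f y)\<^sup>2 / norm (x - y) powr ?d)"
    if "x \<in> ?Q" "y \<in> ?Q" for x y
  proof (cases "x = y")
    case False
    have "norm (x - y) powr ?d \<le> D powr ?d"
      using cube_norm_le[OF that(2,1) h] \<sigma> by (intro powr_mono2) (auto simp: D_def)
    then have "(f x - f y)\<^sup>2 * norm (x - y) powr ?d \<le> (f x - f y)\<^sup>2 * D powr ?d" by (intro mult_left_mono) auto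
    then have "(f x - f y)\<^sup>2 \<le> D powr ?d * ((f x - f y)\<^sup>2 / norm (x - y) powr ?d)"
      using False by (simp add: field_simps)
    then have "(u y - u x)\<^sup>2 \<le> D powr ?d * ((f x - f y)\<^sup>2 / norm (x - y) powr ?d)"
      using uf[of x y] by (simp add: power2_commute[of "u y"])
    then show ?thesis by (subst ennreal_mult'[symmetric]) (auto intro: ennreal_leI)
  qed simp
  have "emeasure lborel ?Q * l2sq ?Q u \<le> (\<integral>\<^sup>+x. indicator ?Q x * (\<integral>\<^sup>+y. indicator ?Q y * ennreal ((u y - u x)\<^sup>2) \<partial>lborel) \<partial>lborel)"
    unfolding l2sq_def by (rule mean_zero_bound[OF _ _ _ i2 mean]) (auto simp: eQ)
  also have "\<dots> \<le> (\<integral>\<^sup>+x. indicator ?Q x * (\<integral>\<^sup>+y. ennreal (D powr ?d) * ennreal ((f x - f y)\<^sup>2 / norm (x - y) powr ?d) \<partial>lborel) \<partial>lborel)"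
  proof (rule nn_integral_mono)
    fix x
    have "(\<integral>\<^sup>+y. indicator ?Q y * ennreal ((u y - u x)\<^sup>2) \<partial>lborel) \<le> (\<integral>\<^sup>+y. ennreal (D powr ?d) * ennreal ((f x - f y)\<^sup>2 / norm (x - y) powr ?d) \<partial>lborel)" if "x \<in> ?Q"
      using pt[OF that] by (intro nn_integral_mono) (auto split: split_indicator)
    then show "indicator ?Q x * (\<integral>\<^sup>+y. indicator ?Q y * ennreal ((u y - u x)\<^sup>2) \<partial>lborel)
      \<le> indicator ?Q x * (\<integral>\<^sup>+y. ennreal (D powr ?d) * ennreal ((f x - f y)\<^sup>2 / norm (x - y) powr ?d) \<partial>lborel)"
      by (auto split: split_indicator)
  qed
  also have "\<dots> = ennreal (D powr ?d) * ?r"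
    by (simp add: nn_integral_cmult mult.left_commute[of "indicator _ _"])
  \<comment> \<open>The part \<open>h ^ CARD('n)\<close> of the kernel bound is the measure of the
    cube and cancels; the remaining power of \<open>h\<close> is the gain in order.\<close>
  also have "D powr ?d = h ^ CARD('n) * (sqrt CARD('n) powr ?d * h powr (2 * \<sigma>))"
    using h by (simp add: D_def powr_mult powr_add powr_realpow)
  also have "ennreal (h ^ CARD('n) * (sqrt CARD('n) powr ?d * h powr (2 * \<sigma>))) * ?r = emeasure lborel ?Q * (ennreal (sqrt CARD('n) powr ?d * h powr (2 * \<sigma>)) * ?r)"
    unfolding eQ using h by (subst ennreal_mult') (auto simp: mult.assoc)
  finally have le: "emeasure lborel ?Q * l2sq ?Q u \<le> emeasure lborel ?Q * (ennreal (sqrt CARD('n) powr ?d * h powr (2 * \<sigma>)) * ?r)" .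
  then show ?thesis
    using h by (subst (asm) ennreal_mult_le_mult_iff) (auto simp: eQ)
qed

text \<open>Poincare steps lift every error to the top order \<open>N\<close>. There the polynomial
  disappears: in the integer case its derivatives of order \<open>N\<close> are 0, and in the
  fractional case they are constants, which cancel in the differences.\<close>

theorem bramble_hilbert:
  assumes s: "0 \<le> s" "s \<le> real p + 1"
  shows "\<exists>C>0. \<forall>w (W :: 'n::finite multiset \<Rightarrow> real^'n \<Rightarrow> real) b h.
     (\<forall>\<alpha>. size \<alpha> \<le> nat \<lfloor>s\<rfloor> \<longrightarrow> has_weak_deriv UNIV \<alpha> w (W \<alpha>) \<and> integrable lborel (\<lambda>x. (W \<alpha> x)\<^sup>2)) \<longrightarrow> h > 0 \<longrightarrow>
     (\<exists>q\<in>Qpoly p. \<forall>\<alpha>. size \<alpha> \<le> nat \<lfloor>s\<rfloor> \<longrightarrow>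
        l2sq (cube b h) (\<lambda>x. W \<alpha> x - multi_deriv \<alpha> q x)
        \<le> ennreal (C * h powr (2 * (s - real (size \<alpha>)))) * (\<integral>\<^sup>+x. indicator (cube b h) x * sob_density s W x \<partial>lborel))"
proof -
  define N where "N = nat \<lfloor>s\<rfloor>"
  define \<sigma> where "\<sigma> = frac s"
  have sN: "s = real N + \<sigma>" using s(1) by (simp add: N_def \<sigma>_def frac_def)
  have \<sigma>: "0 \<le> \<sigma>" "\<sigma> < 1" by (auto simp: \<sigma>_def frac_lt_1)
  \<comment> \<open>For fractional \<open>s\<close> the bound \<open>s \<le> real p + 1\<close> is
    strict, so \<open>N \<le> p\<close> and the additional degree still fits into
    \<open>Qpoly p\<close>.\<close>
  define n where "n = (if \<sigma> = 0 then N else Suc N)"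
  have n: "n \<le> Suc p" "N \<le> n"
    using s(2) sN \<sigma> by (auto simp: n_def)
  define k where "k = 2 ^ CARD('n) * (real CARD('n))\<^sup>2"
  have k: "k \<ge> 1" unfolding k_def by (intro mult_ge1_I) auto
  \<comment> \<open>At most \<open>N\<close> Poincare steps occur, and \<open>k \<ge> 1\<close>
    allows the power to be rounded up to \<open>N\<close>; the last factor is the constant of the
    fractional bound.\<close>
  define C where "C = k ^ N * (if \<sigma> = 0 then 1 else sqrt CARD('n) powr (real CARD('n) + 2 * \<sigma>))"
  have C: "C > 0" using k by (auto simp: C_def)
  have main: "\<exists>q\<in>Qpoly p. \<forall>\<alpha>. size \<alpha> \<le> N \<longrightarrow>
        l2sq (cube b h) (\<lambda>x. W \<alpha> x - multi_deriv \<alpha> q x)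
        \<le> ennreal (C * h powr (2 * (s - real (size \<alpha>)))) * (\<integral>\<^sup>+x. indicator (cube b h) x * sob_density s W x \<partial>lborel)"
    if W: "\<And>\<alpha>. size \<alpha> \<le> N \<Longrightarrow> has_weak_deriv UNIV \<alpha> w (W \<alpha>)" and L2: "\<And>\<alpha>. size \<alpha> \<le> N \<Longrightarrow> integrable lborel (\<lambda>x. (W \<alpha> x)\<^sup>2)"
      and h: "h > 0" for w and W :: "'n multiset \<Rightarrow> real^'n \<Rightarrow> real" and b h
  proof -
    let ?Q = "cube b h" and ?F = "\<integral>\<^sup>+x. indicator (cube b h) x * sob_density s W x \<partial>lborel"
    obtain q where q: "q \<in> polys_lt n"
      and mean: "\<And>\<alpha>. size \<alpha> \<le> N \<Longrightarrow> size \<alpha> < n \<Longrightarrow> (LINT x:?Q|lborel. W \<alpha> x - multi_deriv \<alpha> q x) = 0"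
      and sq: "\<And>\<alpha>. size \<alpha> \<le> N \<Longrightarrow> set_integrable lborel ?Q (\<lambda>x. (W \<alpha> x - multi_deriv \<alpha> q x)\<^sup>2)"
      and ch: "\<And>j J. j \<le> J \<Longrightarrow> J \<le> N \<Longrightarrow> J \<le> n \<Longrightarrow>
        (\<Sum>\<alpha> | size \<alpha> = j. l2sq ?Q (\<lambda>x. W \<alpha> x - multi_deriv \<alpha> q x))
        \<le> ennreal ((2 ^ CARD('n) * (real CARD('n))\<^sup>2 * h\<^sup>2) ^ (J - j)) * (\<Sum>\<alpha> | size \<alpha> = J. l2sq ?Q (\<lambda>x. W \<alpha> x - multi_deriv \<alpha> q x))"
      using bramble_hilbert_chain[OF W L2 h, of N n b] by blast
    have Wm: "W \<alpha> \<in> borel_measurable borel" if "size \<alpha> \<le> N" for \<alpha>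
      using locally_integrable_measurable[of "W \<alpha>"] W[OF that] by (simp add: has_weak_deriv_def)
    have qC: "Ck j q" for j by (rule Ck_polys_lt[OF q])
    define T where "T = (\<Sum>\<alpha> | size \<alpha> = N. l2sq ?Q (\<lambda>x. W \<alpha> x - multi_deriv \<alpha> q x))"
    have T: "T \<le> ennreal ((C / k ^ N) * h powr (2 * \<sigma>)) * ?F"
    proof (cases "\<sigma> = 0")
      case True
      have "multi_deriv \<alpha> q = (\<lambda>x. 0)" if "size \<alpha> = N" for \<alpha>
      proof -
        obtain js where js: "mset js = \<alpha>" using ex_mset by blast
        then have "pd js q = (\<lambda>x. 0)" using that True by (intro pd_polys_lt[OF q]) (auto simp: n_def)
        then show ?thesis using multi_deriv_eq_pd[OF js qC] by simp
      qed
      then have "T = (\<Sum>\<alpha> | size \<alpha> = N. l2sq ?Q (W \<alpha>))" unfolding T_def by (intro sum.cong) auto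
      also have "\<dots> = (\<integral>\<^sup>+x. (\<Sum>\<alpha> | size \<alpha> = N. indicator ?Q x * ennreal ((W \<alpha> x)\<^sup>2)) \<partial>lborel)"
        unfolding l2sq_def using Wm by (subst nn_integral_sum) auto
      also have "\<dots> = ?F"
        using True unfolding sob_density_def N_def[symmetric] \<sigma>_def[symmetric]
        by (simp add: sum_distrib_left del: sum_ennreal)
      finally show ?thesis using True k h by (simp add: C_def)
    next
      case False
      let ?g = "\<lambda>\<alpha> x y. ennreal ((W \<alpha> x - W \<alpha> y)\<^sup>2 / norm (x - y) powr (real CARD('n) + 2 * \<sigma>))"
      let ?c = "sqrt CARD('n) powr (real CARD('n) + 2 * \<sigma>) * h powr (2 * \<sigma>)"
      have "l2sq ?Q (\<lambda>x. W \<alpha> x - multi_deriv \<alpha> q x) \<le> ennreal ?c * (\<integral>\<^sup>+x. indicator ?Q x * (\<integral>\<^sup>+y. ?g \<alpha> x y \<partial>lborel) \<partial>lborel)"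
        if a: "size \<alpha> = N" for \<alpha>
      proof -
        obtain js where js: "mset js = \<alpha>" using ex_mset by blast
        then have "\<exists>c. pd js q = (\<lambda>x. c)" using a q False by (intro pd_polys_lt_top[of q N]) (auto simp: n_def)
        then obtain c where c: "multi_deriv \<alpha> q = (\<lambda>x. c)" using multi_deriv_eq_pd[OF js qC] by auto
        show ?thesis
          using Wm[of \<alpha>] a mean[of \<alpha>] sq[of \<alpha>] False \<sigma> h unfolding c
          by (intro slobodeckij_mean_bound) (auto simp: n_def)
      qed
      then have "T \<le> (\<Sum>\<alpha> | size \<alpha> = N. ennreal ?c * (\<integral>\<^sup>+x. indicator ?Q x * (\<integral>\<^sup>+y. ?g \<alpha> x y \<partial>lborel) \<partial>lborel))"
        unfolding T_def by (intro sum_mono) auto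
      also have "\<dots> = ennreal ?c * (\<Sum>\<alpha> | size \<alpha> = N. \<integral>\<^sup>+x. indicator ?Q x * (\<integral>\<^sup>+y. ?g \<alpha> x y \<partial>lborel) \<partial>lborel)"
        by (simp add: sum_distrib_left)
      also have "(\<Sum>\<alpha> | size \<alpha> = N. \<integral>\<^sup>+x. indicator ?Q x * (\<integral>\<^sup>+y. ?g \<alpha> x y \<partial>lborel) \<partial>lborel)
         = (\<integral>\<^sup>+x. (\<Sum>\<alpha> | size \<alpha> = N. indicator ?Q x * (\<integral>\<^sup>+y. ?g \<alpha> x y \<partial>lborel)) \<partial>lborel)"
        using Wm by (subst nn_integral_sum) auto
      also have "\<dots> = ?F"
        using False unfolding sob_density_def N_def[symmetric] \<sigma>_def[symmetric]
        by (simp add: sum_distrib_left)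
      finally show ?thesis using False k by (simp add: C_def)
    qed
    have "l2sq ?Q (\<lambda>x. W \<alpha> x - multi_deriv \<alpha> q x) \<le> ennreal (C * h powr (2 * (s - real (size \<alpha>)))) * ?F"
      if a: "size \<alpha> \<le> N" for \<alpha>
    proof -
      let ?j = "N - size \<alpha>"
      have "l2sq ?Q (\<lambda>x. W \<alpha> x - multi_deriv \<alpha> q x) \<le> (\<Sum>\<beta> | size \<beta> = size \<alpha>. l2sq ?Q (\<lambda>x. W \<beta> x - multi_deriv \<beta> q x))"
        by (rule member_le_sum) auto
      also have "\<dots> \<le> ennreal ((k * h\<^sup>2) ^ ?j) * T"
        using ch[OF a order_refl n(2)] by (simp add: T_def k_def)
      also have "\<dots> \<le> ennreal ((k * h\<^sup>2) ^ ?j) * (ennreal ((C / k ^ N) * h powr (2 * \<sigma>)) * ?F)"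
        using T by (intro mult_left_mono) auto
      also have "\<dots> = ennreal ((k * h\<^sup>2) ^ ?j * ((C / k ^ N) * h powr (2 * \<sigma>))) * ?F"
        using k by (subst ennreal_mult') (auto simp: mult.assoc)
      also have "\<dots> \<le> ennreal (C * h powr (2 * (s - real (size \<alpha>)))) * ?F"
      proof (intro mult_right_mono ennreal_leI)
        have "h powr real (2 * ?j) = (h\<^sup>2) ^ ?j"
          using powr_realpow[OF h, of "2 * ?j"] by (simp only: power_mult)
        moreover have "real (2 * ?j) + 2 * \<sigma> = 2 * (s - real (size \<alpha>))"
          using a by (simp add: sN of_nat_diff algebra_simps)
        ultimately have e: "(h\<^sup>2) ^ ?j * h powr (2 * \<sigma>) = h powr (2 * (s - real (size \<alpha>)))"
          by (metis powr_add)
        have "k ^ ?j * (C / k ^ N) \<le> C"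
        proof -
          have "k ^ ?j \<le> k ^ N" using k by (intro power_increasing) auto
          then have "k ^ ?j * C \<le> k ^ N * C" using C by (intro mult_right_mono) auto
          then show ?thesis using k by (simp add: field_simps)
        qed
        then have "k ^ ?j * (C / k ^ N) * h powr (2 * (s - real (size \<alpha>))) \<le> C * h powr (2 * (s - real (size \<alpha>)))"
          by (intro mult_right_mono) auto
        then show "(k * h\<^sup>2) ^ ?j * ((C / k ^ N) * h powr (2 * \<sigma>)) \<le> C * h powr (2 * (s - real (size \<alpha>)))"
          unfolding e[symmetric] by (simp add: power_mult_distrib mult_ac)
      qed auto
      finally show ?thesis .
    qed
    then show ?thesis using q polys_lt_subset_Qpoly[OF n(1)] by blast
  qed
  show ?thesis
  proof (intro exI[of _ C] conjI allI impI)
    show "C > 0" by (rule C)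
  qed (rule main[unfolded N_def]; blast)
qed

section \<open>Geometry of the uniform mesh\<close>

text \<open>Elements are indexed by integer vectors, so that adjacency, distance and counting of
  elements become statements about integers.\<close>

definition cell :: "real \<Rightarrow> real^'n \<Rightarrow> int^'n \<Rightarrow> (real^'n) set" where
  "cell h a z = cube (\<chi> i. a $ i + h * of_int (z $ i)) h"

lemma mem_cell: "x \<in> cell h a z \<longleftrightarrow> (\<forall>i. a $ i + h * of_int (z $ i) \<le> x $ i \<and> x $ i \<le> a $ i + h * (of_int (z $ i) + 1))"
  by (simp add: cell_def mem_cube algebra_simps)

lemma uniform_mesh_cell: "uniform_mesh h a = range (cell h a)"
  unfolding uniform_mesh_def
  by (intro image_cong refl set_eqI) (simp add: mem_cell mem_box_cart)

lemma interior_cell: "interior (cell h a z) = box (\<chi> i. a $ i + h * of_int (z $ i)) (\<chi> i. a $ i + h * (of_int (z $ i) + 1))"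
  unfolding cell_def cube_def interior_cbox
  by (intro arg_cong2[where f = box]) (auto simp: vec_eq_iff algebra_simps)

lemma cell_simps [simp, measurable]:
  "cell h a z \<in> sets borel" "compact (cell h a z)" "interior (cell h a z) \<in> sets borel"
  by (auto simp: cell_def)

lemma int_between_eq:
  fixes b h x :: real
  assumes "h > 0" "b + h * of_int z < x" "x < b + h * (of_int z + 1)"
    "b + h * of_int z' \<le> x" "x \<le> b + h * (of_int z' + 1)"
  shows "z = (z' :: int)"
proof -
  have "h * of_int z < h * (of_int z' + 1)" "h * of_int z' < h * (of_int z + 1)" using assms by linarith+
  then have "(of_int z :: real) < of_int z' + 1" "(of_int z' :: real) < of_int z + 1" using assms(1) by simp_all
  then show ?thesis by linarith
qed

lemma interior_cell_unique:
  assumes "h > 0" "x \<in> interior (cell h a z)" "x \<in> cell h a z'"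
  shows "z = z'"
proof -
  have "z $ i = z' $ i" for i
    using assms(2,3) by (intro int_between_eq[OF assms(1), of "a $ i" _ "x $ i"]) (auto simp: interior_cell mem_box_cart mem_cell)
  then show ?thesis by (simp add: vec_eq_iff)
qed

lemma cell_inj: "h > 0 \<Longrightarrow> cell h a z = cell h a z' \<longleftrightarrow> z = z'"
proof
  assume h: "h > 0" and e: "cell h a z = cell h a z'"
  have "(\<chi> i. a $ i + h * (of_int (z $ i) + 1/2)) \<in> interior (cell h a z)"
    using h by (simp add: interior_cell mem_box_cart)
  moreover from this have "(\<chi> i. a $ i + h * (of_int (z $ i) + 1/2)) \<in> cell h a z'"
    using e interior_subset by blast
  ultimately show "z = z'" using interior_cell_unique[OF h] by blast
qed simp

lemma cell_cover: "h > 0 \<Longrightarrow> \<exists>z. x \<in> cell h a z"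
proof (rule exI[of _ "\<chi> i. \<lfloor>(x $ i - a $ i) / h\<rfloor>"])
  assume h: "h > 0"
  show "x \<in> cell h a (\<chi> i. \<lfloor>(x $ i - a $ i) / h\<rfloor>)"
    unfolding mem_cell
  proof
    fix i
    have "h * of_int \<lfloor>(x $ i - a $ i) / h\<rfloor> \<le> h * ((x $ i - a $ i) / h)"
      "h * ((x $ i - a $ i) / h) \<le> h * (of_int \<lfloor>(x $ i - a $ i) / h\<rfloor> + 1)"
      using h by (intro mult_left_mono; linarith)+
    then have "h * of_int \<lfloor>(x $ i - a $ i) / h\<rfloor> \<le> x $ i - a $ i" "x $ i - a $ i \<le> h * (of_int \<lfloor>(x $ i - a $ i) / h\<rfloor> + 1)"
      using h by simp_all
    then show "a $ i + h * of_int ((\<chi> i. \<lfloor>(x $ i - a $ i) / h\<rfloor>) $ i) \<le> x $ i \<and>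
      x $ i \<le> a $ i + h * (of_int ((\<chi> i. \<lfloor>(x $ i - a $ i) / h\<rfloor>) $ i) + 1)" by simp
  qed
qed

lemma null_boundary_cell: "AE x in lborel. x \<notin> cell h a z - interior (cell h a z)"
proof -
  have c: "cell h a z = cbox (\<chi> i. a $ i + h * of_int (z $ i)) (\<chi> i. a $ i + h * (of_int (z $ i) + 1))"
    by (auto simp: mem_cell mem_box_cart)
  show ?thesis
    unfolding interior_cell unfolding c
    by (intro AE_not_in) (simp add: null_sets_def emeasure_Diff box_subset_cbox emeasure_lborel_cbox_eq emeasure_lborel_box_eq)
qed

lemma l2sq_cell_interior: "l2sq (interior (cell h a z)) f = l2sq (cell h a z) f"
  unfolding l2sq_def
proof (rule nn_integral_cong_AE)
  show "AE x in lborel. indicator (interior (cell h a z)) x * ennreal ((f x)\<^sup>2) = indicator (cell h a z) x * ennreal ((f x)\<^sup>2)"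
    using null_boundary_cell[of h a z]
  proof eventually_elim
    case (elim x)
    then show ?case using interior_subset[of "cell h a z"] by (auto split: split_indicator)
  qed
qed

lemma card_int_box:
  fixes l :: "'n::finite \<Rightarrow> int"
  shows "finite {z :: int^'n. \<forall>i. l i \<le> z $ i \<and> z $ i \<le> l i + int m}"
    "card {z :: int^'n. \<forall>i. l i \<le> z $ i \<and> z $ i \<le> l i + int m} \<le> (m + 1) ^ CARD('n)"
proof -
  let ?A = "{z :: int^'n. \<forall>i. l i \<le> z $ i \<and> z $ i \<le> l i + int m}"
  let ?P = "PiE UNIV (\<lambda>i. {l i..l i + int m})"
  have inj: "inj_on vec_nth ?A" by (auto intro: inj_onI simp: vec_eq_iff)
  have sub: "vec_nth ` ?A \<subseteq> ?P" by (auto simp: PiE_iff)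
  have fin: "finite ?P" by (intro finite_PiE) auto
  show "finite ?A" using finite_subset[OF sub fin] inj by (rule finite_imageD)
  have "card ?A \<le> card ?P" by (rule card_inj_on_le[OF inj sub fin])
  also have "card ?P = (m + 1) ^ CARD('n)" by (subst card_PiE) (auto simp: nat_add_distrib)
  finally show "card ?A \<le> (m + 1) ^ CARD('n)" .
qed

section \<open>Patches of cells and their overlap\<close>

text \<open>The block of cells whose index differs from \<open>z\<close> by at most \<open>R\<close>
  in each coordinate. It is itself a cube, so polynomial approximation applies to it
  directly.\<close>

definition patch :: "nat \<Rightarrow> real \<Rightarrow> real^'n \<Rightarrow> int^'n \<Rightarrow> (real^'n) set" where
  "patch R h a z = cube (\<chi> i. a $ i + h * (of_int (z $ i) - real R)) ((2 * real R + 1) * h)"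

lemma cell_subset_patch:
  assumes h: "h > 0" and z: "\<And>i. \<bar>z' $ i - z $ i\<bar> \<le> int R"
  shows "cell h a z' \<subseteq> patch R h a z"
proof
  fix x assume x: "x \<in> cell h a z'"
  show "x \<in> patch R h a z"
    unfolding patch_def mem_cube
  proof
    fix i
    have "real_of_int (z $ i) - real R \<le> of_int (z' $ i)" "real_of_int (z' $ i) + 1 \<le> of_int (z $ i) + real R + 1"
      using z[of i] by linarith+
    then have "h * (real_of_int (z $ i) - real R) \<le> h * of_int (z' $ i)" "h * (real_of_int (z' $ i) + 1) \<le> h * (of_int (z $ i) + real R + 1)"
      using h by (simp_all add: mult_left_mono)
    moreover have "a $ i + h * of_int (z' $ i) \<le> x $ i" "x $ i \<le> a $ i + h * (of_int (z' $ i) + 1)"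
      using x by (auto simp: mem_cell)
    ultimately show "(\<chi> i. a $ i + h * (of_int (z $ i) - real R)) $ i \<le> x $ i \<and>
       x $ i \<le> (\<chi> i. a $ i + h * (of_int (z $ i) - real R)) $ i + (2 * real R + 1) * h"
      by (simp add: algebra_simps)
  qed
qed

text \<open>Patches are closed, so a point on a face belongs to the patches on both sides; this
  accounts for \<open>2 * R + 2\<close> possible indices per direction instead of
  \<open>2 * R + 1\<close>.\<close>

lemma patch_overlap:
  fixes a :: "real^'n"
  assumes h: "h > 0"
  shows "finite {z. x \<in> patch R h a z}" "card {z. x \<in> patch R h a z} \<le> (2 * R + 2) ^ CARD('n)"
proof -
  let ?l = "\<lambda>i. \<lfloor>(x $ i - a $ i) / h\<rfloor> - int R - 1"
  have sub: "{z. x \<in> patch R h a z} \<subseteq> {z. \<forall>i. ?l i \<le> z $ i \<and> z $ i \<le> ?l i + int (2 * R + 1)}"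
  proof
    fix z assume "z \<in> {z. x \<in> patch R h a z}"
    then have x: "a $ i + h * (of_int (z $ i) - real R) \<le> x $ i" "x $ i \<le> a $ i + h * (of_int (z $ i) - real R) + (2 * real R + 1) * h" for i
      by (auto simp: patch_def mem_cube)
    have "?l i \<le> z $ i \<and> z $ i \<le> ?l i + int (2 * R + 1)" for i
    proof -
      have "of_int (z $ i) - real R \<le> (x $ i - a $ i) / h" "(x $ i - a $ i) / h \<le> of_int (z $ i) + real R + 1"
        using x[of i] h by (simp_all add: field_simps)
      then show ?thesis by linarith
    qed
    then show "z \<in> {z. \<forall>i. ?l i \<le> z $ i \<and> z $ i \<le> ?l i + int (2 * R + 1)}" by simp
  qed
  show "finite {z. x \<in> patch R h a z}" by (rule finite_subset[OF sub card_int_box(1)])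
  have "card {z. x \<in> patch R h a z} \<le> card {z :: int^'n. \<forall>i. ?l i \<le> z $ i \<and> z $ i \<le> ?l i + int (2 * R + 1)}"
    by (intro card_mono card_int_box sub)
  also have "\<dots> \<le> (2 * R + 1 + 1) ^ CARD('n)" by (rule card_int_box(2))
  finally show "card {z. x \<in> patch R h a z} \<le> (2 * R + 2) ^ CARD('n)" by simp
qed

lemma patch_measurable [measurable, simp]: "patch R h a z \<in> sets borel"
  by (simp add: patch_def)

lemma countable_int_vec: "countable (Z :: (int^'n::finite) set)"
  by (rule countable_subset[OF subset_UNIV]) simp

text \<open>The sum over the possibly infinite set \<open>Z\<close> is exchanged with the Lebesgue
  integral; at each point it then counts the patches that contain the point.\<close>

lemma sum_over_patches:
  fixes a :: "real^'n" and F :: "real^'n \<Rightarrow> ennreal"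
  assumes h: "h > 0" and [measurable]: "F \<in> borel_measurable borel"
  shows "(\<integral>\<^sup>+z. (\<integral>\<^sup>+x. indicator (patch R h a z) x * F x \<partial>lborel) \<partial>count_space Z)
    \<le> of_nat ((2 * R + 2) ^ CARD('n)) * (\<integral>\<^sup>+x. F x \<partial>lborel)"
proof -
  have "(\<integral>\<^sup>+z. (\<integral>\<^sup>+x. indicator (patch R h a z) x * F x \<partial>lborel) \<partial>count_space Z)
     = (\<integral>\<^sup>+x. (\<integral>\<^sup>+z. indicator (patch R h a z) x * F x \<partial>count_space Z) \<partial>lborel)"
    by (rule nn_integral_count_space_nn_integral[symmetric]) (auto simp: countable_int_vec)
  also have "\<dots> \<le> (\<integral>\<^sup>+x. of_nat ((2 * R + 2) ^ CARD('n)) * F x \<partial>lborel)"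
  proof (rule nn_integral_mono)
    fix x
    have "(\<integral>\<^sup>+z. indicator (patch R h a z) x * F x \<partial>count_space Z) = (\<integral>\<^sup>+z. indicator {z. x \<in> patch R h a z} z * F x \<partial>count_space Z)"
      by (intro nn_integral_cong) (auto simp: indicator_def)
    also have "\<dots> = emeasure (count_space Z) ({z. x \<in> patch R h a z} \<inter> Z) * F x"
      by (subst nn_integral_multc) (auto simp: nn_integral_indicator')
    also have "emeasure (count_space Z) ({z. x \<in> patch R h a z} \<inter> Z) = of_nat (card ({z. x \<in> patch R h a z} \<inter> Z))"
      using patch_overlap(1)[OF h, of x R a] by (subst emeasure_count_space_finite) auto
    also have "\<dots> \<le> of_nat ((2 * R + 2) ^ CARD('n))"
      using order_trans[OF card_mono[OF patch_overlap(1)[OF h, of x R a]] patch_overlap(2)[OF h, of x R a]] by (intro of_nat_mono) auto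
    finally show "(\<integral>\<^sup>+z. indicator (patch R h a z) x * F x \<partial>count_space Z) \<le> of_nat ((2 * R + 2) ^ CARD('n)) * F x"
      by (simp add: mult_right_mono)
  qed
  also have "\<dots> = of_nat ((2 * R + 2) ^ CARD('n)) * (\<integral>\<^sup>+x. F x \<partial>lborel)"
    by (rule nn_integral_cmult) simp
  finally show ?thesis .
qed

lemma l2sq_union_cells:
  fixes a :: "real^'n"
  assumes U: "U \<subseteq> (\<Union>z\<in>Z. cell h a z)" and [measurable]: "f \<in> borel_measurable borel"
  shows "l2sq U f \<le> (\<integral>\<^sup>+z. l2sq (cell h a z) f \<partial>count_space Z)"
proof -
  have "l2sq U f \<le> (\<integral>\<^sup>+x. (\<integral>\<^sup>+z. indicator (cell h a z) x * ennreal ((f x)\<^sup>2) \<partial>count_space Z) \<partial>lborel)"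
    unfolding l2sq_def
  proof (rule nn_integral_mono)
    fix x
    show "indicator U x * ennreal ((f x)\<^sup>2) \<le> (\<integral>\<^sup>+z. indicator (cell h a z) x * ennreal ((f x)\<^sup>2) \<partial>count_space Z)"
    proof (cases "x \<in> U")
      case True
      then obtain z where z: "z \<in> Z" "x \<in> cell h a z" using U by blast
      then have "indicator U x * ennreal ((f x)\<^sup>2) = (\<integral>\<^sup>+z'. indicator {z} z' * ennreal ((f x)\<^sup>2) \<partial>count_space Z)"
        using True by (subst nn_integral_multc) (auto simp: nn_integral_indicator' emeasure_count_space_finite)
      also have "\<dots> \<le> (\<integral>\<^sup>+z. indicator (cell h a z) x * ennreal ((f x)\<^sup>2) \<partial>count_space Z)"
        using z by (intro nn_integral_mono mult_right_mono) (auto split: split_indicator)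
      finally show ?thesis .
    qed simp
  qed
  also have "\<dots> = (\<integral>\<^sup>+z. l2sq (cell h a z) f \<partial>count_space Z)"
    unfolding l2sq_def by (rule nn_integral_count_space_nn_integral) (auto simp: countable_int_vec)
  finally show ?thesis .
qed

lemma cell_corner: "h \<ge> 0 \<Longrightarrow> (\<chi> i. a $ i + h * of_int (z $ i)) \<in> cell h a z"
  by (simp add: mem_cell algebra_simps)

text \<open>Turns the diameter bounds for supports and for the element map into bounds on index
  differences. The lower corners of the two cells differ by \<open>h\<close> times the difference of
  the indices.\<close>

lemma cells_close:
  fixes a :: "real^'n"
  assumes h: "h > 0" and X: "cell h a z \<subseteq> X" "cell h a z' \<subseteq> X" "bounded X" "diameter X \<le> C * h"
  shows "\<bar>z $ i - z' $ i\<bar> \<le> int (nat \<lceil>C\<rceil>)"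
proof -
  let ?c = "\<lambda>z. (\<chi> i. a $ i + h * of_int (z $ i)) :: real^'n"
  have "?c z \<in> X" "?c z' \<in> X" using X(1,2) cell_corner[of h a] h by auto
  then have "dist (?c z) (?c z') \<le> C * h" using diameter_bounded_bound[OF X(3)] X(4) by force
  moreover have "\<bar>(?c z - ?c z') $ i\<bar> \<le> dist (?c z) (?c z')" unfolding dist_norm by (rule component_le_norm_cart)
  ultimately have "\<bar>h * (of_int (z $ i) - of_int (z' $ i))\<bar> \<le> C * h" by (simp add: algebra_simps)
  then have "\<bar>of_int (z $ i) - of_int (z' $ i) :: real\<bar> \<le> C" using h by (simp add: abs_mult mult.commute)
  then show ?thesis by linarith
qed

section \<open>Local projections onto polynomials\<close>

lemma L2_on_mult_integrable:
  fixes f g :: "real^'n \<Rightarrow> real"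
  assumes T: "T \<in> sets borel" and fm: "f \<in> borel_measurable borel" and gm: "g \<in> borel_measurable borel"
    and f2: "set_integrable lborel T (\<lambda>x. (f x)\<^sup>2)" and g2: "set_integrable lborel T (\<lambda>x. (g x)\<^sup>2)"
  shows "set_integrable lborel T (\<lambda>x. f x * g x)"
  unfolding set_integrable_def
proof (rule Bochner_Integration.integrable_bound)
  note [measurable] = T fm gm
  show "integrable lborel (\<lambda>x. indicator T x *\<^sub>R (f x)\<^sup>2 + indicator T x *\<^sub>R (g x)\<^sup>2)"
    using f2 g2 unfolding set_integrable_def by (rule Bochner_Integration.integrable_add)
  show "(\<lambda>x. indicator T x *\<^sub>R (f x * g x)) \<in> borel_measurable lborel" by measurable
  have "\<bar>c * e\<bar> \<le> c\<^sup>2 + e\<^sup>2" for c e :: real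
  proof -
    have "2 * (\<bar>c\<bar> * \<bar>e\<bar>) \<le> c\<^sup>2 + e\<^sup>2" using zero_le_power2[of "\<bar>c\<bar> - \<bar>e\<bar>"] by (simp add: power2_diff mult.assoc)
    moreover have "0 \<le> \<bar>c\<bar> * \<bar>e\<bar>" by simp
    ultimately show ?thesis unfolding abs_mult by linarith
  qed
  then show "AE x in lborel. norm (indicator T x *\<^sub>R (f x * g x)) \<le> norm (indicator T x *\<^sub>R (f x)\<^sup>2 + indicator T x *\<^sub>R (g x)\<^sup>2)"
    by (auto split: split_indicator)
qed

text \<open>Gram-Schmidt: when a function is added to the family, the residual is corrected along the
  component of that function orthogonal to the previous ones.\<close>

lemma orthogonal_projection_exists:
  fixes f :: "'j \<Rightarrow> real^'n \<Rightarrow> real"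
  assumes T: "compact T" and F: "finite F" and fc: "\<And>j. j \<in> F \<Longrightarrow> continuous_on UNIV (f j)"
    and v: "v \<in> borel_measurable borel" "set_integrable lborel T (\<lambda>x. (v x)\<^sup>2)"
  shows "\<exists>c. \<forall>j\<in>F. (LINT x:T|lborel. (v x - (\<Sum>i\<in>F. c i * f i x)) * f j x) = 0"
  using F fc v
proof (induction F arbitrary: v)
  case empty
  then show ?case by simp
next
  case (insert k F)
  have Tb: "T \<in> sets borel" using T by (simp add: borel_compact)
  define comb where "comb c x = (\<Sum>i\<in>F. c i * f i x)" for c x
  have cc: "continuous_on UNIV (comb c)" for c
    unfolding comb_def[abs_def] using insert.prems(1) by (intro continuous_intros) auto
  have kc: "continuous_on UNIV (f k)" using insert.prems(1) by simp
  have meas: "g \<in> borel_measurable borel" if "continuous_on UNIV g" for g :: "real^'n \<Rightarrow> real"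
    using that by (rule borel_measurable_continuous_onI)
  have sqi: "set_integrable lborel T (\<lambda>x. (g x)\<^sup>2)" if "continuous_on UNIV g" for g :: "real^'n \<Rightarrow> real"
    using that T by (intro set_integrable_continuous continuous_intros)
  have vi: "set_integrable lborel T (\<lambda>x. v x * g x)" if "continuous_on UNIV g" for g
    by (rule L2_on_mult_integrable[OF Tb insert.prems(2) meas[OF that] insert.prems(3) sqi[OF that]])
  have ci: "set_integrable lborel T (\<lambda>x. g x * g' x)" if "continuous_on UNIV g" "continuous_on UNIV g'" for g g' :: "real^'n \<Rightarrow> real"
    using that T by (intro set_integrable_continuous continuous_intros)
  obtain c where c: "\<And>j. j \<in> F \<Longrightarrow> (LINT x:T|lborel. (v x - comb c x) * f j x) = 0"
    using insert.IH[OF _ insert.prems(2,3)] insert.prems(1) unfolding comb_def by blast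
  obtain e where e: "\<And>j. j \<in> F \<Longrightarrow> (LINT x:T|lborel. (f k x - comb e x) * f j x) = 0"
    using insert.IH[OF _ meas[OF kc] sqi[OF kc]] insert.prems(1) unfolding comb_def by blast
  define r where "r x = v x - comb c x" for x
  define s where "s x = f k x - comb e x" for x
  have sc: "continuous_on UNIV s" unfolding s_def[abs_def] by (intro continuous_intros kc cc)
  have ri: "set_integrable lborel T (\<lambda>x. r x * g x)" if "continuous_on UNIV g" for g
    unfolding r_def using set_integral_diff(1)[OF vi[OF that] ci[OF cc that]] by (simp add: left_diff_distrib)
  have comb_orth: "(LINT x:T|lborel. u x * comb d x) = 0"
    if "\<And>j. j \<in> F \<Longrightarrow> (LINT x:T|lborel. u x * f j x) = 0" "\<And>g. continuous_on UNIV g \<Longrightarrow> set_integrable lborel T (\<lambda>x. u x * g x)" for u d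
  proof -
    have "(LINT x:T|lborel. u x * comb d x) = (LINT x|lborel. (\<Sum>i\<in>F. d i * (indicator T x *\<^sub>R (u x * f i x))))"
      unfolding set_lebesgue_integral_def comb_def by (simp add: sum_distrib_left mult_ac)
    also have "\<dots> = (\<Sum>i\<in>F. d i * (LINT x:T|lborel. u x * f i x))"
      using that(2) insert.prems(1) unfolding set_lebesgue_integral_def set_integrable_def
      by (subst Bochner_Integration.integral_sum) auto
    finally show ?thesis using that(1) by simp
  qed
  have rs_k: "(LINT x:T|lborel. u x * f k x) = (LINT x:T|lborel. u x * s x)"
    if "\<And>j. j \<in> F \<Longrightarrow> (LINT x:T|lborel. u x * f j x) = 0" "\<And>g. continuous_on UNIV g \<Longrightarrow> set_integrable lborel T (\<lambda>x. u x * g x)" for u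
  proof -
    have "(LINT x:T|lborel. u x * s x) = (LINT x:T|lborel. u x * f k x) - (LINT x:T|lborel. u x * comb e x)"
      unfolding s_def using set_integral_diff(2)[OF that(2)[OF kc] that(2)[OF cc]] by (simp add: right_diff_distrib)
    then show ?thesis using comb_orth[OF that] by simp
  qed
  \<comment> \<open>If \<open>s\<close> vanishes almost everywhere on \<open>T\<close>, the quotient
    is 0 by the convention for division, and orthogonality to \<open>s\<close> is then checked
    separately.\<close>
  define t where "t = (LINT x:T|lborel. r x * s x) / (LINT x:T|lborel. s x * s x)"
  define u where "u x = r x - t * s x" for x
  have tsi: "set_integrable lborel T (\<lambda>x. t * (s x * g x))" if "continuous_on UNIV g" for g
    by (intro set_integrable_mult_right ci[OF sc that])
  have ui: "set_integrable lborel T (\<lambda>x. u x * g x)" if "continuous_on UNIV g" for g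
    unfolding u_def using set_integral_diff(1)[OF ri[OF that] tsi[OF that]]
    by (simp add: left_diff_distrib mult.assoc)
  have usplit: "(LINT x:T|lborel. u x * g x) = (LINT x:T|lborel. r x * g x) - t * (LINT x:T|lborel. s x * g x)"
    if "continuous_on UNIV g" for g
    unfolding u_def using set_integral_diff(2)[OF ri[OF that] tsi[OF that]]
    by (simp add: left_diff_distrib mult.assoc)
  have u0: "(LINT x:T|lborel. u x * f j x) = 0" if "j \<in> F" for j
    using usplit[of "f j"] insert.prems(1) that c[OF that] e[OF that] by (simp add: r_def s_def)
  have "(LINT x:T|lborel. u x * s x) = 0"
  proof (cases "(LINT x:T|lborel. s x * s x) = 0")
    case True
    have i: "integrable lborel (\<lambda>x. indicator T x *\<^sub>R (s x * s x))" using ci[OF sc sc] by (simp only: set_integrable_def)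
    have "AE x in lborel. indicator T x *\<^sub>R (s x * s x) = 0"
      using True unfolding set_lebesgue_integral_def
      by (subst (asm) integral_nonneg_eq_0_iff_AE[OF i]) (auto split: split_indicator)
    then have "AE x in lborel. indicator T x *\<^sub>R (u x * s x) = 0"
      by eventually_elim (auto split: split_indicator)
    then show ?thesis unfolding set_lebesgue_integral_def by (rule integral_eq_zero_AE)
  next
    case False
    then show ?thesis using usplit[OF sc] by (simp add: t_def)
  qed
  then have uk: "(LINT x:T|lborel. u x * f k x) = 0" using rs_k[OF u0 ui] by simp
  define d where "d = (\<lambda>i. if i = k then t else c i - t * e i)"
  have "u x = v x - (\<Sum>i\<in>insert k F. d i * f i x)" for x
  proof -
    have "(\<Sum>i\<in>F. d i * f i x) = (\<Sum>i\<in>F. c i * f i x - t * (e i * f i x))"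
      using insert.hyps(2) by (intro sum.cong) (auto simp: d_def algebra_simps)
    also have "\<dots> = comb c x - t * comb e x" by (simp add: comb_def sum_subtractf sum_distrib_left)
    finally show ?thesis using insert.hyps by (simp add: u_def r_def s_def d_def algebra_simps)
  qed
  then have "(LINT x:T|lborel. (v x - (\<Sum>i\<in>insert k F. d i * f i x)) * f j x) = 0" if "j \<in> insert k F" for j
    using u0 uk that by auto
  then show ?case by blast
qed

subsection \<open>The \<open>L\<^sup>2\<close> projection on a cell\<close>

lemma Qpoly_eq_on_open:
  assumes "open U" "x \<in> U" "q \<in> Qpoly p" "q' \<in> Qpoly p" "\<And>y. y \<in> U \<Longrightarrow> q y = q' y"
  shows "q = q'"
proof -
  obtain e where e: "e > 0" "ball x e \<subseteq> U" using assms(1,2) open_contains_ball by blast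
  obtain l u where lu: "x \<in> box l u" "box l u \<subseteq> ball x e" using rational_boxes[OF e(1)] by blast
  show ?thesis
  proof (rule Qpoly_eqI[OF assms(3,4)])
    show "l $ i < u $ i" for i using lu(1) by (auto simp: mem_box_cart intro: less_trans)
    show "q y = q' y" if "y \<in> box l u" for y using that lu(2) e(2) assms(5) by blast
  qed
qed

lemma interior_cell_nonempty: "h > 0 \<Longrightarrow> (\<chi> i. a $ i + h * (of_int (z $ i) + 1/2)) \<in> interior (cell h a z)"
  by (simp add: interior_cell mem_box_cart)

lemma Qpoly_eq_on_cell:
  assumes "h > 0" "q \<in> Qpoly p" "q' \<in> Qpoly p" "\<And>y. y \<in> interior (cell h a z) \<Longrightarrow> q y = q' y"
  shows "q = q'"
  using Qpoly_eq_on_open[OF open_interior interior_cell_nonempty[OF assms(1)] assms(2,3,4)] .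

lemma Qpoly_measurable: "q \<in> Qpoly p \<Longrightarrow> q \<in> borel_measurable borel"
  by (rule borel_measurable_continuous_onI[OF Qpoly_continuous])

lemma Qpoly_cell_integrable:
  assumes "q \<in> Qpoly p" "q' \<in> Qpoly p"
  shows "set_integrable lborel (cell h a z) (\<lambda>x. q x * q' x)"
  by (intro set_integrable_continuous continuous_intros Qpoly_continuous[OF assms(1)] Qpoly_continuous[OF assms(2)]) simp

text \<open>The difference of two candidates is orthogonal to itself, hence 0 almost everywhere on
  the cell and, by continuity, identically. Integrability is stated for products with polynomials,
  the form in which it can be checked directly for the discontinuous extension.\<close>

lemma L2_proj_eqI:
  assumes h: "h > 0" and q: "q \<in> Qpoly p" and o: "\<And>w. w \<in> Qpoly p \<Longrightarrow> (LINT x:cell h a z|lborel. (v x - q x) * w x) = 0"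
    and vi: "\<And>w. w \<in> Qpoly p \<Longrightarrow> set_integrable lborel (cell h a z) (\<lambda>x. v x * w x)"
  shows "L2_proj p (cell h a z) v = q"
  unfolding L2_proj_def
proof (rule the_equality)
  show "q \<in> Qpoly p \<and> (\<forall>w\<in>Qpoly p. (LINT x:cell h a z|lborel. (v x - q x) * w x) = 0)" using q o by blast
  fix q' assume q': "q' \<in> Qpoly p \<and> (\<forall>w\<in>Qpoly p. (LINT x:cell h a z|lborel. (v x - q' x) * w x) = 0)"
  define d where "d x = q x - q' x" for x
  have d: "d \<in> Qpoly p" unfolding d_def using q q' by (intro Qpoly_diff) auto
  have split: "(LINT x:cell h a z|lborel. (v x - r x) * d x) = (LINT x:cell h a z|lborel. v x * d x) - (LINT x:cell h a z|lborel. r x * d x)"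
    if "r \<in> Qpoly p" for r
    using set_integral_diff(2)[OF vi[OF d] Qpoly_cell_integrable[OF that d]] by (simp add: left_diff_distrib)
  have "(LINT x:cell h a z|lborel. d x * d x) = (LINT x:cell h a z|lborel. q x * d x) - (LINT x:cell h a z|lborel. q' x * d x)"
    using set_integral_diff(2)[OF Qpoly_cell_integrable[OF q d, of h a z] Qpoly_cell_integrable[of q' p d h a z]] q' d
    by (simp add: d_def left_diff_distrib)
  also have "\<dots> = 0" using split[OF q] split[of q'] o[OF d] q' d by auto
  finally have "(LINT x:cell h a z|lborel. d x * d x) = 0" .
  moreover have i: "integrable lborel (\<lambda>x. indicator (cell h a z) x *\<^sub>R (d x * d x))"
    using Qpoly_cell_integrable[OF d d] by (simp only: set_integrable_def)
  ultimately have "AE x in lborel. indicator (cell h a z) x *\<^sub>R (d x * d x) = 0"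
    unfolding set_lebesgue_integral_def
    by (subst (asm) integral_nonneg_eq_0_iff_AE[OF i]) (auto split: split_indicator)
  then have "AE x in lborel. x \<in> interior (cell h a z) \<longrightarrow> d x = 0"
  proof eventually_elim
    case (elim x)
    then show ?case using interior_subset[of "cell h a z"] by (auto split: split_indicator_asm)
  qed
  then have "d x = 0" if "x \<in> interior (cell h a z)" for x
    using continuous_zero_AE[OF Qpoly_continuous[OF d]] that unfolding interior_cell by blast
  then show "q' = q" using q' q by (intro Qpoly_eq_on_cell[OF h, of q' p q a z]) (auto simp: d_def)
qed

lemma L2_proj_facts:
  assumes h: "h > 0" and v: "v \<in> borel_measurable borel" "set_integrable lborel (cell h a z) (\<lambda>x. (v x)\<^sup>2)"
  shows "L2_proj p (cell h a z) v \<in> Qpoly p"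
    and "w \<in> Qpoly p \<Longrightarrow> (LINT x:cell h a z|lborel. (v x - L2_proj p (cell h a z) v x) * w x) = 0"
proof -
  let ?T = "cell h a z"
  have vi: "set_integrable lborel ?T (\<lambda>x. v x * w x)" if "w \<in> Qpoly p" for w
    using Qpoly_cell_integrable[OF that that] by (intro L2_on_mult_integrable v Qpoly_measurable[OF that]) (auto simp: power2_eq_square)
  obtain c where c: "\<And>j. j \<in> degs p \<Longrightarrow> (LINT x:?T|lborel. (v x - (\<Sum>i\<in>degs p. c i * tens_mono i x)) * tens_mono j x) = 0"
    using orthogonal_projection_exists[of ?T "degs p" tens_mono v] v Ck_continuous[OF Ck_tens_mono[of 0]] by auto
  define q where "q x = (\<Sum>i\<in>degs p. c i * tens_mono i x)" for x
  have q: "q \<in> Qpoly p" unfolding q_def[abs_def] by (intro Qpoly_sum Qpoly_cmult tens_mono_in_Qpoly)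
  have o: "(LINT x:?T|lborel. (v x - q x) * w x) = 0" if w: "w \<in> Qpoly p" for w
  proof -
    obtain e where e: "w = (\<lambda>x. \<Sum>j\<in>degs p. e j * tens_mono j x)" using w by (auto simp: Qpoly_iff)
    have i: "set_integrable lborel ?T (\<lambda>x. (v x - q x) * tens_mono j x)" if "j \<in> degs p" for j
      using set_integral_diff(1)[OF vi[OF tens_mono_in_Qpoly[OF that]] Qpoly_cell_integrable[OF q tens_mono_in_Qpoly[OF that]]]
      by (simp add: left_diff_distrib)
    have "(LINT x:?T|lborel. (v x - q x) * w x) = (LINT x|lborel. (\<Sum>j\<in>degs p. e j * (indicator ?T x *\<^sub>R ((v x - q x) * tens_mono j x))))"
      unfolding set_lebesgue_integral_def e by (simp add: sum_distrib_left mult_ac)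
    also have "\<dots> = (\<Sum>j\<in>degs p. e j * (LINT x:?T|lborel. (v x - q x) * tens_mono j x))"
      using i unfolding set_lebesgue_integral_def set_integrable_def
      by (subst Bochner_Integration.integral_sum) auto
    finally show ?thesis using c by (simp add: q_def)
  qed
  have P: "L2_proj p ?T v = q" by (rule L2_proj_eqI[OF h q o vi])
  show "L2_proj p ?T v \<in> Qpoly p" using P q by simp
  show "w \<in> Qpoly p \<Longrightarrow> (LINT x:?T|lborel. (v x - L2_proj p ?T v x) * w x) = 0" using P o by simp
qed

text \<open>Pythagoras: \<open>v - q\<close> is the sum of the residual of the projection and a
  polynomial, which are orthogonal. As projections fix \<open>q\<close>, this is the stability
  estimate in the form in which it is used.\<close>

lemma L2_proj_best:
  assumes h: "h > 0" and v: "v \<in> borel_measurable borel" "set_integrable lborel (cell h a z) (\<lambda>x. (v x)\<^sup>2)"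
    and q: "q \<in> Qpoly p"
  shows "l2sq (cell h a z) (\<lambda>x. L2_proj p (cell h a z) v x - q x) \<le> l2sq (cell h a z) (\<lambda>x. v x - q x)"
proof -
  let ?T = "cell h a z"
  define P where "P = L2_proj p ?T v"
  note PQ = L2_proj_facts[OF h v, where p = p, folded P_def]
  define d where "d x = P x - q x" for x
  define r where "r x = v x - P x" for x
  have d: "d \<in> Qpoly p" unfolding d_def by (intro Qpoly_diff PQ q)
  note [measurable] = v(1) Qpoly_measurable[OF PQ(1)] Qpoly_measurable[OF q] Qpoly_measurable[OF d]
  have vi: "set_integrable lborel ?T (\<lambda>x. v x * w x)" if "w \<in> Qpoly p" for w
    using Qpoly_cell_integrable[OF that that] by (intro L2_on_mult_integrable v Qpoly_measurable[OF that]) (auto simp: power2_eq_square)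
  have i1: "integrable lborel (\<lambda>x. indicator ?T x * (r x * d x))"
    using set_integral_diff(1)[OF vi[OF d] Qpoly_cell_integrable[OF PQ(1) d]] by (simp add: r_def left_diff_distrib set_integrable_def)
  have i2: "integrable lborel (\<lambda>x. indicator ?T x * (d x)\<^sup>2)"
    using Qpoly_cell_integrable[OF d d] by (simp add: set_integrable_def power2_eq_square)
  have i3: "integrable lborel (\<lambda>x. indicator ?T x * (v x - q x)\<^sup>2)"
  proof -
    have "set_integrable lborel ?T (\<lambda>x. (v x)\<^sup>2 - 2 * (v x * q x) + q x * q x)"
      by (intro set_integral_add set_integral_diff set_integrable_mult_right v vi[OF q] Qpoly_cell_integrable[OF q q])
    moreover have "(v x - q x)\<^sup>2 = (v x)\<^sup>2 - 2 * (v x * q x) + q x * q x" for x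
      by (simp add: power2_eq_square algebra_simps)
    ultimately show ?thesis by (simp add: set_integrable_def)
  qed
  have o: "(LINT x|lborel. indicator ?T x * (r x * d x)) = 0"
    using PQ(2)[OF d] by (simp add: set_lebesgue_integral_def r_def)
  have "(LINT x|lborel. indicator ?T x * (d x)\<^sup>2) = (LINT x|lborel. indicator ?T x * (d x)\<^sup>2 + 2 * (indicator ?T x * (r x * d x)))"
    using i1 i2 o by simp
  also have "\<dots> \<le> (LINT x|lborel. indicator ?T x * (v x - q x)\<^sup>2)"
  proof (rule integral_mono)
    show "integrable lborel (\<lambda>x. indicator ?T x * (d x)\<^sup>2 + 2 * (indicator ?T x * (r x * d x)))" using i1 i2 by simp
    fix x
    have "(v x - q x)\<^sup>2 = (d x)\<^sup>2 + 2 * (r x * d x) + (r x)\<^sup>2"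
      by (simp add: d_def r_def power2_eq_square algebra_simps)
    then show "indicator ?T x * (d x)\<^sup>2 + 2 * (indicator ?T x * (r x * d x)) \<le> indicator ?T x * (v x - q x)\<^sup>2"
      by (auto split: split_indicator)
  qed (rule i3)
  finally have le: "ennreal (LINT x|lborel. indicator ?T x * (d x)\<^sup>2) \<le> ennreal (LINT x|lborel. indicator ?T x * (v x - q x)\<^sup>2)"
    by (rule ennreal_leI)
  have conv: "l2sq ?T f = ennreal (LINT x|lborel. indicator ?T x * (f x)\<^sup>2)" if "integrable lborel (\<lambda>x. indicator ?T x * (f x)\<^sup>2)" for f
  proof -
    have "l2sq ?T f = (\<integral>\<^sup>+x. ennreal (indicator ?T x * (f x)\<^sup>2) \<partial>lborel)"
      unfolding l2sq_def by (intro nn_integral_cong) (auto split: split_indicator)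
    also have "\<dots> = ennreal (LINT x|lborel. indicator ?T x * (f x)\<^sup>2)" by (rule nn_integral_eq_integral[OF that]) auto
    finally show ?thesis .
  qed
  show ?thesis using le conv[OF i2] conv[OF i3] by (simp add: d_def P_def)
qed

text \<open>Only the interior of the cell matters, its boundary being a null set. The value 0 there
  is the one that \<open>disc_ext\<close> takes, and it makes the products integrable over the
  closed cell.\<close>

lemma L2_proj_of_poly:
  assumes h: "h > 0" and g: "g \<in> Qpoly p" and vg: "\<And>x. x \<in> interior (cell h a z) \<Longrightarrow> v x = g x"
    and v0: "\<And>x. x \<in> cell h a z - interior (cell h a z) \<Longrightarrow> v x = 0"
  shows "L2_proj p (cell h a z) v = g"
proof (rule L2_proj_eqI[OF h g])
  let ?T = "cell h a z"
  fix w :: "real^'a \<Rightarrow> real" assume w: "w \<in> Qpoly p"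
  have "AE x in lborel. indicator ?T x *\<^sub>R ((v x - g x) * w x) = 0"
    using null_boundary_cell[of h a z] by eventually_elim (use vg in \<open>auto split: split_indicator\<close>)
  then show "(LINT x:?T|lborel. (v x - g x) * w x) = 0"
    unfolding set_lebesgue_integral_def by (rule integral_eq_zero_AE)
  have "set_integrable lborel (interior ?T) (\<lambda>x. g x * w x)"
    by (rule set_integrable_subset[OF Qpoly_cell_integrable[OF g w, of h a z]]) (auto simp: interior_subset)
  moreover have "indicator (interior ?T) x *\<^sub>R (g x * w x) = indicator ?T x *\<^sub>R (v x * w x)" for x
    using vg[of x] v0[of x] interior_subset[of ?T] by (auto split: split_indicator)
  ultimately show "set_integrable lborel ?T (\<lambda>x. v x * w x)" by (simp only: set_integrable_def)
qed

section \<open>Stable local spline bases\<close>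

text \<open>One mesh with one basis. The bounds proved in this context are explicit in
  \<open>C1\<close>, \<open>c2\<close> and \<open>C2\<close>, so the final constant can be chosen
  before \<open>h\<close>, \<open>a\<close> and the basis are given.\<close>

locale spline_basis =
  fixes p k N :: nat and h C1 c2 C2 :: real and a :: "real^'n" and I :: "'i set" and \<phi> :: "'i \<Rightarrow> real^'n \<Rightarrow> real"
  assumes h: "h > 0" and c2: "c2 > 0"
    and basis: "is_basis (spline_space p k h a) I \<phi>"
    and local_supp: "local_support N C1 h a I \<phi>"
    and stable: "stable_local_basis p c2 C2 h a I \<phi>"
begin

abbreviation T :: "int^'n \<Rightarrow> (real^'n) set" where "T \<equiv> cell h a"

definition J :: "int^'n \<Rightarrow> 'i set" where "J z = {i \<in> I. T z \<subseteq> supp (\<phi> i)}"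

lemma T_mesh: "T z \<in> uniform_mesh h a"
  by (simp add: uniform_mesh_cell)

lemma J_I: "i \<in> J z \<Longrightarrow> i \<in> I"
  by (simp add: J_def)

lemma phi_Ck: "i \<in> I \<Longrightarrow> Ck k (\<phi> i)"
  using basis by (auto simp: is_basis_def spline_space_def)

lemma phi_poly: "i \<in> I \<Longrightarrow> \<exists>q\<in>Qpoly p. \<forall>x\<in>T z. \<phi> i x = q x"
  using basis T_mesh[of z] unfolding is_basis_def spline_space_def by blast

lemma stable_cell:
  "finite (J z) \<and>
   (\<forall>q \<in> Qpoly p. \<exists>c. \<forall>x\<in>T z. q x = (\<Sum>i\<in>J z. c i * \<phi> i x)) \<and>
   (\<forall>c. (\<forall>x\<in>T z. (\<Sum>i\<in>J z. c i * \<phi> i x) = 0) \<longrightarrow> (\<forall>i\<in>J z. c i = 0)) \<and>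
   (\<forall>c. c2 * (h ^ CARD('n) * (\<Sum>i\<in>J z. (c i)\<^sup>2)) \<le> (LINT x:T z|lborel. (\<Sum>i\<in>J z. c i * \<phi> i x)\<^sup>2) \<and>
      (LINT x:T z|lborel. (\<Sum>i\<in>J z. c i * \<phi> i x)\<^sup>2) \<le> C2 * (h ^ CARD('n) * (\<Sum>i\<in>J z. (c i)\<^sup>2)))"
  using bspec[OF stable[unfolded stable_local_basis_def] T_mesh[of z]] unfolding Let_def J_def .

lemma finite_J [simp]: "finite (J z)"
  using stable_cell by simp

lemma J_indep:
  assumes "\<And>x. x \<in> T z \<Longrightarrow> (\<Sum>i\<in>J z. c i * \<phi> i x) = 0" "i \<in> J z"
  shows "c i = 0"
proof -
  have "(\<forall>x\<in>T z. (\<Sum>i\<in>J z. c i * \<phi> i x) = 0) \<longrightarrow> (\<forall>i\<in>J z. c i = 0)"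
    using stable_cell[of z] by (elim conjE allE[of _ c])
  then show ?thesis using assms by simp
qed

lemma J_span: "q \<in> Qpoly p \<Longrightarrow> \<exists>c. \<forall>x\<in>T z. q x = (\<Sum>i\<in>J z. c i * \<phi> i x)"
  using stable_cell[of z] by (elim conjE bspec)

text \<open>If the cell were not contained in the support, the basis function would vanish on a
  nonempty open part of it; being a polynomial on the cell, it would vanish on all of it. Hence the
  functions in \<open>J z\<close> alone determine a combination on the cell.\<close>

lemma phi_nonzero_J:
  assumes i: "i \<in> I" and x: "x \<in> T z" "\<phi> i x \<noteq> 0"
  shows "i \<in> J z"
proof -
  obtain q where q: "q \<in> Qpoly p" "\<And>x. x \<in> T z \<Longrightarrow> \<phi> i x = q x" using phi_poly[OF i] by blast
  have "T z \<subseteq> supp (\<phi> i)"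
  proof (rule ccontr)
    assume "\<not> ?thesis"
    then obtain y where y: "y \<in> T z" "y \<notin> supp (\<phi> i)" by blast
    \<comment> \<open>The point outside the support may lie on the boundary of the cell; as the cell
      is the closure of its interior, the open complement of the support also meets the
      interior.\<close>
    have "closure (interior (T z)) = closure (T z)"
      using interior_cell_nonempty[OF h, of a z] by (intro convex_closure_interior) (auto simp: cell_def)
    then have "y \<in> closure (interior (T z))" using y(1) closure_subset by auto
    moreover have op: "open (- supp (\<phi> i))" unfolding supp_def by (rule open_Compl[OF closed_closure])
    ultimately have "- supp (\<phi> i) \<inter> interior (T z) \<noteq> {}"
      using y(2) open_Int_closure_eq_empty[OF op, of "interior (T z)"] by auto
    then obtain w where w: "w \<in> - supp (\<phi> i) \<inter> interior (T z)" by blast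
    have "q = (\<lambda>x. 0)"
    proof (rule Qpoly_eq_on_open[OF open_Int[OF op open_interior] w q(1) Qpoly_zero])
      fix y assume "y \<in> - supp (\<phi> i) \<inter> interior (T z)"
      then show "q y = 0" using q(2)[of y] zero_outside_supp[of y "\<phi> i"] interior_subset by auto
    qed
    then show False using q(2)[OF x(1)] x(2) by simp
  qed
  then show ?thesis using i by (simp add: J_def)
qed

lemma basis_comb_cell:
  assumes A: "A \<subseteq> I" and x: "x \<in> T z"
  shows "basis_comb A \<phi> c x = (\<Sum>i\<in>J z \<inter> A. c i * \<phi> i x)"
  unfolding basis_comb_def
proof (rule sum.mono_neutral_left)
  show "{i \<in> A. \<phi> i x \<noteq> 0} \<subseteq> J z \<inter> A" using A phi_nonzero_J[OF _ x] by auto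
qed auto

lemma comb_poly: "F \<subseteq> I \<Longrightarrow> \<exists>q\<in>Qpoly p. \<forall>x\<in>T z. (\<Sum>i\<in>F. c i * \<phi> i x) = q x"
proof -
  assume F: "F \<subseteq> I"
  then have "\<forall>i\<in>F. \<exists>q. q \<in> Qpoly p \<and> (\<forall>x\<in>T z. \<phi> i x = q x)" using phi_poly by blast
  then obtain q where q: "\<And>i. i \<in> F \<Longrightarrow> q i \<in> Qpoly p" "\<And>i x. i \<in> F \<Longrightarrow> x \<in> T z \<Longrightarrow> \<phi> i x = q i x"
    using bchoice[of F "\<lambda>i q. q \<in> Qpoly p \<and> (\<forall>x\<in>T z. \<phi> i x = q x)"] by blast
  have "(\<lambda>x. \<Sum>i\<in>F. c i * q i x) \<in> Qpoly p" by (intro Qpoly_sum Qpoly_cmult q)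
  then show ?thesis by (rule bexI[rotated]) (use q(2) in simp)
qed

text \<open>A cell that meets the ball of radius \<open>h\<close> around \<open>x\<close> has
  \<open>x\<close> in its patch of radius 1. There are finitely many such cells, so the combination
  is a finite sum on that ball.\<close>

lemma basis_comb_Ck:
  assumes A: "A \<subseteq> I"
  shows "Ck k (basis_comb A \<phi> c)"
proof (rule Ck_local)
  fix x :: "real^'n"
  define Z where "Z = {z. x \<in> patch 1 h a z}"
  have finZ: "finite Z" unfolding Z_def by (rule patch_overlap(1)[OF h])
  define F where "F = (\<Union>z\<in>Z. J z) \<inter> A"
  have finF: "finite F" using finZ by (simp add: F_def)
  have "basis_comb A \<phi> c y = (\<Sum>i\<in>F. c i * \<phi> i y)" if y: "y \<in> ball x h" for y
  proof -
    obtain z where z: "y \<in> T z" using cell_cover[OF h] by blast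
    have "x \<in> patch 1 h a z"
      unfolding patch_def mem_cube
    proof
      fix i
      have "\<bar>(x - y) $ i\<bar> < h" using y component_le_norm_cart[of "x - y" i] by (simp add: dist_norm)
      moreover have "a $ i + h * of_int (z $ i) \<le> y $ i" "y $ i \<le> a $ i + h * (of_int (z $ i) + 1)" using z by (auto simp: mem_cell)
      ultimately show "(\<chi> i. a $ i + h * (of_int (z $ i) - real 1)) $ i \<le> x $ i \<and>
        x $ i \<le> (\<chi> i. a $ i + h * (of_int (z $ i) - real 1)) $ i + (2 * real 1 + 1) * h"
        by (simp add: algebra_simps abs_less_iff)
    qed
    then have zZ: "z \<in> Z" by (simp add: Z_def)
    show ?thesis unfolding basis_comb_def
    proof (rule sum.mono_neutral_left[OF finF])
      show "{i \<in> A. \<phi> i y \<noteq> 0} \<subseteq> F" using A phi_nonzero_J[OF _ z] zZ by (auto simp: F_def)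
    qed (auto simp: F_def)
  qed
  moreover have "Ck k (\<lambda>y. \<Sum>i\<in>F. c i * \<phi> i y)"
    using A by (intro Ck_sum Ck_cmult phi_Ck) (auto simp: F_def)
  ultimately show "\<exists>U g. open U \<and> x \<in> U \<and> Ck k g \<and> (\<forall>y\<in>U. basis_comb A \<phi> c y = g y)"
    using h by (intro exI[of _ "ball x h"] exI[of _ "\<lambda>y. \<Sum>i\<in>F. c i * \<phi> i y"]) (auto simp del: Ck.simps)
qed

text \<open>On the cell the combination is a polynomial, which is continuous, so the Lebesgue
  integral in the stability condition is also the \<open>ennreal\<close> norm. The absolute value of
  \<open>C2\<close> provides a constant known to be nonnegative.\<close>

lemma stable_bounds:
  assumes f: "\<And>x. x \<in> T z \<Longrightarrow> f x = (\<Sum>i\<in>J z. c i * \<phi> i x)"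
  shows "ennreal (c2 * (h ^ CARD('n) * (\<Sum>i\<in>J z. (c i)\<^sup>2))) \<le> l2sq (T z) f"
    and "l2sq (T z) f \<le> ennreal (\<bar>C2\<bar> * (h ^ CARD('n) * (\<Sum>i\<in>J z. (c i)\<^sup>2)))"
proof -
  let ?L = "LINT x:T z|lborel. (\<Sum>i\<in>J z. c i * \<phi> i x)\<^sup>2" and ?X = "h ^ CARD('n) * (\<Sum>i\<in>J z. (c i)\<^sup>2)"
  have st: "c2 * ?X \<le> ?L" "?L \<le> C2 * ?X"
    using stable_cell[of z, THEN conjunct2, THEN conjunct2, THEN conjunct2, rule_format, of c] by simp_all
  obtain q where q: "q \<in> Qpoly p" "\<And>x. x \<in> T z \<Longrightarrow> (\<Sum>i\<in>J z. c i * \<phi> i x) = q x"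
    using comb_poly[of "J z" z c] J_I by blast
  have "l2sq (T z) f = l2sq (T z) q" using f q(2) by (intro l2sq_cong) simp
  also have "\<dots> = ennreal (LINT x:T z|lborel. (q x)\<^sup>2)" by (rule l2sq_continuous[OF Qpoly_continuous[OF q(1)]]) simp
  also have "(LINT x:T z|lborel. (q x)\<^sup>2) = ?L"
    by (rule set_lebesgue_integral_cong) (auto simp: q(2))
  finally have e: "l2sq (T z) f = ennreal ?L" .
  show "ennreal (c2 * ?X) \<le> l2sq (T z) f" unfolding e by (rule ennreal_leI[OF st(1)])
  have "C2 * ?X \<le> \<bar>C2\<bar> * ?X" using h by (intro mult_right_mono) (auto intro!: mult_nonneg_nonneg sum_nonneg)
  with st(2) show "l2sq (T z) f \<le> ennreal (\<bar>C2\<bar> * ?X)" unfolding e by (intro ennreal_leI) linarith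
qed

text \<open>The coefficients \<open>c\<close> are chosen before the cell: the expansion comes from
  the global basis of the spline space, and not from the separate local bases.\<close>

lemma Qpoly_coeffs:
  assumes q: "q \<in> Qpoly p"
  shows "\<exists>c. \<forall>z. \<forall>x\<in>T z. q x = (\<Sum>i\<in>J z. c i * \<phi> i x)"
proof -
  have "q \<in> spline_space p k h a" using q Ck_Qpoly[OF q, of k] by (auto simp: spline_space_def)
  then obtain c where c: "q = basis_comb I \<phi> c" using basis by (auto simp: is_basis_def)
  have "q x = (\<Sum>i\<in>J z. c i * \<phi> i x)" if "x \<in> T z" for x z
  proof -
    have "J z \<inter> I = J z" using J_I by blast
    then show ?thesis unfolding c using basis_comb_cell[OF order_refl that, of c] by simp
  qed
  then show ?thesis by blast
qed

end

section \<open>The interpolation and extension operators\<close>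

context spline_basis
begin

lemma active_index_subset: "active_index Th I \<phi> \<subseteq> I"
  by (auto simp: active_index_def)

lemma J_subset_active: "z \<in> Z \<Longrightarrow> J z \<subseteq> active_index (T ` Z) I \<phi>"
  by (auto simp: J_def active_index_def)

lemma local_index_eq_J: "z \<in> Z \<Longrightarrow> local_index (T ` Z) I \<phi> (T z) = J z"
  by (auto simp: local_index_def active_index_def J_def)

lemma T_inj: "inj_on T A"
  by (simp add: inj_on_def cell_inj[OF h])

lemma sum_local_elements:
  "(\<Sum>S\<in>local_elements (T ` Z) \<phi> i. f S) = (\<Sum>z | z \<in> Z \<and> T z \<subseteq> supp (\<phi> i). f (T z))"
proof -
  have "local_elements (T ` Z) \<phi> i = T ` {z \<in> Z. T z \<subseteq> supp (\<phi> i)}" by (auto simp: local_elements_def)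
  then show ?thesis by (simp add: sum.reindex[OF T_inj])
qed

text \<open>The cells whose local coefficients can influence a weighted combination on the cell
  \<open>z\<close>, because the support of some basis function contains both cells.\<close>

definition Nb :: "(int^'n) set \<Rightarrow> int^'n \<Rightarrow> (int^'n) set" where
  "Nb Z z = {z' \<in> Z. \<exists>i\<in>J z. T z' \<subseteq> supp (\<phi> i)}"

lemma Nb_close: "z' \<in> Nb Z z \<Longrightarrow> \<bar>z' $ j - z $ j\<bar> \<le> int (nat \<lceil>C1\<rceil>)"
proof -
  assume "z' \<in> Nb Z z"
  then obtain i where i: "i \<in> I" "T z \<subseteq> supp (\<phi> i)" "T z' \<subseteq> supp (\<phi> i)" by (auto simp: Nb_def J_def)
  show ?thesis
    using local_supp i(1) by (intro cells_close[OF h i(3,2)]) (auto simp: local_support_def)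
qed

lemma Nb_finite_card: "finite (Nb Z z)" "card (Nb Z z) \<le> (2 * nat \<lceil>C1\<rceil> + 1) ^ CARD('n)"
proof -
  let ?R = "nat \<lceil>C1\<rceil>"
  have aux: "y - int R \<le> x \<and> x \<le> y - int R + int (2 * R)" if "\<bar>x - y\<bar> \<le> int R" for x y R
    using that by (auto simp: abs_le_iff)
  have sub: "Nb Z z \<subseteq> {z'. \<forall>i. z $ i - int ?R \<le> z' $ i \<and> z' $ i \<le> z $ i - int ?R + int (2 * ?R)}"
  proof
    fix z' assume "z' \<in> Nb Z z"
    then have "\<bar>z' $ i - z $ i\<bar> \<le> int ?R" for i by (rule Nb_close)
    then have "z $ i - int ?R \<le> z' $ i \<and> z' $ i \<le> z $ i - int ?R + int (2 * ?R)" for i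
      by (rule aux)
    then show "z' \<in> {z'. \<forall>i. z $ i - int ?R \<le> z' $ i \<and> z' $ i \<le> z $ i - int ?R + int (2 * ?R)}" by blast
  qed
  note B = card_int_box[of "\<lambda>i. z $ i - int ?R" "2 * ?R"]
  show "finite (Nb Z z)" by (rule finite_subset[OF sub B(1)])
  show "card (Nb Z z) \<le> (2 * ?R + 1) ^ CARD('n)" using card_mono[OF B(1) sub] B(2) by (rule order_trans)
qed

text \<open>The local coefficients \<open>b\<close> are arbitrary, so this covers both the
  interpolant of a function and that of the discontinuous extension. As \<open>q\<close> has the
  same coefficients on all cells and the weights have sum 1, the error coefficients are weighted
  means of \<open>b - c\<close>; stability translates between coefficients and norms on both
  sides.\<close>

lemma quasi_interpolation_bound:
  assumes \<kappa>: "interp_weights (T ` Z) I \<phi> \<kappa>" and z: "z \<in> Z" and q: "q \<in> Qpoly p"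
    and g: "\<And>z' x. z' \<in> Z \<Longrightarrow> x \<in> T z' \<Longrightarrow> g z' x = (\<Sum>i\<in>J z'. b (T z') i * \<phi> i x)"
  shows "l2sq (T z) (\<lambda>x. basis_comb (active_index (T ` Z) I \<phi>) \<phi> (\<lambda>i. \<Sum>S\<in>local_elements (T ` Z) \<phi> i. \<kappa> S i * b S i) x - q x)
    \<le> ennreal (\<bar>C2\<bar> / c2) * (\<Sum>z'\<in>Nb Z z. l2sq (T z') (\<lambda>x. g z' x - q x))"
proof -
  let ?A = "active_index (T ` Z) I \<phi>"
  let ?L = "\<lambda>i. {z' \<in> Z. T z' \<subseteq> supp (\<phi> i)}"
  obtain c where c: "\<And>z x. x \<in> T z \<Longrightarrow> q x = (\<Sum>i\<in>J z. c i * \<phi> i x)" using Qpoly_coeffs[OF q] by blast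
  define e where "e i = (\<Sum>z'\<in>?L i. \<kappa> (T z') i * (b (T z') i - c i))" for i
  define Y where "Y z' i = (b (T z') i - c i)\<^sup>2" for z' i
  have JA: "J z \<inter> ?A = J z" using J_subset_active[OF z] by blast
  have wts: "(\<Sum>z'\<in>?L i. \<kappa> (T z') i) = 1" "\<And>z'. z' \<in> ?L i \<Longrightarrow> 0 \<le> \<kappa> (T z') i \<and> \<kappa> (T z') i \<le> 1" if "i \<in> J z" for i
  proof -
    have "i \<in> ?A" using that JA by blast
    then have k: "\<forall>S\<in>local_elements (T ` Z) \<phi> i. 0 \<le> \<kappa> S i \<and> \<kappa> S i \<le> 1" "(\<Sum>S\<in>local_elements (T ` Z) \<phi> i. \<kappa> S i) = 1"
      using \<kappa> by (auto simp: interp_weights_def)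
    show "(\<Sum>z'\<in>?L i. \<kappa> (T z') i) = 1" using k(2) by (simp add: sum_local_elements)
    show "0 \<le> \<kappa> (T z') i \<and> \<kappa> (T z') i \<le> 1" if "z' \<in> ?L i" for z' using k(1) that by (auto simp: local_elements_def)
  qed
  have fe: "basis_comb ?A \<phi> (\<lambda>i. \<Sum>S\<in>local_elements (T ` Z) \<phi> i. \<kappa> S i * b S i) x - q x = (\<Sum>i\<in>J z. e i * \<phi> i x)"
    if x: "x \<in> T z" for x
  proof -
    have "e i = (\<Sum>S\<in>local_elements (T ` Z) \<phi> i. \<kappa> S i * b S i) - c i" if "i \<in> J z" for i
      using wts(1)[OF that] unfolding e_def sum_local_elements
      by (simp add: right_diff_distrib sum_subtractf sum_distrib_right[symmetric])
    then have "(\<Sum>i\<in>J z. e i * \<phi> i x) = (\<Sum>i\<in>J z. (\<Sum>S\<in>local_elements (T ` Z) \<phi> i. \<kappa> S i * b S i) * \<phi> i x) - (\<Sum>i\<in>J z. c i * \<phi> i x)"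
      by (simp add: left_diff_distrib sum_subtractf)
    then show ?thesis using c[OF x] basis_comb_cell[OF active_index_subset x] JA by simp
  qed
  \<comment> \<open>Cauchy-Schwarz, together with the fact that squares of weights in the unit
    interval are at most the weights, whose sum is 1; no factor for the size of the support
    arises.\<close>
  have e2: "(e i)\<^sup>2 \<le> (\<Sum>z'\<in>?L i. Y z' i)" if i: "i \<in> J z" for i
  proof -
    have "(e i)\<^sup>2 \<le> (\<Sum>z'\<in>?L i. (\<kappa> (T z') i)\<^sup>2) * (\<Sum>z'\<in>?L i. (b (T z') i - c i)\<^sup>2)"
      unfolding e_def by (rule Cauchy_Schwarz_ineq_sum)
    also have "\<dots> \<le> 1 * (\<Sum>z'\<in>?L i. (b (T z') i - c i)\<^sup>2)"
    proof (rule mult_right_mono)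
      have "(\<Sum>z'\<in>?L i. (\<kappa> (T z') i)\<^sup>2) \<le> (\<Sum>z'\<in>?L i. \<kappa> (T z') i)"
        using wts(2)[OF i] by (intro sum_mono) (auto simp: power2_eq_square mult_left_le)
      then show "(\<Sum>z'\<in>?L i. (\<kappa> (T z') i)\<^sup>2) \<le> 1" using wts(1)[OF i] by simp
    qed (auto intro: sum_nonneg)
    finally show ?thesis by (simp add: Y_def)
  qed
  have Yn: "Y z' i \<ge> 0" for z' i by (simp add: Y_def)
  \<comment> \<open>The double sum is reordered by cells: an index \<open>i\<close> of
    \<open>J z\<close> whose support contains the cell \<open>z'\<close> also belongs to
    \<open>J z'\<close>, so the inner sum extends to the full set of local coefficients on
    \<open>z'\<close>.\<close>
  have "(\<Sum>i\<in>J z. (e i)\<^sup>2) \<le> (\<Sum>i\<in>J z. \<Sum>z'\<in>?L i. Y z' i)" by (intro sum_mono e2)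
  also have "\<dots> = (\<Sum>i\<in>J z. \<Sum>z'\<in>Nb Z z. if T z' \<subseteq> supp (\<phi> i) then Y z' i else 0)"
  proof (rule sum.cong[OF refl])
    fix i assume i: "i \<in> J z"
    have "?L i = {z' \<in> Nb Z z. T z' \<subseteq> supp (\<phi> i)}" using i by (auto simp: Nb_def)
    then show "(\<Sum>z'\<in>?L i. Y z' i) = (\<Sum>z'\<in>Nb Z z. if T z' \<subseteq> supp (\<phi> i) then Y z' i else 0)"
      using sum.inter_filter[OF Nb_finite_card(1)[of Z z], of "\<lambda>z'. Y z' i" "\<lambda>z'. T z' \<subseteq> supp (\<phi> i)"] by simp
  qed
  also have "\<dots> = (\<Sum>z'\<in>Nb Z z. \<Sum>i\<in>J z. if T z' \<subseteq> supp (\<phi> i) then Y z' i else 0)" by (rule sum.swap)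
  also have "\<dots> \<le> (\<Sum>z'\<in>Nb Z z. \<Sum>i\<in>J z'. Y z' i)"
  proof (rule sum_mono)
    fix z'
    have "(\<Sum>i\<in>J z. if T z' \<subseteq> supp (\<phi> i) then Y z' i else 0) = (\<Sum>i\<in>{i \<in> J z. T z' \<subseteq> supp (\<phi> i)}. Y z' i)"
      by (rule sum.inter_filter[symmetric]) simp
    also have "\<dots> \<le> (\<Sum>i\<in>J z'. Y z' i)" using Yn by (intro sum_mono2 finite_J) (auto simp: J_def)
    finally show "(\<Sum>i\<in>J z. if T z' \<subseteq> supp (\<phi> i) then Y z' i else 0) \<le> (\<Sum>i\<in>J z'. Y z' i)" .
  qed
  finally have sumle: "(\<Sum>i\<in>J z. (e i)\<^sup>2) \<le> (\<Sum>z'\<in>Nb Z z. \<Sum>i\<in>J z'. Y z' i)" .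
  have hp: "0 < h ^ CARD('n)" using h by simp
  have "l2sq (T z) (\<lambda>x. basis_comb ?A \<phi> (\<lambda>i. \<Sum>S\<in>local_elements (T ` Z) \<phi> i. \<kappa> S i * b S i) x - q x)
     \<le> ennreal (\<bar>C2\<bar> * (h ^ CARD('n) * (\<Sum>i\<in>J z. (e i)\<^sup>2)))"
    by (rule stable_bounds(2)) (rule fe)
  also have "\<dots> \<le> ennreal (\<bar>C2\<bar> * (h ^ CARD('n) * (\<Sum>z'\<in>Nb Z z. \<Sum>i\<in>J z'. Y z' i)))"
    using sumle hp by (intro ennreal_leI mult_left_mono) auto
  also have "\<bar>C2\<bar> * (h ^ CARD('n) * (\<Sum>z'\<in>Nb Z z. \<Sum>i\<in>J z'. Y z' i))
      = \<bar>C2\<bar> / c2 * (\<Sum>z'\<in>Nb Z z. c2 * (h ^ CARD('n) * (\<Sum>i\<in>J z'. Y z' i)))"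
    using c2 by (simp add: sum_distrib_left[symmetric])
  also have "ennreal \<dots> = ennreal (\<bar>C2\<bar> / c2) * ennreal (\<Sum>z'\<in>Nb Z z. c2 * (h ^ CARD('n) * (\<Sum>i\<in>J z'. Y z' i)))"
    using c2 by (intro ennreal_mult') simp
  also have "ennreal (\<Sum>z'\<in>Nb Z z. c2 * (h ^ CARD('n) * (\<Sum>i\<in>J z'. Y z' i))) = (\<Sum>z'\<in>Nb Z z. ennreal (c2 * (h ^ CARD('n) * (\<Sum>i\<in>J z'. Y z' i))))"
    using c2 hp Yn by (intro sum_ennreal[symmetric]) (auto intro!: mult_nonneg_nonneg sum_nonneg)
  also have "ennreal (\<bar>C2\<bar> / c2) * (\<Sum>z'\<in>Nb Z z. ennreal (c2 * (h ^ CARD('n) * (\<Sum>i\<in>J z'. Y z' i))))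
    \<le> ennreal (\<bar>C2\<bar> / c2) * (\<Sum>z'\<in>Nb Z z. l2sq (T z') (\<lambda>x. g z' x - q x))"
  proof (intro mult_left_mono sum_mono)
    fix z' assume "z' \<in> Nb Z z"
    then have z': "z' \<in> Z" by (simp add: Nb_def)
    show "ennreal (c2 * (h ^ CARD('n) * (\<Sum>i\<in>J z'. Y z' i))) \<le> l2sq (T z') (\<lambda>x. g z' x - q x)"
      unfolding Y_def
    proof (rule stable_bounds(1))
      fix x assume x: "x \<in> T z'"
      show "g z' x - q x = (\<Sum>i\<in>J z'. (b (T z') i - c i) * \<phi> i x)"
        using g[OF z' x] c[OF x] by (simp add: left_diff_distrib sum_subtractf)
    qed
  qed simp
  finally show ?thesis .
qed

text \<open>The definite description in \<open>local_coeff\<close> is legitimate: the local basis is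
  linearly independent, and the values outside \<open>J z\<close> are fixed to 0.\<close>

lemma local_coeff_expansion:
  assumes z: "z \<in> Z" and P: "L2_proj p (T z) v \<in> Qpoly p" and x: "x \<in> T z"
  shows "L2_proj p (T z) v x = (\<Sum>i\<in>J z. local_coeff p (T ` Z) I \<phi> (T z) v i * \<phi> i x)"
proof -
  let ?P = "\<lambda>c. (\<forall>i. i \<notin> J z \<longrightarrow> c i = 0) \<and> (\<forall>x\<in>T z. L2_proj p (T z) v x = (\<Sum>i\<in>J z. c i * \<phi> i x))"
  obtain c where c: "\<And>x. x \<in> T z \<Longrightarrow> L2_proj p (T z) v x = (\<Sum>i\<in>J z. c i * \<phi> i x)" using J_span[OF P] by blast
  have ex: "?P (\<lambda>i. if i \<in> J z then c i else 0)" using c by simp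
  have "?P (THE c. ?P c)"
  proof (rule theI[of ?P, OF ex])
    fix c' assume c': "?P c'"
    show "c' = (\<lambda>i. if i \<in> J z then c i else 0)"
    proof
      fix i
      show "c' i = (if i \<in> J z then c i else 0)"
      proof (cases "i \<in> J z")
        case True
        have "c' i - c i = 0"
        proof (rule J_indep[of z "\<lambda>i. c' i - c i"])
          fix x assume x: "x \<in> T z"
          have "L2_proj p (T z) v x = (\<Sum>i\<in>J z. c' i * \<phi> i x)" using c' x by blast
          then have "(\<Sum>i\<in>J z. c' i * \<phi> i x) = (\<Sum>i\<in>J z. c i * \<phi> i x)" using c[OF x] by simp
          then show "(\<Sum>i\<in>J z. (c' i - c i) * \<phi> i x) = 0" by (simp add: left_diff_distrib sum_subtractf)
        qed (rule True)
        then show ?thesis using True by simp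
      qed (use c' in simp)
    qed
  qed
  then show ?thesis using x unfolding local_coeff_def local_index_eq_J[OF z] by blast
qed

lemma interp_poly: "\<exists>g\<in>Qpoly p. \<forall>x\<in>T z. interp p (T ` Z) I \<phi> \<kappa> v x = g x"
proof -
  let ?A = "active_index (T ` Z) I \<phi>"
  let ?c = "\<lambda>i. \<Sum>S\<in>local_elements (T ` Z) \<phi> i. \<kappa> S i * local_coeff p (T ` Z) I \<phi> S v i"
  have "J z \<inter> ?A \<subseteq> I" using active_index_subset by blast
  from comb_poly[OF this, of z ?c] obtain g where "g \<in> Qpoly p" "\<forall>x\<in>T z. (\<Sum>i\<in>J z \<inter> ?A. ?c i * \<phi> i x) = g x" by blast
  then show ?thesis unfolding interp_def using basis_comb_cell[OF active_index_subset, of _ z "T ` Z" ?c] by (intro bexI[of _ g]) auto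
qed

lemma Ck_interp: "Ck k (interp p Th I \<phi> \<kappa> v)"
  unfolding interp_def by (rule basis_comb_Ck[OF active_index_subset])

lemma interp_error:
  assumes \<kappa>: "interp_weights (T ` Z) I \<phi> \<kappa>" and z: "z \<in> Z" and q: "q \<in> Qpoly p"
    and P: "\<And>z'. z' \<in> Z \<Longrightarrow> L2_proj p (T z') v \<in> Qpoly p"
  shows "l2sq (T z) (\<lambda>x. interp p (T ` Z) I \<phi> \<kappa> v x - q x)
    \<le> ennreal (\<bar>C2\<bar> / c2) * (\<Sum>z'\<in>Nb Z z. l2sq (T z') (\<lambda>x. L2_proj p (T z') v x - q x))"
  unfolding interp_def
  by (rule quasi_interpolation_bound[OF \<kappa> z q]) (rule local_coeff_expansion[OF _ P])

section \<open>The discontinuous extension and its projection\<close>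

lemma poly_ext_facts:
  assumes g: "g \<in> Qpoly p" "\<And>x. x \<in> T z \<Longrightarrow> f x = g x"
  shows "poly_ext p (T z) f = g"
  unfolding poly_ext_def
proof (rule the_equality)
  show "g \<in> Qpoly p \<and> (\<forall>x\<in>T z. g x = f x)" using g by simp
  fix q assume q: "q \<in> Qpoly p \<and> (\<forall>x\<in>T z. q x = f x)"
  then show "q = g" using g interior_subset[of "T z"] by (intro Qpoly_eq_on_cell[OF h, of q p g a z]) auto
qed

lemma disc_ext_interior:
  assumes z: "z \<in> Z" and x: "x \<in> interior (T z)"
  shows "disc_ext p (T ` Z) TL S f x = (if T z \<in> TL then f x else poly_ext p (S (T z)) f x)"
proof -
  have the: "(THE S. S \<in> T ` Z \<and> x \<in> interior S) = T z"
  proof (rule the_equality)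
    show "T z \<in> T ` Z \<and> x \<in> interior (T z)" using z x by simp
    fix S assume "S \<in> T ` Z \<and> x \<in> interior S"
    then obtain z' where "S = T z'" "x \<in> interior (T z')" by blast
    then show "S = T z" using interior_cell_unique[OF h x, of z'] interior_subset by auto
  qed
  have "\<exists>S\<in>T ` Z. x \<in> interior S" using z x by blast
  then show ?thesis by (simp add: disc_ext_def the Let_def)
qed

lemma disc_ext_boundary:
  assumes x: "x \<in> T z - interior (T z)"
  shows "disc_ext p (T ` Z) TL S f x = 0"
proof -
  have "x \<notin> interior (T z')" for z'
  proof
    assume "x \<in> interior (T z')"
    then show False using interior_cell_unique[OF h, of x a z' z] x by auto
  qed
  then show ?thesis by (simp add: disc_ext_def)
qed

text \<open>In the interior of a cell the discontinuous extension is a single polynomial, which the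
  projection returns unchanged. The cell \<open>z'\<close> is where this polynomial comes from:
  \<open>z\<close> itself for a large cell, its image under \<open>S\<close> for a small
  one.\<close>

lemma L2_proj_disc_ext:
  assumes S: "element_map CS h (T ` Z) TL S" and TL: "TL \<subseteq> T ` Z" and z: "z \<in> Z"
    and f: "\<And>z. \<exists>g\<in>Qpoly p. \<forall>x\<in>T z. f x = g x"
  shows "\<exists>z'\<in>Z. \<exists>g\<in>Qpoly p. (\<forall>i. \<bar>z' $ i - z $ i\<bar> \<le> int (nat \<lceil>CS\<rceil>)) \<and> (\<forall>x\<in>T z'. f x = g x) \<and>
     L2_proj p (T z) (disc_ext p (T ` Z) TL S f) = g"
proof -
  obtain z' where z': "z' \<in> Z" "if T z \<in> TL then z' = z else S (T z) = T z'"
  proof (cases "T z \<in> TL")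
    case False
    then have "S (T z) \<in> TL" using S z by (auto simp: element_map_def)
    then obtain z' where "z' \<in> Z" "S (T z) = T z'" using TL by blast
    then show ?thesis using that False by simp
  qed (use that z in simp)
  obtain g where g: "g \<in> Qpoly p" "\<And>x. x \<in> T z' \<Longrightarrow> f x = g x" using f by blast
  have "\<bar>z' $ i - z $ i\<bar> \<le> int (nat \<lceil>CS\<rceil>)" for i
  proof (cases "T z \<in> TL")
    case False
    then have "diameter (S (T z) \<union> T z) \<le> CS * h" using S z unfolding element_map_def by blast
    then have "diameter (T z' \<union> T z) \<le> CS * h" using z'(2) False by simp
    then show ?thesis by (intro cells_close[OF h, of a z' "T z' \<union> T z" z]) (auto simp: compact_imp_bounded)
  qed (use z'(2) in simp)
  moreover have "L2_proj p (T z) (disc_ext p (T ` Z) TL S f) = g"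
  proof (rule L2_proj_of_poly[OF h g(1)])
    show "disc_ext p (T ` Z) TL S f x = 0" if "x \<in> T z - interior (T z)" for x by (rule disc_ext_boundary[OF that])
    show "disc_ext p (T ` Z) TL S f x = g x" if x: "x \<in> interior (T z)" for x
      using z'(2) g(2)[of x] poly_ext_facts[OF g, of z'] x interior_subset[of "T z"]
      unfolding disc_ext_interior[OF z x] by (auto split: if_splits)
  qed
  ultimately show ?thesis using z'(1) g by blast
qed

text \<open>The radius of the patch adds up three displacements: \<open>R1\<close> for each of the
  two interpolations and the offset of the element map between them. The constant is the product of
  the corresponding three bounds.\<close>

theorem ext_interp_error:
  fixes w :: "real^'n \<Rightarrow> real"
  assumes \<kappa>: "interp_weights (T ` Z) I \<phi> \<kappa>" and TL: "TL \<subseteq> T ` Z" and S: "element_map CS h (T ` Z) TL S"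
    and w: "w \<in> borel_measurable borel" "integrable lborel (\<lambda>x. (w x)\<^sup>2)"
    and Cp: "Cp \<ge> 0" "\<And>(b :: real^'n) b' q. q \<in> Qpoly p \<Longrightarrow> (\<And>i. \<bar>b' $ i - b $ i\<bar> \<le> real (nat \<lceil>CS\<rceil>) * h) \<Longrightarrow> l2sq (cube b' h) q \<le> ennreal Cp * l2sq (cube b h) q"
    and q: "q \<in> Qpoly p" and z: "z \<in> Z"
  defines "R1 \<equiv> nat \<lceil>C1\<rceil>"
  defines "K \<equiv> \<bar>C2\<bar> / c2 * real ((2 * R1 + 1) ^ CARD('n))"
  shows "l2sq (T z) (\<lambda>x. ext_op p (T ` Z) TL S I \<phi> \<kappa> (interp p (T ` Z) I \<phi> \<kappa> w) x - q x)
    \<le> ennreal (K * (Cp * K)) * l2sq (patch (2 * R1 + nat \<lceil>CS\<rceil>) h a z) (\<lambda>x. w x - q x)"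
proof -
  let ?R2 = "nat \<lceil>CS\<rceil>"
  define X where "X = l2sq (patch (2 * R1 + ?R2) h a z) (\<lambda>x. w x - q x)"
  define f1 where "f1 = interp p (T ` Z) I \<phi> \<kappa> w"
  define D where "D = disc_ext p (T ` Z) TL S f1"
  have K0: "K \<ge> 0" using c2 by (simp add: K_def)
  \<comment> \<open>A bound common to all neighbours turns the sum over \<open>Nb\<close> into its
    maximal cardinality, which is absorbed into \<open>K\<close>.\<close>
  have nb_sum: "ennreal (\<bar>C2\<bar> / c2) * (\<Sum>z''\<in>Nb Z z'. B z'') \<le> ennreal K * M" if "\<And>z''. z'' \<in> Nb Z z' \<Longrightarrow> B z'' \<le> M" for B M z'
  proof -
    have "(\<Sum>z''\<in>Nb Z z'. B z'') \<le> of_nat (card (Nb Z z')) * M" using that by (rule sum_bounded_above)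
    also have "\<dots> \<le> of_nat ((2 * R1 + 1) ^ CARD('n)) * M"
      using Nb_finite_card(2)[of Z z'] by (intro mult_right_mono of_nat_mono) (auto simp: R1_def)
    finally have "ennreal (\<bar>C2\<bar> / c2) * (\<Sum>z''\<in>Nb Z z'. B z'') \<le> ennreal (\<bar>C2\<bar> / c2) * (of_nat ((2 * R1 + 1) ^ CARD('n)) * M)"
      by (intro mult_left_mono) auto
    also have "\<dots> = ennreal K * M"
    proof -
      have "ennreal K = ennreal (\<bar>C2\<bar> / c2) * ennreal (real ((2 * R1 + 1) ^ CARD('n)))"
        unfolding K_def using c2 by (intro ennreal_mult') simp
      then show ?thesis by (simp only: ennreal_of_nat_eq_real_of_nat mult.assoc)
    qed
    finally show ?thesis .
  qed
  have wi: "set_integrable lborel (T z') (\<lambda>x. (w x)\<^sup>2)" for z'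
    unfolding set_integrable_def using w(2) by (intro integrable_mult_indicator) auto
  note Pw = L2_proj_facts[OF h w(1) wi, where p = p]
  have f1_err: "l2sq (T z') (\<lambda>x. f1 x - q x) \<le> ennreal K * X"
    if z': "z' \<in> Z" "\<And>i. \<bar>z' $ i - z $ i\<bar> \<le> int (R1 + ?R2)" for z'
  proof -
    have "l2sq (T z') (\<lambda>x. f1 x - q x) \<le> ennreal (\<bar>C2\<bar> / c2) * (\<Sum>z''\<in>Nb Z z'. l2sq (T z'') (\<lambda>x. L2_proj p (T z'') w x - q x))"
      unfolding f1_def by (rule interp_error[OF \<kappa> z'(1) q Pw(1)])
    also have "\<dots> \<le> ennreal K * X"
    proof (rule nb_sum)
      fix z'' assume z'': "z'' \<in> Nb Z z'"
      have "l2sq (T z'') (\<lambda>x. L2_proj p (T z'') w x - q x) \<le> l2sq (T z'') (\<lambda>x. w x - q x)"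
        by (rule L2_proj_best[OF h w(1) wi q])
      also have "\<dots> \<le> X" unfolding X_def
      proof (rule l2sq_mono, rule cell_subset_patch[OF h])
        fix i
        show "\<bar>z'' $ i - z $ i\<bar> \<le> int (2 * R1 + ?R2)"
          using Nb_close[OF z'', of i] z'(2)[of i] unfolding R1_def by linarith
      qed
      finally show "l2sq (T z'') (\<lambda>x. L2_proj p (T z'') w x - q x) \<le> X" .
    qed
    finally show ?thesis .
  qed
  have proj: "\<exists>z''\<in>Z. \<exists>g\<in>Qpoly p. (\<forall>i. \<bar>z'' $ i - z' $ i\<bar> \<le> int ?R2) \<and> (\<forall>x\<in>T z''. f1 x = g x) \<and> L2_proj p (T z') D = g"
    if "z' \<in> Z" for z'
    unfolding D_def f1_def by (rule L2_proj_disc_ext[OF S TL that interp_poly])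
  have D_err: "l2sq (T z') (\<lambda>x. L2_proj p (T z') D x - q x) \<le> ennreal (Cp * K) * X"
    if z': "z' \<in> Z" and near: "\<And>i. \<bar>z' $ i - z $ i\<bar> \<le> int R1" for z'
  proof -
    obtain z'' g where z'': "z'' \<in> Z" and g: "g \<in> Qpoly p" "\<And>x. x \<in> T z'' \<Longrightarrow> f1 x = g x"
      and close: "\<And>i. \<bar>z'' $ i - z' $ i\<bar> \<le> int ?R2" and P: "L2_proj p (T z') D = g"
      using proj[OF z'] by blast
    have "l2sq (T z') (\<lambda>x. g x - q x) \<le> ennreal Cp * l2sq (T z'') (\<lambda>x. g x - q x)"
      unfolding cell_def
    proof (rule Cp(2)[OF Qpoly_diff[OF g(1) q]])
      fix i
      have "\<bar>real_of_int (z' $ i) - of_int (z'' $ i)\<bar> \<le> real ?R2" using close[of i] by linarith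
      then have "h * \<bar>real_of_int (z' $ i) - of_int (z'' $ i)\<bar> \<le> h * real ?R2" using h by (intro mult_left_mono) auto
      then show "\<bar>(\<chi> i. a $ i + h * of_int (z' $ i)) $ i - (\<chi> i. a $ i + h * of_int (z'' $ i)) $ i\<bar> \<le> real ?R2 * h"
        using h by (simp add: abs_mult right_diff_distrib[symmetric] mult.commute)
    qed
    also have "l2sq (T z'') (\<lambda>x. g x - q x) = l2sq (T z'') (\<lambda>x. f1 x - q x)" using g(2) by (intro l2sq_cong) simp
    also have "ennreal Cp * \<dots> \<le> ennreal Cp * (ennreal K * X)"
    proof (intro mult_left_mono f1_err[OF z''])
      fix i show "\<bar>z'' $ i - z $ i\<bar> \<le> int (R1 + ?R2)" using close[of i] near[of i] by linarith
    qed simp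
    also have "\<dots> = ennreal (Cp * K) * X" using Cp(1) by (simp add: ennreal_mult' mult.assoc)
    finally show ?thesis using P by simp
  qed
  have Dpoly: "L2_proj p (T z') D \<in> Qpoly p" if "z' \<in> Z" for z' using proj[OF that] by blast
  have "l2sq (T z) (\<lambda>x. ext_op p (T ` Z) TL S I \<phi> \<kappa> f1 x - q x)
     \<le> ennreal (\<bar>C2\<bar> / c2) * (\<Sum>z'\<in>Nb Z z. l2sq (T z') (\<lambda>x. L2_proj p (T z') D x - q x))"
    unfolding ext_op_def D_def[symmetric] by (rule interp_error[OF \<kappa> z q Dpoly])
  also have "\<dots> \<le> ennreal K * (ennreal (Cp * K) * X)"
  proof (rule nb_sum)
    fix z' assume z': "z' \<in> Nb Z z"
    then show "l2sq (T z') (\<lambda>x. L2_proj p (T z') D x - q x) \<le> ennreal (Cp * K) * X"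
      using Nb_close[OF z'] by (intro D_err) (auto simp: Nb_def R1_def)
  qed
  also have "\<dots> = ennreal (K * (Cp * K)) * X"
    using K0 by (simp add: ennreal_mult' mult.assoc)
  finally show ?thesis unfolding X_def f1_def .
qed

end

section \<open>Sobolev functions on the whole space\<close>

text \<open>If the minimum is \<open>real p + 1\<close>, it is an integer, so no fractional seminorm
  is involved and only derivatives of order at most \<open>p + 1\<close> are required.\<close>

lemma sobolev_min_subset:
  assumes v: "v \<in> sobolev r U"
  shows "v \<in> sobolev (min r (real p + 1)) U"
proof (cases "r \<le> real p + 1")
  case False
  then have s: "min r (real p + 1) = real (Suc p)" by simp
  have "Suc p \<le> nat \<lfloor>r\<rfloor>" using False by (simp add: le_nat_iff le_floor_iff)
  then show ?thesis using v unfolding s by (auto simp: sobolev_def simp flip: of_nat_Suc)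
qed (use v in \<open>simp add: min_def\<close>)

lemma L2_space_UNIV: "u \<in> L2_space UNIV \<longleftrightarrow> u \<in> borel_measurable borel \<and> integrable lborel (\<lambda>x. (u x)\<^sup>2)"
  by (simp add: L2_space_def set_borel_measurable_def set_integrable_def)

text \<open>Membership provides some square integrable weak derivative; the chosen representative
  agrees with it almost everywhere and inherits the integrability.\<close>

lemma sobolev_weak_deriv:
  assumes w: "w \<in> sobolev s UNIV" and \<alpha>: "size \<alpha> \<le> nat \<lfloor>s\<rfloor>"
  shows "has_weak_deriv UNIV \<alpha> w (weak_deriv UNIV \<alpha> w)" (is ?A)
    and "integrable lborel (\<lambda>x. (weak_deriv UNIV \<alpha> w x)\<^sup>2)" (is ?B)
    and "weak_deriv UNIV \<alpha> w \<in> borel_measurable borel" (is ?C)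
proof -
  obtain w' where w': "has_weak_deriv UNIV \<alpha> w w'" "w' \<in> L2_space UNIV" using w \<alpha> by (auto simp: sobolev_def)
  show A: ?A by (rule has_weak_deriv_weak_deriv[OF w'(1)])
  show C: ?C using locally_integrable_measurable[of "weak_deriv UNIV \<alpha> w"] A by (simp add: has_weak_deriv_def)
  have ae: "AE x in lborel. x \<in> UNIV \<longrightarrow> w' x = weak_deriv UNIV \<alpha> w x"
    by (rule has_weak_deriv_unique[OF open_UNIV w'(1) A])
  show ?B
  proof (rule integrable_cong_AE_imp)
    show "integrable lborel (\<lambda>x. (w' x)\<^sup>2)" using w'(2) by (simp add: L2_space_UNIV)
    show "(\<lambda>x. (weak_deriv UNIV \<alpha> w x)\<^sup>2) \<in> borel_measurable lborel" using C by simp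
    show "AE x in lborel. (w' x)\<^sup>2 = (weak_deriv UNIV \<alpha> w x)\<^sup>2" using ae by eventually_elim simp
  qed
qed

lemma sobolev_function_facts:
  assumes w: "w \<in> sobolev s UNIV"
  shows "w \<in> borel_measurable borel" "integrable lborel (\<lambda>x. (w x)\<^sup>2)"
    "AE x in lborel. weak_deriv UNIV {#} w x = w x"
proof -
  show "w \<in> borel_measurable borel" "integrable lborel (\<lambda>x. (w x)\<^sup>2)"
    using w by (auto simp: sobolev_def L2_space_UNIV)
  have A: "has_weak_deriv UNIV {#} w (weak_deriv UNIV {#} w)" by (rule sobolev_weak_deriv[OF w]) simp
  then have "has_weak_deriv UNIV {#} w w" by (intro has_weak_deriv_empty) (simp add: has_weak_deriv_def)
  from has_weak_deriv_unique[OF open_UNIV A this] show "AE x in lborel. weak_deriv UNIV {#} w x = w x" by simp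
qed

lemma sobolev_norm_nonneg: "sobolev_norm s U u \<ge> 0"
proof -
  have "0 \<le> (LINT x:U|lborel. (weak_deriv U \<alpha> u x)\<^sup>2)" for \<alpha>
    unfolding set_lebesgue_integral_def by (rule integral_nonneg_AE) (auto split: split_indicator)
  then show ?thesis unfolding sobolev_norm_def
    by (intro real_sqrt_ge_zero add_nonneg_nonneg sum_nonneg) (auto intro: sum_nonneg)
qed

lemma sob_density_integral_le:
  assumes w: "w \<in> sobolev s UNIV"
  defines "W \<equiv> \<lambda>\<alpha>. weak_deriv UNIV \<alpha> w"
  shows "(\<integral>\<^sup>+x. sob_density s W x \<partial>lborel) \<le> ennreal ((sobolev_norm s UNIV w)\<^sup>2)"
proof -
  let ?N = "nat \<lfloor>s\<rfloor>"
  let ?L = "\<lambda>\<alpha>. LINT x:UNIV|lborel. (W \<alpha> x)\<^sup>2"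
  have Wm [measurable]: "W \<alpha> \<in> borel_measurable borel" if "size \<alpha> \<le> ?N" for \<alpha>
    unfolding W_def by (rule sobolev_weak_deriv(3)[OF w that])
  have L0: "0 \<le> ?L \<alpha>" for \<alpha>
    unfolding set_lebesgue_integral_def by (rule integral_nonneg_AE) simp
  show ?thesis
  proof (cases "frac s = 0")
    case True
    have "(\<integral>\<^sup>+x. sob_density s W x \<partial>lborel) = (\<integral>\<^sup>+x. (\<Sum>\<beta> | size \<beta> = ?N. ennreal ((W \<beta> x)\<^sup>2)) \<partial>lborel)"
      using True by (intro nn_integral_cong) (simp add: sob_density_def del: sum_ennreal)
    also have "\<dots> = (\<Sum>\<beta> | size \<beta> = ?N. \<integral>\<^sup>+x. ennreal ((W \<beta> x)\<^sup>2) \<partial>lborel)"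
      using Wm by (intro nn_integral_sum) auto
    also have "\<dots> = (\<Sum>\<beta> | size \<beta> = ?N. ennreal (?L \<beta>))"
    proof (rule sum.cong[OF refl])
      fix \<beta> :: "'a multiset" assume "\<beta> \<in> {\<beta>. size \<beta> = ?N}"
      then have "integrable lborel (\<lambda>x. (W \<beta> x)\<^sup>2)" unfolding W_def by (intro sobolev_weak_deriv(2)[OF w]) simp
      then show "(\<integral>\<^sup>+x. ennreal ((W \<beta> x)\<^sup>2) \<partial>lborel) = ennreal (?L \<beta>)"
        by (simp add: nn_integral_eq_integral set_lebesgue_integral_def)
    qed
    also have "\<dots> = ennreal (\<Sum>\<beta> | size \<beta> = ?N. ?L \<beta>)" using L0 by (intro sum_ennreal) auto
    also have "\<dots> \<le> ennreal ((sobolev_norm s UNIV w)\<^sup>2)"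
    proof (rule ennreal_leI)
      have "(\<Sum>\<beta> | size \<beta> = ?N. ?L \<beta>) \<le> (\<Sum>\<beta> | size \<beta> \<le> ?N. ?L \<beta>)" using L0 by (intro sum_mono2) auto
      then show "(\<Sum>\<beta> | size \<beta> = ?N. ?L \<beta>) \<le> (sobolev_norm s UNIV w)\<^sup>2"
        using True L0 by (simp add: sobolev_norm_def W_def sum_nonneg)
    qed
    finally show ?thesis .
  next
    case False
    let ?S = "\<lambda>\<beta>. slobodeckij (frac s) UNIV (W \<beta>)"
    \<comment> \<open>Without finiteness the conversion by \<open>enn2real\<close> inside the norm
      would replace an infinite seminorm by 0.\<close>
    have fin: "?S \<beta> < \<infinity>" if "size \<beta> = ?N" for \<beta> using w False that by (simp add: sobolev_def W_def)
    have "(\<integral>\<^sup>+x. sob_density s W x \<partial>lborel) = (\<integral>\<^sup>+x. (\<Sum>\<beta> | size \<beta> = ?N.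
        \<integral>\<^sup>+y. ennreal ((W \<beta> x - W \<beta> y)\<^sup>2 / norm (x - y) powr (real CARD('a) + 2 * frac s)) \<partial>lborel) \<partial>lborel)"
      using False by (intro nn_integral_cong) (simp add: sob_density_def)
    also have "\<dots> = (\<Sum>\<beta> | size \<beta> = ?N. \<integral>\<^sup>+x.
        \<integral>\<^sup>+y. ennreal ((W \<beta> x - W \<beta> y)\<^sup>2 / norm (x - y) powr (real CARD('a) + 2 * frac s)) \<partial>lborel \<partial>lborel)"
      using Wm by (intro nn_integral_sum) auto
    also have "\<dots> = (\<Sum>\<beta> | size \<beta> = ?N. ?S \<beta>)"
      by (simp add: slobodeckij_def)
    also have "\<dots> = (\<Sum>\<beta> | size \<beta> = ?N. ennreal (enn2real (?S \<beta>)))"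
      using fin by (intro sum.cong) auto
    also have "\<dots> = ennreal (\<Sum>\<beta> | size \<beta> = ?N. enn2real (?S \<beta>))" by (intro sum_ennreal) auto
    also have "\<dots> \<le> ennreal ((sobolev_norm s UNIV w)\<^sup>2)"
    proof (rule ennreal_leI)
      have "0 \<le> (\<Sum>\<beta> | size \<beta> \<le> ?N. ?L \<beta>)" using L0 by (intro sum_nonneg) auto
      moreover have "0 \<le> (\<Sum>\<beta> | size \<beta> = ?N. enn2real (?S \<beta>))" by (intro sum_nonneg) auto
      ultimately show "(\<Sum>\<beta> | size \<beta> = ?N. enn2real (?S \<beta>)) \<le> (sobolev_norm s UNIV w)\<^sup>2"
        using False by (simp add: sobolev_norm_def W_def)
    qed
    finally show ?thesis .
  qed
qed

text \<open>If the square of \<open>f\<close> is not integrable on \<open>U\<close>, the Bochner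
  integral is 0 and the bound holds because \<open>X\<close> is nonnegative. This suits the chosen
  weak derivatives, whose values off \<open>U\<close> are uncontrolled.\<close>

lemma set_integral_square_le:
  assumes g: "l2sq U g \<le> ennreal X" "0 \<le> X" and fg: "AE x in lborel. x \<in> U \<longrightarrow> f x = g x"
  shows "(LINT x:U|lborel. (f x)\<^sup>2) \<le> X"
proof (cases "integrable lborel (\<lambda>x. indicator U x *\<^sub>R (f x)\<^sup>2)")
  case True
  have "ennreal (LINT x:U|lborel. (f x)\<^sup>2) = (\<integral>\<^sup>+x. ennreal (indicator U x *\<^sub>R (f x)\<^sup>2) \<partial>lborel)"
    unfolding set_lebesgue_integral_def
    by (rule nn_integral_eq_integral[OF True, symmetric]) (auto split: split_indicator)
  also have "\<dots> = l2sq U g" unfolding l2sq_def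
  proof (rule nn_integral_cong_AE)
    show "AE x in lborel. ennreal (indicator U x *\<^sub>R (f x)\<^sup>2) = indicator U x * ennreal ((g x)\<^sup>2)"
      using fg by eventually_elim (auto split: split_indicator)
  qed
  finally have "ennreal (LINT x:U|lborel. (f x)\<^sup>2) \<le> ennreal X" using g(1) by (rule ord_eq_le_trans)
  then show ?thesis by (simp only: ennreal_le_iff[OF g(2)])
next
  case False
  then show ?thesis using g(2) by (simp add: set_lebesgue_integral_def not_integrable_integral_eq)
qed

lemma L2_spaceI:
  assumes U: "U \<in> sets borel" and f: "f \<in> borel_measurable borel" and fin: "l2sq U f < \<infinity>"
  shows "f \<in> L2_space U"
proof -
  note [measurable] = U f
  have "integrable lborel (\<lambda>x. indicator U x *\<^sub>R (f x)\<^sup>2)"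
  proof (rule integrableI_nonneg)
    have "(\<integral>\<^sup>+x. ennreal (indicator U x *\<^sub>R (f x)\<^sup>2) \<partial>lborel) = l2sq U f"
      unfolding l2sq_def by (intro nn_integral_cong) (auto split: split_indicator)
    then show "(\<integral>\<^sup>+x. ennreal (indicator U x *\<^sub>R (f x)\<^sup>2) \<partial>lborel) < \<infinity>" using fin by simp
  qed (auto split: split_indicator)
  then show ?thesis unfolding L2_space_def set_integrable_def set_borel_measurable_def by simp
qed

lemma l2sq_cong_AE: "AE x in lborel. f x = g x \<Longrightarrow> l2sq U f = l2sq U g"
  unfolding l2sq_def by (rule nn_integral_cong_AE) (auto elim: eventually_mono)

section \<open>The error on a cell and the global estimate\<close>

context spline_basis
begin

text \<open>On the cell, \<open>f\<close> is a polynomial \<open>g\<close>, and the error is split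
  at the derivative of the approximating polynomial \<open>q\<close>. The first part is the
  approximation error on the patch; the second is a derivative of the polynomial
  \<open>q - g\<close>, where the inverse inequality loses exactly the powers of \<open>h\<close>
  that separate it from the estimate without derivatives.\<close>

lemma derivative_error:
  fixes w :: "real^'n \<Rightarrow> real"
  assumes \<kappa>: "interp_weights (T ` Z) I \<phi> \<kappa>" and TL: "TL \<subseteq> T ` Z" and S: "element_map CS h (T ` Z) TL S"
    and Cp: "Cp \<ge> 0" "\<And>(b :: real^'n) b' q. q \<in> Qpoly p \<Longrightarrow> (\<And>i. \<bar>b' $ i - b $ i\<bar> \<le> real (nat \<lceil>CS\<rceil>) * h) \<Longrightarrow> l2sq (cube b' h) q \<le> ennreal Cp * l2sq (cube b h) q"
    and Ci: "Ci \<ge> 0" "\<And>(b :: real^'n) q js. length js \<le> m \<Longrightarrow> q \<in> Qpoly p \<Longrightarrow> l2sq (cube b h) (pd js q) \<le> ennreal (Ci / h ^ (2 * length js)) * l2sq (cube b h) q"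
    and CB: "CB \<ge> 0" "\<And>(w :: real^'n \<Rightarrow> real) W b h. (\<And>\<alpha>. size \<alpha> \<le> nat \<lfloor>s\<rfloor> \<Longrightarrow> has_weak_deriv UNIV \<alpha> w (W \<alpha>) \<and> integrable lborel (\<lambda>x. (W \<alpha> x)\<^sup>2)) \<Longrightarrow> h > 0 \<Longrightarrow>
     (\<exists>q\<in>Qpoly p. \<forall>\<alpha>. size \<alpha> \<le> nat \<lfloor>s\<rfloor> \<longrightarrow>
        l2sq (cube b h) (\<lambda>x. W \<alpha> x - multi_deriv \<alpha> q x)
        \<le> ennreal (CB * h powr (2 * (s - real (size \<alpha>)))) * (\<integral>\<^sup>+x. indicator (cube b h) x * sob_density s W x \<partial>lborel))"
    and w: "w \<in> sobolev s UNIV" and z: "z \<in> Z" and js: "length js \<le> m" and ms: "real m \<le> s"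
  defines "R \<equiv> 2 * nat \<lceil>C1\<rceil> + nat \<lceil>CS\<rceil>"
  defines "K \<equiv> \<bar>C2\<bar> / c2 * real ((2 * nat \<lceil>C1\<rceil> + 1) ^ CARD('n))"
  defines "W \<equiv> \<lambda>\<alpha>. weak_deriv UNIV \<alpha> w"
  defines "f \<equiv> ext_op p (T ` Z) TL S I \<phi> \<kappa> (interp p (T ` Z) I \<phi> \<kappa> w)"
  shows "l2sq (T z) (\<lambda>x. W (mset js) x - pd js f x)
    \<le> ennreal (2 * (CB * (2 * real R + 1) powr (2 * s)) * (1 + Ci * (K * (Cp * K))) * h powr (2 * (s - real (length js))))
       * (\<integral>\<^sup>+x. indicator (patch R h a z) x * sob_density s W x \<partial>lborel)"
proof -
  let ?P = "patch R h a z"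
  define F where "F = (\<integral>\<^sup>+x. indicator (patch R h a z) x * sob_density s W x \<partial>lborel)"
  define H where "H = (2 * real R + 1) * h"
  define M where "M = K * (Cp * K)"
  have H: "H > 0" using h by (simp add: H_def)
  have K0: "K \<ge> 0" using c2 by (simp add: K_def)
  have M0: "M \<ge> 0" using K0 Cp(1) by (simp add: M_def)
  have jN: "length js \<le> nat \<lfloor>s\<rfloor>" using js ms by (simp add: le_nat_iff le_floor_iff)
  obtain q where q: "q \<in> Qpoly p" and qb: "\<And>\<alpha>. size \<alpha> \<le> nat \<lfloor>s\<rfloor> \<Longrightarrow>
      l2sq ?P (\<lambda>x. W \<alpha> x - multi_deriv \<alpha> q x) \<le> ennreal (CB * H powr (2 * (s - real (size \<alpha>)))) * F"
    using CB(2)[OF conjI[OF sobolev_weak_deriv(1,2)[OF w]] H, of "\<chi> i. a $ i + h * (of_int (z $ i) - real R)"]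
    unfolding W_def patch_def H_def[symmetric] F_def by blast
  have qC: "Ck j q" for j by (rule Ck_Qpoly[OF q])
  have Wm: "W \<alpha> \<in> borel_measurable borel" if "size \<alpha> \<le> nat \<lfloor>s\<rfloor>" for \<alpha>
    unfolding W_def by (rule sobolev_weak_deriv(3)[OF w that])
  \<comment> \<open>The patch has side \<open>(2 * real R + 1) * h\<close>. Its base factor is at
    least 1 and the exponents do not exceed \<open>2 * s\<close>, so this single constant serves all
    orders.\<close>
  define \<rho> where "\<rho> = (2 * real R + 1) powr (2 * s)"
  have Hpow: "H powr (2 * (s - real j)) \<le> \<rho> * h powr (2 * (s - real j))" if "j \<le> m" for j
  proof -
    have "H powr (2 * (s - real j)) = (2 * real R + 1) powr (2 * (s - real j)) * h powr (2 * (s - real j))"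
      using h unfolding H_def by (intro powr_mult)
    also have "\<dots> \<le> \<rho> * h powr (2 * (s - real j))"
      unfolding \<rho>_def by (intro mult_right_mono powr_mono) auto
    finally show ?thesis .
  qed
  have qb': "l2sq ?P (\<lambda>x. W (mset is) x - pd is q x) \<le> ennreal (CB * (\<rho> * h powr (2 * (s - real (length is))))) * F"
    if "length is \<le> m" for "is"
  proof -
    have "length is \<le> nat \<lfloor>s\<rfloor>" using that ms by (simp add: le_nat_iff le_floor_iff)
    then have "l2sq ?P (\<lambda>x. W (mset is) x - pd is q x) \<le> ennreal (CB * H powr (2 * (s - real (length is)))) * F"
      using qb[of "mset is"] multi_deriv_eq_pd[of "is" "mset is" q, OF refl qC] by simp
    also have "\<dots> \<le> ennreal (CB * (\<rho> * h powr (2 * (s - real (length is))))) * F"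
      using Hpow[OF that] CB(1) by (intro mult_right_mono ennreal_leI mult_left_mono) auto
    finally show ?thesis .
  qed
  obtain g where g: "g \<in> Qpoly p" "\<And>x. x \<in> T z \<Longrightarrow> f x = g x"
    using interp_poly unfolding f_def ext_op_def by blast
  have gC: "Ck j g" for j by (rule Ck_Qpoly[OF g(1)])
  have pdfg: "pd js f x = pd js g x" if "x \<in> interior (T z)" for x
    using g(2) interior_subset[of "T z"] that by (intro pd_cong_open[OF open_interior _ gC]) auto
  have qg: "(\<lambda>x. q x - g x) \<in> Qpoly p" by (rule Qpoly_diff[OF q g(1)])
  have sub: "T z \<subseteq> ?P" by (rule cell_subset_patch[OF h]) simp
  have fq: "l2sq (T z) (\<lambda>x. q x - g x) \<le> ennreal M * (ennreal (CB * (\<rho> * h powr (2 * s))) * F)"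
  proof -
    have "l2sq (T z) (\<lambda>x. q x - g x) = l2sq (T z) (\<lambda>x. f x - q x)"
      unfolding l2sq_def using g(2) by (intro nn_integral_cong) (auto split: split_indicator simp: power2_commute)
    also have "\<dots> \<le> ennreal M * l2sq ?P (\<lambda>x. w x - q x)"
      unfolding f_def M_def K_def R_def
      by (rule ext_interp_error[OF \<kappa> TL S sobolev_function_facts(1,2)[OF w] Cp q z])
    \<comment> \<open>The weak derivative of order zero is a chosen representative as well, equal to
      \<open>w\<close> only almost everywhere.\<close>
    also have "l2sq ?P (\<lambda>x. w x - q x) = l2sq ?P (\<lambda>x. W (mset []) x - pd [] q x)"
      using sobolev_function_facts(3)[OF w] by (intro l2sq_cong_AE) (auto simp: W_def elim: eventually_mono)
    also have "ennreal M * \<dots> \<le> ennreal M * (ennreal (CB * (\<rho> * h powr (2 * s))) * F)"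
      using qb'[of "[]"] by (intro mult_left_mono) auto
    finally show ?thesis .
  qed
  have part2: "l2sq (T z) (\<lambda>x. pd js q x - pd js g x) \<le> ennreal (Ci * M * (CB * (\<rho> * h powr (2 * (s - real (length js)))))) * F"
  proof -
    have "l2sq (T z) (\<lambda>x. pd js q x - pd js g x) = l2sq (T z) (pd js (\<lambda>x. q x - g x))"
      by (simp add: pd_diff[OF qC gC])
    also have "\<dots> \<le> ennreal (Ci / h ^ (2 * length js)) * l2sq (T z) (\<lambda>x. q x - g x)"
      unfolding cell_def by (rule Ci(2)[OF js qg])
    also have "\<dots> \<le> ennreal (Ci / h ^ (2 * length js)) * (ennreal M * (ennreal (CB * (\<rho> * h powr (2 * s))) * F))"
      by (rule mult_left_mono[OF fq]) simp
    also have "\<dots> = ennreal (Ci / h ^ (2 * length js) * (M * (CB * (\<rho> * h powr (2 * s))))) * F"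
    proof -
      have "ennreal (Ci / h ^ (2 * length js) * (M * (CB * (\<rho> * h powr (2 * s)))))
         = ennreal (Ci / h ^ (2 * length js)) * (ennreal M * ennreal (CB * (\<rho> * h powr (2 * s))))"
        using Ci(1) h M0 CB(1) by (subst ennreal_mult', simp, subst ennreal_mult', simp, simp)
      then show ?thesis by (simp only: mult.assoc)
    qed
    also have "Ci / h ^ (2 * length js) * (M * (CB * (\<rho> * h powr (2 * s)))) = Ci * M * (CB * (\<rho> * h powr (2 * (s - real (length js)))))"
    proof -
      have "h powr (2 * (s - real (length js))) = h powr (2 * s - real (2 * length js))" by (simp add: algebra_simps)
      also have "\<dots> = h powr (2 * s) / h ^ (2 * length js)" using h by (simp only: powr_diff powr_realpow)
      finally show ?thesis by (simp add: field_simps)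
    qed
    finally show ?thesis .
  qed
  have part1: "l2sq (T z) (\<lambda>x. W (mset js) x - pd js q x) \<le> ennreal (CB * (\<rho> * h powr (2 * (s - real (length js))))) * F"
    using order_trans[OF l2sq_mono[OF sub] qb'[OF js]] .
  have pm: "pd js q \<in> borel_measurable borel" "pd js g \<in> borel_measurable borel"
    using Qpoly_measurable[OF Qpoly_pd[OF q]] Qpoly_measurable[OF Qpoly_pd[OF g(1)]] by auto
  define B where "B = CB * (\<rho> * h powr (2 * (s - real (length js))))"
  have B0: "B \<ge> 0" using CB(1) by (simp add: B_def \<rho>_def)
  \<comment> \<open>Derivatives of \<open>f\<close> are identified with those of \<open>g\<close> in
    the interior only; the faces are discarded as a null set.\<close>
  have "l2sq (T z) (\<lambda>x. W (mset js) x - pd js f x) = l2sq (interior (T z)) (\<lambda>x. W (mset js) x - pd js f x)"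
    by (simp add: l2sq_cell_interior)
  also have "\<dots> = l2sq (interior (T z)) (\<lambda>x. (W (mset js) x - pd js q x) + (pd js q x - pd js g x))"
    using pdfg by (intro l2sq_cong) simp
  also have "\<dots> = l2sq (T z) (\<lambda>x. (W (mset js) x - pd js q x) + (pd js q x - pd js g x))"
    by (simp add: l2sq_cell_interior)
  also have "\<dots> \<le> 2 * l2sq (T z) (\<lambda>x. W (mset js) x - pd js q x) + 2 * l2sq (T z) (\<lambda>x. pd js q x - pd js g x)"
    using Wm[of "mset js"] jN pm by (intro l2sq_triangle) auto
  also have "\<dots> \<le> 2 * (ennreal B * F) + 2 * (ennreal (Ci * M * B) * F)"
    using part1 part2 unfolding B_def by (intro add_mono mult_left_mono) auto
  also have "\<dots> = ennreal (2 * B + 2 * (Ci * M * B)) * F"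
    using B0 Ci(1) M0 by (simp add: ennreal_plus ennreal_mult' distrib_right mult.assoc)
  also have "2 * B + 2 * (Ci * M * B) = 2 * (CB * (2 * real R + 1) powr (2 * s)) * (1 + Ci * (K * (Cp * K))) * h powr (2 * (s - real (length js)))"
    by (simp add: B_def M_def \<rho>_def algebra_simps)
  finally show ?thesis by (simp only: F_def)
qed

text \<open>The local right-hand sides are integrals of one fixed density \<open>F\<close> over
  patches, so their sum costs only the overlap number times the total integral.\<close>

lemma global_error:
  fixes f :: "real^'n \<Rightarrow> real"
  assumes cells: "\<And>z. z \<in> Z \<Longrightarrow> l2sq (T z) f \<le> ennreal A * (\<integral>\<^sup>+x. indicator (patch R h a z) x * F x \<partial>lborel)"
    and A: "A \<ge> 0" and U: "U \<subseteq> (\<Union>z\<in>Z. T z)"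
    and [measurable]: "f \<in> borel_measurable borel" "F \<in> borel_measurable borel"
    and F: "(\<integral>\<^sup>+x. F x \<partial>lborel) \<le> ennreal B" "B \<ge> 0"
  shows "l2sq U f \<le> ennreal (A * real ((2 * R + 2) ^ CARD('n)) * B)"
proof -
  have "l2sq U f \<le> (\<integral>\<^sup>+z. l2sq (T z) f \<partial>count_space Z)" by (rule l2sq_union_cells[OF U]) simp
  also have "\<dots> \<le> (\<integral>\<^sup>+z. ennreal A * (\<integral>\<^sup>+x. indicator (patch R h a z) x * F x \<partial>lborel) \<partial>count_space Z)"
    using cells by (intro nn_integral_mono) simp
  also have "\<dots> = ennreal A * (\<integral>\<^sup>+z. (\<integral>\<^sup>+x. indicator (patch R h a z) x * F x \<partial>lborel) \<partial>count_space Z)"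
    by (rule nn_integral_cmult) simp
  also have "\<dots> \<le> ennreal A * (of_nat ((2 * R + 2) ^ CARD('n)) * (\<integral>\<^sup>+x. F x \<partial>lborel))"
    by (intro mult_left_mono sum_over_patches[OF h]) auto
  also have "\<dots> \<le> ennreal A * (of_nat ((2 * R + 2) ^ CARD('n)) * ennreal B)"
    by (intro mult_left_mono F) auto
  also have "\<dots> = ennreal (A * real ((2 * R + 2) ^ CARD('n)) * B)"
    unfolding ennreal_of_nat_eq_real_of_nat using A F(2)
    by (subst ennreal_mult', simp, subst ennreal_mult') (simp_all add: mult.assoc)
  finally show ?thesis .
qed

end

theorem lemma4p4:
  fixes \<Omega> :: "(real^'n) set"
    and E :: "(real^'n \<Rightarrow> real) \<Rightarrow> (real^'n \<Rightarrow> real)"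
    and p k m N :: nat
    and r h0 \<gamma> C1 c2 C2 CS :: real
  assumes "lipschitz_domain \<Omega>"
    and "extension_operator \<Omega> E"
    and "k < p" and "m \<le> k" and "real m \<le> r"
    and "0 < h0" and "0 \<le> \<gamma>" and "0 < c2"
  shows "\<exists>C>0. \<forall>h \<in> {0<..h0}. \<forall>(a :: real^'n) (I :: 'i set) \<phi> \<kappa> S.
    let s = min r (real p + 1);
        Th = active_mesh h a \<Omega>;
        TL = large_elements \<gamma> h \<Omega> Th;
        \<Omega>h = interior (\<Union>Th)
    in is_basis (spline_space p k h a) I \<phi> \<longrightarrow>
       local_support N C1 h a I \<phi> \<longrightarrow>
       stable_local_basis p c2 C2 h a I \<phi> \<longrightarrow>
       interp_weights Th I \<phi> \<kappa> \<longrightarrow>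
       element_map CS h Th TL S \<longrightarrow>
       (\<forall>v \<in> sobolev r \<Omega>.
          let e = (\<lambda>x. E v x - ext_op p Th TL S I \<phi> \<kappa> (interp p Th I \<phi> \<kappa> (E v)) x)
          in e \<in> sobolev (real m) \<Omega>h \<and>
             sobolev_norm (real m) \<Omega>h e \<le> C * h powr (s - real m) * sobolev_norm s \<Omega> v)"
proof -
  define s where "s = min r (real p + 1)"
  have s: "0 \<le> s" "s \<le> real p + 1" "real m \<le> s" using assms(3-5) by (auto simp: s_def)
  obtain CE where CE: "\<And>u. u \<in> sobolev s \<Omega> \<Longrightarrow> E u \<in> sobolev s UNIV \<and> sobolev_norm s UNIV (E u) \<le> CE * sobolev_norm s \<Omega> u"
    using assms(2) s(1) unfolding extension_operator_def by blast
  obtain CB where CB: "CB > 0" "\<And>(w :: real^'n \<Rightarrow> real) W b h. (\<And>\<alpha>. size \<alpha> \<le> nat \<lfloor>s\<rfloor> \<Longrightarrow> has_weak_deriv UNIV \<alpha> w (W \<alpha>) \<and> integrable lborel (\<lambda>x. (W \<alpha> x)\<^sup>2)) \<Longrightarrow> h > 0 \<Longrightarrow>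
     (\<exists>q\<in>Qpoly p. \<forall>\<alpha>. size \<alpha> \<le> nat \<lfloor>s\<rfloor> \<longrightarrow>
        l2sq (cube b h) (\<lambda>x. W \<alpha> x - multi_deriv \<alpha> q x)
        \<le> ennreal (CB * h powr (2 * (s - real (size \<alpha>)))) * (\<integral>\<^sup>+x. indicator (cube b h) x * sob_density s W x \<partial>lborel))"
    using bramble_hilbert[OF s(1,2), where 'n = 'n] by blast
  let ?R2 = "nat \<lceil>CS\<rceil>"
  \<comment> \<open>No derivatives, corners up to \<open>?R2\<close> cells apart: this bounds the
    extension of a polynomial from \<open>S T\<close> to \<open>T\<close>.\<close>
  from cube_poly_bound[of 0 p "real ?R2", where 'n = 'n] obtain Cp where Cp0: "Cp \<ge> 0"
    and Cp': "\<forall>h>0. \<forall>(b :: real^'n) b' q js. length js \<le> 0 \<longrightarrow> q \<in> Qpoly p \<longrightarrow> (\<forall>i. \<bar>b' $ i - b $ i\<bar> \<le> real ?R2 * h) \<longrightarrow>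
     l2sq (cube b' h) (pd js q) \<le> ennreal (Cp / h ^ (2 * length js)) * l2sq (cube b h) q"
    by (elim exE conjE)
  have Cp: "l2sq (cube b' h) q \<le> ennreal Cp * l2sq (cube b h) q"
    if "h > 0" "q \<in> Qpoly p" "\<And>i. \<bar>b' $ i - b $ i\<bar> \<le> real ?R2 * h" for h b b' and q :: "real^'n \<Rightarrow> real"
    using Cp'[rule_format, of h "[]" q b' b] that by simp
  \<comment> \<open>No displacement, derivatives up to order \<open>m\<close>: the inverse
    inequality.\<close>
  from cube_poly_bound[of m p 0, where 'n = 'n] obtain Ci where Ci0: "Ci \<ge> 0"
    and Ci': "\<forall>h>0. \<forall>(b :: real^'n) b' q js. length js \<le> m \<longrightarrow> q \<in> Qpoly p \<longrightarrow> (\<forall>i. \<bar>b' $ i - b $ i\<bar> \<le> 0 * h) \<longrightarrow>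
     l2sq (cube b' h) (pd js q) \<le> ennreal (Ci / h ^ (2 * length js)) * l2sq (cube b h) q"
    by (elim exE conjE)
  have Ci: "l2sq (cube b h) (pd js q) \<le> ennreal (Ci / h ^ (2 * length js)) * l2sq (cube b h) q"
    if "h > 0" "length js \<le> m" "q \<in> Qpoly p" for h b js and q :: "real^'n \<Rightarrow> real"
    using Ci'[rule_format, of h js q b b] that by simp
  define R where "R = 2 * nat \<lceil>C1\<rceil> + nat \<lceil>CS\<rceil>"
  define K where "K = \<bar>C2\<bar> / c2 * real ((2 * nat \<lceil>C1\<rceil> + 1) ^ CARD('n))"
  define CL where "CL = 2 * (CB * (2 * real R + 1) powr (2 * s)) * (1 + Ci * (K * (Cp * K)))"
  \<comment> \<open>Besides the overlap number, a power of \<open>max 1 h0\<close> lets derivatives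
    of order below \<open>m\<close>, which have a higher power of \<open>h\<close>, be bounded by
    the rate for order \<open>m\<close>.\<close>
  define CG where "CG = CL * real ((2 * R + 2) ^ CARD('n)) * max 1 h0 ^ (2 * m)"
  define nm where "nm = card {\<alpha> :: 'n multiset. size \<alpha> \<le> m}"
  \<comment> \<open>The square root converts the sum of \<open>nm\<close> squared errors into a
    norm. The absolute value is taken since the sign of \<open>CE\<close> is unknown, and the
    summand 1 makes \<open>C\<close> positive.\<close>
  define C where "C = sqrt (real nm * CG) * \<bar>CE\<bar> + 1"
  have K0: "K \<ge> 0" using assms(8) by (simp add: K_def)
  have CL0: "CL \<ge> 0" using CB(1) Ci0 K0 Cp0 by (simp add: CL_def)
  have CG0: "CG \<ge> 0" using CL0 by (simp add: CG_def)
  have C0: "C > 0" using CG0 unfolding C_def by (intro add_nonneg_pos) auto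
  have main: "(\<lambda>x. E v x - ext_op p (active_mesh h a \<Omega>) (large_elements \<gamma> h \<Omega> (active_mesh h a \<Omega>)) S I \<phi> \<kappa>
          (interp p (active_mesh h a \<Omega>) I \<phi> \<kappa> (E v)) x) \<in> sobolev (real m) (interior (\<Union>(active_mesh h a \<Omega>))) \<and>
      sobolev_norm (real m) (interior (\<Union>(active_mesh h a \<Omega>))) (\<lambda>x. E v x - ext_op p (active_mesh h a \<Omega>)
          (large_elements \<gamma> h \<Omega> (active_mesh h a \<Omega>)) S I \<phi> \<kappa> (interp p (active_mesh h a \<Omega>) I \<phi> \<kappa> (E v)) x)
      \<le> C * h powr (s - real m) * sobolev_norm s \<Omega> v"
    if hh: "h \<in> {0<..h0}" and basis: "is_basis (spline_space p k h a) I \<phi>" and ls: "local_support N C1 h a I \<phi>"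
      and st: "stable_local_basis p c2 C2 h a I \<phi>" and \<kappa>: "interp_weights (active_mesh h a \<Omega>) I \<phi> \<kappa>"
      and S: "element_map CS h (active_mesh h a \<Omega>) (large_elements \<gamma> h \<Omega> (active_mesh h a \<Omega>)) S"
      and v: "v \<in> sobolev r \<Omega>"
    for h and a :: "real^'n" and I :: "'i set" and \<phi> \<kappa> S v
  proof -
    have h: "h > 0" "h \<le> h0" using hh by auto
    interpret B: spline_basis p k N h C1 c2 C2 a I \<phi>
      using h(1) assms(8) basis ls st by unfold_locales
    define Z where "Z = {z. cell h a z \<inter> \<Omega> \<noteq> {}}"
    have Th: "active_mesh h a \<Omega> = cell h a ` Z" by (auto simp: active_mesh_def uniform_mesh_cell Z_def)
    define TL where "TL = large_elements \<gamma> h \<Omega> (cell h a ` Z)"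
    have TL: "TL \<subseteq> cell h a ` Z" by (auto simp: TL_def large_elements_def)
    define U where "U = interior (\<Union>(cell h a ` Z))"
    have Uo: "open U" by (simp add: U_def)
    have Usub: "U \<subseteq> (\<Union>z\<in>Z. cell h a z)" unfolding U_def by (rule interior_subset)
    define w where "w = E v"
    define W where "W \<alpha> = weak_deriv UNIV \<alpha> w" for \<alpha>
    define f where "f = ext_op p (cell h a ` Z) TL S I \<phi> \<kappa> (interp p (cell h a ` Z) I \<phi> \<kappa> w)"
    define e where "e x = w x - f x" for x
    define Ns where "Ns = sobolev_norm s UNIV w"
    have vs: "v \<in> sobolev s \<Omega>" unfolding s_def by (rule sobolev_min_subset[OF v])
    have w: "w \<in> sobolev s UNIV" and Ns: "Ns \<le> CE * sobolev_norm s \<Omega> v" using CE[OF vs] by (auto simp: w_def Ns_def)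
    have Ns0: "Ns \<ge> 0" by (simp add: Ns_def sobolev_norm_nonneg)
    have fC: "Ck k f" unfolding f_def ext_op_def by (rule B.Ck_interp)
    have mN: "j \<le> nat \<lfloor>s\<rfloor>" if "j \<le> m" for j using that s(3) by (simp add: le_nat_iff le_floor_iff)
    have Wm: "W \<alpha> \<in> borel_measurable borel" if "size \<alpha> \<le> nat \<lfloor>s\<rfloor>" for \<alpha>
      unfolding W_def by (rule sobolev_weak_deriv(3)[OF w that])
    have Fm: "sob_density s W \<in> borel_measurable borel" by (rule sob_density_measurable) (simp add: Wm)
    have pdm: "pd js f \<in> borel_measurable borel" if "length js \<le> m" for js
    proof -
      have "Ck (length js + 0) f" using Ck_mono[OF fC, of "length js"] that assms(4) by simp
      from borel_measurable_continuous_onI[OF Ck_continuous[OF Ck_pd[OF this]]] show ?thesis .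
    qed
    define Xb where "Xb = CG * h powr (2 * (s - real m)) * Ns\<^sup>2"
    have Xb0: "Xb \<ge> 0" using CG0 by (simp add: Xb_def)
    have err: "l2sq U (\<lambda>x. W (mset js) x - pd js f x) \<le> ennreal Xb" if js: "length js \<le> m" for js
    proof -
      let ?A = "CL * h powr (2 * (s - real (length js)))"
      have "l2sq U (\<lambda>x. W (mset js) x - pd js f x) \<le> ennreal (?A * real ((2 * R + 2) ^ CARD('n)) * Ns\<^sup>2)"
      proof (rule B.global_error[OF _ _ Usub])
        show "l2sq (cell h a z) (\<lambda>x. W (mset js) x - pd js f x) \<le> ennreal ?A * (\<integral>\<^sup>+x. indicator (patch R h a z) x * sob_density s W x \<partial>lborel)"
          if "z \<in> Z" for z
          unfolding W_def f_def CL_def K_def R_def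
          using \<kappa> S unfolding Th TL_def[symmetric]
          by (intro B.derivative_error[OF _ TL _ Cp0 Cp[OF h(1)] Ci0 Ci[OF h(1)] less_imp_le[OF CB(1)] CB(2) w that js s(3)])
        show "(\<lambda>x. W (mset js) x - pd js f x) \<in> borel_measurable borel" using Wm[of "mset js"] mN[OF js] pdm[OF js] by simp
        show "(\<integral>\<^sup>+x. sob_density s W x \<partial>lborel) \<le> ennreal (Ns\<^sup>2)"
          using sob_density_integral_le[OF w] by (simp add: W_def[abs_def] Ns_def)
      qed (use CL0 Fm in auto)
      also have "\<dots> \<le> ennreal Xb"
      proof (rule ennreal_leI)
        have "h powr (2 * (s - real (length js))) = h powr (2 * (s - real m)) * h ^ (2 * (m - length js))"
        proof -
          have "2 * (s - real (length js)) = 2 * (s - real m) + real (2 * (m - length js))" using js by (simp add: of_nat_diff algebra_simps)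
          then show ?thesis using h(1) by (simp only: powr_add powr_realpow)
        qed
        also have "\<dots> \<le> h powr (2 * (s - real m)) * max 1 h0 ^ (2 * m)"
        proof (rule mult_left_mono)
          have "h ^ (2 * (m - length js)) \<le> max 1 h0 ^ (2 * (m - length js))" using h by (intro power_mono) auto
          also have "\<dots> \<le> max 1 h0 ^ (2 * m)" by (intro power_increasing) auto
          finally show "h ^ (2 * (m - length js)) \<le> max 1 h0 ^ (2 * m)" .
        qed simp
        finally have "CL * real ((2 * R + 2) ^ CARD('n)) * Ns\<^sup>2 * h powr (2 * (s - real (length js)))
           \<le> CL * real ((2 * R + 2) ^ CARD('n)) * Ns\<^sup>2 * (h powr (2 * (s - real m)) * max 1 h0 ^ (2 * m))"
          using CL0 by (intro mult_left_mono) auto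
        then show "?A * real ((2 * R + 2) ^ CARD('n)) * Ns\<^sup>2 \<le> Xb" by (simp add: Xb_def CG_def mult_ac)
      qed
      finally show ?thesis .
    qed
    have wd: "has_weak_deriv U (mset js) e (\<lambda>x. W (mset js) x - pd js f x)" if js: "length js \<le> m" for js
    proof -
      have W: "has_weak_deriv UNIV (mset js) w (W (mset js))"
        unfolding W_def using mN[OF js] by (intro sobolev_weak_deriv(1)[OF w]) simp
      have "length js \<le> k" using js assms(4) by simp
      from has_weak_deriv_diff[OF has_weak_deriv_mono[OF W subset_UNIV] has_weak_deriv_Ck[OF fC refl this]]
      show ?thesis unfolding e_def .
    qed
    have fm: "f \<in> borel_measurable borel" using pdm[of "[]"] by simp
    have eL2: "e \<in> L2_space U"
    proof (rule L2_spaceI)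
      show "U \<in> sets borel" using Uo by simp
      show "e \<in> borel_measurable borel" unfolding e_def using sobolev_function_facts(1)[OF w] fm by simp
      have "l2sq U e = l2sq U (\<lambda>x. W (mset []) x - pd [] f x)"
        using sobolev_function_facts(3)[OF w] by (intro l2sq_cong_AE) (auto simp: e_def W_def elim: eventually_mono)
      also have "\<dots> < \<infinity>" using le_less_trans[OF err[of "[]"] ennreal_less_top] by simp
      finally show "l2sq U e < \<infinity>" .
    qed
    have DL2: "(\<lambda>x. W (mset js) x - pd js f x) \<in> L2_space U" if js: "length js \<le> m" for js
    proof (rule L2_spaceI)
      show "U \<in> sets borel" using Uo by simp
      show "(\<lambda>x. W (mset js) x - pd js f x) \<in> borel_measurable borel" using Wm[of "mset js"] mN[OF js] pdm[OF js] by simp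
      show "l2sq U (\<lambda>x. W (mset js) x - pd js f x) < \<infinity>" using le_less_trans[OF err[OF js] ennreal_less_top] by simp
    qed
    have sob: "e \<in> sobolev (real m) U"
    proof -
      have "\<exists>w'. has_weak_deriv U \<alpha> e w' \<and> w' \<in> L2_space U" if "size \<alpha> \<le> m" for \<alpha>
      proof -
        obtain js where js: "mset js = \<alpha>" using ex_mset by blast
        then have "length js \<le> m" using that by auto
        then show ?thesis using wd[of js] DL2[of js] js by blast
      qed
      then show ?thesis using eL2 by (simp add: sobolev_def)
    qed
    have each: "(LINT x:U|lborel. (weak_deriv U \<alpha> e x)\<^sup>2) \<le> Xb" if "size \<alpha> \<le> m" for \<alpha>
    proof -
      obtain js where js: "mset js = \<alpha>" using ex_mset by blast
      then have l: "length js \<le> m" using that by auto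
      \<comment> \<open>The norm involves a chosen weak derivative of \<open>e\<close> on
        \<open>U\<close>; uniqueness on the open set \<open>U\<close> identifies it with the
        explicit error derivative estimated above.\<close>
      have "AE x in lborel. x \<in> U \<longrightarrow> weak_deriv U \<alpha> e x = W (mset js) x - pd js f x"
        using has_weak_deriv_unique[OF Uo has_weak_deriv_weak_deriv[OF wd[OF l]] wd[OF l]] js by simp
      then show ?thesis by (rule set_integral_square_le[OF err[OF l] Xb0])
    qed
    have "sobolev_norm (real m) U e = sqrt (\<Sum>\<alpha> | size \<alpha> \<le> m. LINT x:U|lborel. (weak_deriv U \<alpha> e x)\<^sup>2)"
      by (simp add: sobolev_norm_def)
    also have "\<dots> \<le> sqrt (real nm * Xb)"
      unfolding nm_def using each by (intro real_sqrt_le_mono sum_bounded_above) simp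
    also have "real nm * Xb = (real nm * CG) * (h powr (s - real m) * Ns)\<^sup>2"
    proof -
      have "h powr (2 * (s - real m)) = (h powr (s - real m))\<^sup>2"
        by (simp add: power2_eq_square powr_add[symmetric])
      then show ?thesis by (simp add: Xb_def power_mult_distrib)
    qed
    also have "sqrt \<dots> = sqrt (real nm * CG) * (h powr (s - real m) * Ns)"
      using Ns0 by (simp add: real_sqrt_mult)
    also have "\<dots> \<le> sqrt (real nm * CG) * (h powr (s - real m) * (\<bar>CE\<bar> * sobolev_norm s \<Omega> v))"
    proof -
      have "Ns \<le> \<bar>CE\<bar> * sobolev_norm s \<Omega> v"
        using Ns mult_right_mono[OF abs_ge_self[of CE] sobolev_norm_nonneg[of s \<Omega> v]] by linarith
      then show ?thesis using CG0 by (intro mult_left_mono) auto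
    qed
    also have "\<dots> \<le> C * h powr (s - real m) * sobolev_norm s \<Omega> v"
      using sobolev_norm_nonneg[of s \<Omega> v] by (simp add: C_def algebra_simps)
    finally have "sobolev_norm (real m) U e \<le> C * h powr (s - real m) * sobolev_norm s \<Omega> v" .
    with sob show ?thesis unfolding Th U_def[symmetric] TL_def[symmetric] w_def[symmetric] f_def[symmetric] e_def by blast
  qed
  show ?thesis
    unfolding Let_def s_def[symmetric]
    by (rule exI[of _ C], intro conjI[OF C0] ballI allI impI, rule main)
qed

end
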